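(* Let $1\le p\le\infty$, let $l,m\ge 0$ be integers and $0<\alpha,\beta\le 1$ with $l+\alpha\le m+\beta$. Let $X\in\mathcal{C}^{l,\alpha}([0,1],M)\cap\mathcal{CB}^{m,\beta}((0,1],c(\cdot),V(\cdot))$ for some constant $M>0$ and positive continuous functions $c,V$ on $(0,1]$, and suppose that the mean function $f(t)=\mathrm{E}X(t)$ satisfies $f\in C^{m,\theta}([0,1],C)$ for some $\beta<\theta\le 1$ and some constant $C>0$. Let $X$ be interpolated by the composite Hermite spline $H_{q,k}(X,T_n)$, where $l\le q$, $m\le k$, and $\{T_n\}$ is a quasi regular sequence of sampling designs generated by the density $h$ (qRS$(h)$), with associated functions $H$, $G=H^{-1}$, $g=G'$. Assume that there is a function $r$, regularly varying at $0+$ (with some index), such that $g(s)\le r(s)$ for all $s\in(0,a]$ for some $a>0$, that $$r(s)=o\left(s^{(m+\beta)/(l+\alpha+1/p)-1}\right)\quad\text{as } s\to 0,$$ and that the following holds: - if $p=\infty$: $V(t)^{1/2}\,r(H(t))^{m+\beta}\to 0$ as $t\to 0$; - if $1\le p<\infty$: there is a function $R$, regularly varying at $0+$ (with some index), such that $V(G(s))^{1/2}\le R(s)$ for all $s\in(0,a']$ for some $a'>0$, and the function $t\mapsto R(H(t))\,r(H(t))^{m+\beta}$ belongs to $L_p[0,b]$ for some $b>0$. Then $$\lim_{n\to\infty} n^{m+\beta}\,\|X-H_{q,k}(X,T_n)\|_p = b^{m,\beta}_{k,p}\,\|c^{1/2}h^{-(m+\beta)}\|_p>0 .$$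
   Context: **Processes and norms.** $X=X(t)$, $t\in[0,1]$, is a real random process on a probability space with $\mathrm{E}X(t)^2<\infty$ for all $t$; $\|Z\|:=(\mathrm{E}Z^2)^{1/2}$ for a random variable $Z$. Continuity and derivatives of processes are in quadratic mean (q.m.). $\mathcal{C}^m(I)$ is the set of processes with continuous q.m. derivatives up to order $m$ on the interval $I$. For a process $Y$, $\|Y\|_p:=\left(\int_0^1\|Y(t)\|^p\,dt\right)^{1/p}$ for $1\le p<\infty$ and $\|Y\|_\infty:=\max_{t\in[0,1]}\|Y(t)\|$. For a non-random function on $(0,1]$, $\|\cdot\|_p$ is the usual $L_p$ norm (supremum over $(0,1]$ if $p=\infty$). Convention: $1/p=0$ if $p=\infty$. **Classes.** Let $0<\beta\le 1$. (i) $X\in\mathcal{C}^{m,\beta}([a,b],V(\cdot))$, with $V$ positive and continuous on $[a,b]$, if $X\in\mathcal{C}^m([a,b])$ and for all $t,t+s\in[a,b]$ we have $\|X^{(m)}(t+s)-X^{(m)}(t)\|\le V(\bar t)^{1/2}|s|^\beta$ for some $\bar t$ between $t$ and $t+s$. If $V\equiv M$ is constant, write $\mathcal{C}^{m,\beta}([a,b],M)$. For non-random functions, $C^{m,\theta}([0,1],C)$ denotes the analogous class of $m$ times continuously differentiable functions whose $m$-th derivative is $\theta$-Hölder with constant determined by $C$. (ii) $X\in\mathcal{B}^{m,\beta}([a,b],c(\cdot))$, with $c$ positive and continuous on $[a,b]$, if $X\in\mathcal{C}^m([a,b])$ and $\lim_{s\to0}\|X^{(m)}(t+s)-X^{(m)}(t)\|/|s|^\beta=c(t)^{1/2}$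 uniformly in $t\in[a,b]$. (iii) $X\in\mathcal{CB}^{m,\beta}((0,1],c(\cdot),V(\cdot))$, with $c,V$ positive and continuous on $(0,1]$, if $X\in\mathcal{C}^{m,\beta}([a,b],V(\cdot))\cap\mathcal{B}^{m,\beta}([a,b],c(\cdot))$ for every $[a,b]\subset(0,1]$. **Sampling designs.** A design is $T_n=(t_0,\dots,t_n)$ with $0=t_0<t_1<\dots<t_n=1$ (the dependence of $t_j$ on $n$ is suppressed). Let $h$ be a positive continuous probability density on $(0,1]$ such that either $h$ is unbounded at $0$ and then $h(t)\to+\infty$ as $t\to0+$, or $h\in C([0,1])$. $\{T_n\}$ is qRS$(h)$ if $\int_0^{t_i}h(t)\,dt=i/n$, $i=1,\dots,n$. Put $H(t)=\int_0^t h(u)\,du$, $G=H^{-1}$ and $g(s)=G'(s)=1/h(G(s))$; $g$ is assumed continuous on $[0,1]$, with the convention $g(0)=0$ if $h(t)\to+\infty$ as $t\to0+$. Thus $t_i=G(i/n)$. **Hermite splines.** For odd $k=2r+1$, $H_k(X,T_n)$ is the piecewise Hermite interpolant: on each $[t_{j-1},t_j]$ it is the polynomial of degree at most $k$ in $t$ (with random coefficients) whose derivatives of orders $0,\dots,r$ at $t_{j-1}$ and $t_j$ coincide with the q.m. derivatives of $X$ there. For odd $q\le k$, the composite Hermite spline $H_{q,k}(X,T_n)$ equals $H_q(X,T_n)$ on $[0,t_1]$ and $H_k(X,T_n)$ on $[t_1,1]$. It is assumed throughout that the derivatives used exist: $k\le 2m+1$ and $q\le 2l+1$. **Regular variation.**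 A positive function $r$ is regularly varying at $0+$ with index $\rho$ if $r(\lambda x)/r(x)\to\lambda^\rho$ as $x\to0+$ for every $\lambda>0$. **Constant.** Let $B(t)$, $t\in[0,1]$, be zero mean fractional Brownian motion with covariance $\frac12\left(t^{2\beta}+s^{2\beta}-|t-s|^{2\beta}\right)$; let $B_0=B$ and $B_m(t)=\frac1{(m-1)!}\int_0^1 (t-s)_+^{m-1}B(s)\,ds$ for $m\ge1$, where $(x)_+=\max(0,x)$. Then $b^{m,\beta}_{k,p}:=\|B_m-H_k(B_m)\|_p$, where $H_k(B_m)$ is the two-point Hermite interpolant of degree $k$ of $B_m$ on $[0,1]$ (knots $0$ and $1$). *)

theory Defs
  imports
    "HOL-Probability.Probability"
    "HOL-Computational_Algebra.Polynomial"
    "HOL-Library.Landau_Symbols"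
begin

section \<open>Quadratic mean calculus\<close>

text \<open>
  A process is a function \<open>X :: real \<Rightarrow> 'a \<Rightarrow> real\<close>: time first, then the sample point.
\<close>

definition sq_integrable :: "'a measure \<Rightarrow> ('a \<Rightarrow> real) \<Rightarrow> bool" where
  "sq_integrable M Z \<longleftrightarrow> Z \<in> borel_measurable M \<and> integrable M (\<lambda>\<omega>. (Z \<omega>)\<^sup>2)"

definition qm_norm :: "'a measure \<Rightarrow> ('a \<Rightarrow> real) \<Rightarrow> real" where
  "qm_norm M Z = sqrt (\<integral>\<omega>. (Z \<omega>)\<^sup>2 \<partial>M)"

definition qm_continuous_on :: "'a measure \<Rightarrow> real set \<Rightarrow> (real \<Rightarrow> 'a \<Rightarrow> real) \<Rightarrow> bool" where
  "qm_continuous_on M I X \<longleftrightarrow>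
     (\<forall>t\<in>I. ((\<lambda>s. qm_norm M (\<lambda>\<omega>. X s \<omega> - X t \<omega>)) \<longlongrightarrow> 0) (at t within I))"

definition has_qm_deriv ::
  "'a measure \<Rightarrow> real set \<Rightarrow> (real \<Rightarrow> 'a \<Rightarrow> real) \<Rightarrow> ('a \<Rightarrow> real) \<Rightarrow> real \<Rightarrow> bool" where
  "has_qm_deriv M I X Z t \<longleftrightarrow> sq_integrable M Z \<and>
     ((\<lambda>s. qm_norm M (\<lambda>\<omega>. (X s \<omega> - X t \<omega>) / (s - t) - Z \<omega>)) \<longlongrightarrow> 0) (at t within I)"

text \<open>
  Quadratic mean derivatives are determined up to almost sure equality only; a version is chosen.
  Where no derivative exists the value is arbitrary, so existence has to be stated separately
  through \<open>has_qm_deriv\<close>.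
\<close>

definition qm_deriv :: "'a measure \<Rightarrow> real set \<Rightarrow> (real \<Rightarrow> 'a \<Rightarrow> real) \<Rightarrow> real \<Rightarrow> 'a \<Rightarrow> real" where
  "qm_deriv M I X t = (SOME Z. has_qm_deriv M I X Z t)"

definition qm_derivn ::
  "'a measure \<Rightarrow> real set \<Rightarrow> nat \<Rightarrow> (real \<Rightarrow> 'a \<Rightarrow> real) \<Rightarrow> real \<Rightarrow> 'a \<Rightarrow> real" where
  "qm_derivn M I j X = (qm_deriv M I ^^ j) X"


section \<open>Smoothness classes\<close>

definition qm_C :: "'a measure \<Rightarrow> nat \<Rightarrow> real set \<Rightarrow> (real \<Rightarrow> 'a \<Rightarrow> real) set" where
  "qm_C M m I = {X. (\<forall>t\<in>I. sq_integrable M (X t)) \<and>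
     (\<forall>j<m. \<forall>t\<in>I. has_qm_deriv M I (qm_derivn M I j X) (qm_derivn M I (Suc j) X t) t) \<and>
     (\<forall>j\<le>m. qm_continuous_on M I (qm_derivn M I j X))}"

definition pos_cont_on :: "real set \<Rightarrow> (real \<Rightarrow> real) \<Rightarrow> bool" where
  "pos_cont_on I f \<longleftrightarrow> continuous_on I f \<and> (\<forall>t\<in>I. 0 < f t)"

definition class_C ::
  "'a measure \<Rightarrow> nat \<Rightarrow> real \<Rightarrow> real \<Rightarrow> real \<Rightarrow> (real \<Rightarrow> real) \<Rightarrow> (real \<Rightarrow> 'a \<Rightarrow> real) set" where
  "class_C M m \<beta> a b V = {X. pos_cont_on {a..b} V \<and> X \<in> qm_C M m {a..b} \<and>
     (\<forall>t\<in>{a..b}. \<forall>u\<in>{a..b}. \<exists>v\<in>closed_segment t u.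
        qm_norm M (\<lambda>\<omega>. qm_derivn M {a..b} m X u \<omega> - qm_derivn M {a..b} m X t \<omega>)
          \<le> sqrt (V v) * \<bar>u - t\<bar> powr \<beta>)}"

definition class_B ::
  "'a measure \<Rightarrow> nat \<Rightarrow> real \<Rightarrow> real \<Rightarrow> real \<Rightarrow> (real \<Rightarrow> real) \<Rightarrow> (real \<Rightarrow> 'a \<Rightarrow> real) set" where
  "class_B M m \<beta> a b c = {X. pos_cont_on {a..b} c \<and> X \<in> qm_C M m {a..b} \<and>
     (\<forall>\<epsilon>>0. \<exists>\<delta>>0. \<forall>t\<in>{a..b}. \<forall>s. s \<noteq> 0 \<and> \<bar>s\<bar> < \<delta> \<and> t + s \<in> {a..b} \<longrightarrow>
        \<bar>qm_norm M (\<lambda>\<omega>. qm_derivn M {a..b} m X (t + s) \<omega> - qm_derivn M {a..b} m X t \<omega>)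
            / \<bar>s\<bar> powr \<beta> - sqrt (c t)\<bar> < \<epsilon>)}"

definition class_CB ::
  "'a measure \<Rightarrow> nat \<Rightarrow> real \<Rightarrow> (real \<Rightarrow> real) \<Rightarrow> (real \<Rightarrow> real) \<Rightarrow> (real \<Rightarrow> 'a \<Rightarrow> real) set" where
  "class_CB M m \<beta> c V = {X. pos_cont_on {0<..1} c \<and> pos_cont_on {0<..1} V \<and>
     (\<forall>a b. 0 < a \<and> a < b \<and> b \<le> 1 \<longrightarrow> X \<in> class_C M m \<beta> a b V \<inter> class_B M m \<beta> a b c)}"

text \<open>
  The Hoelder constant is \<open>sqrt C\<close>, in analogy with \<open>class_C\<close> for a constant \<open>V\<close>.
\<close>

definition fun_class_C :: "nat \<Rightarrow> real \<Rightarrow> real \<Rightarrow> (real \<Rightarrow> real) set" where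
  "fun_class_C m \<theta> C = {f. \<exists>F :: nat \<Rightarrow> real \<Rightarrow> real. (\<forall>t\<in>{0..1}. F 0 t = f t) \<and>
     (\<forall>j<m. \<forall>t\<in>{0..1}. (F j has_real_derivative F (Suc j) t) (at t within {0..1})) \<and>
     continuous_on {0..1} (F m) \<and>
     (\<forall>t\<in>{0..1}. \<forall>u\<in>{0..1}. \<bar>F m u - F m t\<bar> \<le> sqrt C * \<bar>u - t\<bar> powr \<theta>)}"


section \<open>Norms in time\<close>

definition Lp_norm :: "ereal \<Rightarrow> real set \<Rightarrow> (real \<Rightarrow> real) \<Rightarrow> ennreal" where
  "Lp_norm p I f =
     (if p = \<infinity> then (SUP t\<in>I. ennreal \<bar>f t\<bar>)
      else (let J = (\<integral>\<^sup>+t\<in>I. ennreal (\<bar>f t\<bar> powr real_of_ereal p) \<partial>lborel)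
            in if J = \<infinity> then \<infinity> else ennreal (enn2real J powr (1 / real_of_ereal p))))"

definition process_norm :: "'a measure \<Rightarrow> ereal \<Rightarrow> (real \<Rightarrow> 'a \<Rightarrow> real) \<Rightarrow> ennreal" where
  "process_norm M p Y = Lp_norm p {0..1} (\<lambda>t. qm_norm M (Y t))"

definition in_Lp :: "real \<Rightarrow> real set \<Rightarrow> (real \<Rightarrow> real) \<Rightarrow> bool" where
  "in_Lp p I f \<longleftrightarrow> set_borel_measurable lebesgue I f \<and>
     set_integrable lebesgue I (\<lambda>t. \<bar>f t\<bar> powr p)"


section \<open>Sampling designs\<close>

definition cdf_of :: "(real \<Rightarrow> real) \<Rightarrow> real \<Rightarrow> real" where
  "cdf_of h t = (LBINT u:{0..t}. h u)"

definition quantile_of :: "(real \<Rightarrow> real) \<Rightarrow> real \<Rightarrow> real" where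
  "quantile_of h = inv_into {0..1} (cdf_of h)"

definition quantile_density :: "(real \<Rightarrow> real) \<Rightarrow> real \<Rightarrow> real" where
  "quantile_density h s =
     (if s = 0 \<and> filterlim h at_top (at_right 0) then 0 else 1 / h (quantile_of h s))"

definition design_density :: "(real \<Rightarrow> real) \<Rightarrow> bool" where
  "design_density h \<longleftrightarrow> pos_cont_on {0<..1} h \<and>
     set_integrable lborel {0<..1} h \<and> (LBINT t:{0<..1}. h t) = 1 \<and>
     (filterlim h at_top (at_right 0) \<or> continuous_on {0..1} h) \<and>
     continuous_on {0..1} (quantile_density h)"

definition design :: "nat \<Rightarrow> (nat \<Rightarrow> real) \<Rightarrow> bool" where
  "design n \<tau> \<longleftrightarrow> \<tau> 0 = 0 \<and> \<tau> n = 1 \<and> (\<forall>i<n. \<tau> i < \<tau> (Suc i))"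

text \<open>\<open>T n i\<close> is the knot \<open>t\<^sub>i\<close> of the design \<open>T\<^sub>n\<close>.\<close>

definition qRS :: "(real \<Rightarrow> real) \<Rightarrow> (nat \<Rightarrow> nat \<Rightarrow> real) \<Rightarrow> bool" where
  "qRS h T \<longleftrightarrow> (\<forall>n\<ge>1. design n (T n) \<and>
     (\<forall>i\<in>{1..n}. (LBINT t:{0..T n i}. h t) = real i / real n))"


section \<open>Hermite splines\<close>

text \<open>
  Two-point Hermite interpolation of odd degree \<open>k = 2 r + 1\<close>, hence \<open>k div 2 = r\<close>;
  \<open>u i\<close> and \<open>v i\<close> are the prescribed derivatives of order \<open>i\<close> at \<open>a\<close> and \<open>b\<close>.
\<close>

definition hermite_poly ::
  "nat \<Rightarrow> real \<Rightarrow> real \<Rightarrow> (nat \<Rightarrow> real) \<Rightarrow> (nat \<Rightarrow> real) \<Rightarrow> real poly" where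
  "hermite_poly k a b u v = (THE P. degree P \<le> k \<and>
     (\<forall>i\<le>k div 2. poly ((pderiv ^^ i) P) a = u i \<and> poly ((pderiv ^^ i) P) b = v i))"

definition hermite ::
  "'a measure \<Rightarrow> nat \<Rightarrow> real \<Rightarrow> real \<Rightarrow> (real \<Rightarrow> 'a \<Rightarrow> real) \<Rightarrow> real \<Rightarrow> 'a \<Rightarrow> real" where
  "hermite M k a b X t \<omega> =
     poly (hermite_poly k a b (\<lambda>i. qm_derivn M {0..1} i X a \<omega>)
                              (\<lambda>i. qm_derivn M {0..1} i X b \<omega>)) t"

text \<open>
  The index \<open>j\<close> selects the interval \<open>[t\<^sub>j\<^sub>-\<^sub>1, t\<^sub>j]\<close> containing \<open>t\<close>; at interior knots the left
  of the two candidates is taken, which makes no difference as both interpolate there.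
\<close>

definition composite_hermite ::
  "'a measure \<Rightarrow> nat \<Rightarrow> nat \<Rightarrow> (nat \<Rightarrow> real) \<Rightarrow> (real \<Rightarrow> 'a \<Rightarrow> real) \<Rightarrow> real \<Rightarrow> 'a \<Rightarrow> real" where
  "composite_hermite M q k \<tau> X t =
     (let j = (LEAST j. 1 \<le> j \<and> t \<le> \<tau> j)
      in hermite M (if j = 1 then q else k) (\<tau> (j - 1)) (\<tau> j) X t)"


section \<open>Regular variation at zero\<close>

definition regularly_varying_0 :: "(real \<Rightarrow> real) \<Rightarrow> real \<Rightarrow> bool" where
  "regularly_varying_0 r \<rho> \<longleftrightarrow> (\<forall>\<^sub>F x in at_right 0. 0 < r x) \<and>
     (\<forall>y>0. ((\<lambda>x. r (y * x) / r x) \<longlongrightarrow> y powr \<rho>) (at_right 0))"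


section \<open>Fractional Brownian motion and the asymptotic constant\<close>

text \<open>
  Gaussian means that all finite linear combinations are centred normal, possibly degenerate.
  Continuity of the sample paths makes the pathwise integral in \<open>fbm_integral\<close> meaningful.
\<close>

definition fractional_BM :: "'a measure \<Rightarrow> real \<Rightarrow> (real \<Rightarrow> 'a \<Rightarrow> real) \<Rightarrow> bool" where
  "fractional_BM N \<beta> B \<longleftrightarrow> prob_space N \<and>
     (\<forall>t\<in>{0..1}. sq_integrable N (B t) \<and> (\<integral>\<omega>. B t \<omega> \<partial>N) = 0) \<and>
     (\<forall>t\<in>{0..1}. \<forall>s\<in>{0..1}. (\<integral>\<omega>. B t \<omega> * B s \<omega> \<partial>N) =
        (t powr (2 * \<beta>) + s powr (2 * \<beta>) - \<bar>t - s\<bar> powr (2 * \<beta>)) / 2) \<and>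
     (\<forall>S x. finite S \<and> S \<subseteq> {0..1} \<longrightarrow>
        (AE \<omega> in N. (\<Sum>t\<in>S. x t * B t \<omega>) = 0) \<or>
        (\<exists>\<sigma>>0. distributed N lborel (\<lambda>\<omega>. \<Sum>t\<in>S. x t * B t \<omega>) (normal_density 0 \<sigma>))) \<and>
     (\<forall>\<omega>\<in>space N. continuous_on {0..1} (\<lambda>t. B t \<omega>))"

text \<open>
  The factor \<open>(t - s)\<^sub>+\<^sup>m\<^sup>-\<^sup>1\<close> is rendered by restricting the integral to \<open>s \<le> t\<close>; for \<open>m = 1\<close> it has
  to be the indicator of \<open>s < t\<close>, whereas \<open>max 0 (t - s) ^ 0\<close> would be 1 everywhere.
\<close>

definition fbm_integral :: "(real \<Rightarrow> 'a \<Rightarrow> real) \<Rightarrow> nat \<Rightarrow> real \<Rightarrow> 'a \<Rightarrow> real" where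
  "fbm_integral B m t \<omega> =
     (if m = 0 then B t \<omega>
      else (LBINT s:{0..t}. (t - s) ^ (m - 1) * B s \<omega>) / fact (m - 1))"

definition hermite_const ::
  "'a measure \<Rightarrow> (real \<Rightarrow> 'a \<Rightarrow> real) \<Rightarrow> nat \<Rightarrow> nat \<Rightarrow> ereal \<Rightarrow> ennreal" where
  "hermite_const N B m k p =
     process_norm N p (\<lambda>t \<omega>. fbm_integral B m t \<omega> - hermite N k 0 1 (fbm_integral B m) t \<omega>)"

end

theory Submission
  imports Defs "HOL-Real_Asymp.Real_Asymp"
begin

text \<open>
  Why the theorem holds.  On a short knot interval \<open>[a, a + w]\<close> away from \<open>0\<close> the derivative
  \<open>X\<^sup>(\<^sup>m\<^sup>)\<close> has increments whose norms are close to \<open>sqrt (c a)\<close> times those of fractional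
  Brownian motion.  By polarisation the covariances of the increments are then close to those of
  fractional Brownian motion as well.  The Hermite error is a linear functional that annihilates
  polynomials of degree at most \<open>m\<close>, so that its second moment depends on \<open>X\<close> through the increment
  covariances of \<open>X\<^sup>(\<^sup>m\<^sup>)\<close> only; after rescaling, the norm of the error at \<open>a + x * w\<close> is
  approximately \<open>w powr (m + \<beta>) * sqrt (c a)\<close> times the error \<open>b x\<close> for the \<open>m\<close>-fold integrated
  fractional Brownian motion.  Since \<open>n * w\<close> is close to \<open>1 / h a\<close>, the error multiplied by
  \<open>n powr (m + \<beta>)\<close> behaves like \<open>\<psi> a * b x\<close> with \<open>\<psi> = sqrt c * h powr - (m + \<beta>)\<close>, uniformly on
  every \<open>[\<delta>, 1]\<close> (\<open>residual_local\<close>).  Integration over the knot intervals, or the supremum over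
  them, separates \<open>x\<close> from \<open>a\<close> and yields the product of the two norms.

  No integral of a process with values in a space of random variables enters.  Pairing with a fixed
  random variable turns quadratic mean derivatives into derivatives of real functions
  (\<open>has_qm_deriv_inner\<close>).  The comparison of the two processes becomes an estimate for a real
  function of two variables, the difference of their covariances, to which the error functional is
  applied in each variable; Taylor expansion bounds the result by double differences of the mixed
  derivative of order \<open>(m, m)\<close> (\<open>hermite_error_double_bound\<close>, \<open>hermite_error_compare\<close>).

  Near \<open>0\<close> only upper bounds are available.  The first interval is governed by the global Hoelder
  condition of order \<open>l + \<alpha>\<close>, and the growth restriction on \<open>r\<close> makes its contribution negligible
  (\<open>first_interval_negligible\<close>).  On the interval with right end point \<open>t\<^sub>j\<close>, \<open>j \<ge> 2\<close>, the error
  multiplied by \<open>n powr (m + \<beta>)\<close> is at most a constant times \<open>sqrt (V v) * g \<xi> powr (m + \<beta>)\<close> for some \<open>v\<close> in the interval and some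
  \<open>\<xi>\<close> in \<open>[(j - 1) / n, j / n]\<close> (\<open>residual_dominated\<close>).  The arguments on such an interval differ by
  a factor of at most \<open>2\<close>, so regular variation should allow them to be moved to a common point.
  The uniform convergence theorem for regularly varying functions presupposes measurability, which
  is no part of the definition here.  A Baire category argument gives a bound
  \<open>r (y * s) \<le> C * r s\<close> for all small \<open>s\<close> and a dense set of factors \<open>y\<close> only, and this is enough
  because the functions that \<open>r\<close> and \<open>R\<close> majorise are continuous
  (\<open>regularly_varying_0_majorant_bound\<close>).  The resulting majorant serves for dominated convergence
  if \<open>p < \<infinity>\<close> and for a uniform tail bound if \<open>p = \<infinity>\<close>.

  The limit is positive because fractional Brownian motion with \<open>\<beta> < 1\<close> is not differentiable in
  quadratic mean, so that its integral is not a polynomial with random coefficients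
  (\<open>fbm_residual_nontrivial\<close>).
\<close>

section \<open>Square integrable random variables\<close>

lemma sq_integrable_mult:
  assumes "sq_integrable M X" "sq_integrable M Y"
  shows "integrable M (\<lambda>\<omega>. X \<omega> * Y \<omega>)"
proof (rule Bochner_Integration.integrable_bound)
  show "integrable M (\<lambda>\<omega>. (X \<omega>)\<^sup>2 + (Y \<omega>)\<^sup>2)"
    using assms by (auto simp: sq_integrable_def)
  show "(\<lambda>\<omega>. X \<omega> * Y \<omega>) \<in> borel_measurable M"
    using assms by (auto simp: sq_integrable_def)
  have "\<bar>x * y\<bar> \<le> x\<^sup>2 + y\<^sup>2" for x y :: real
  proof -
    have "2 * (\<bar>x\<bar> * \<bar>y\<bar>) \<le> x\<^sup>2 + y\<^sup>2"
      using sum_squares_bound[of "\<bar>x\<bar>" "\<bar>y\<bar>"] by simp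
    moreover have "0 \<le> \<bar>x\<bar> * \<bar>y\<bar>" by simp
    ultimately show ?thesis by (simp only: abs_mult)
  qed
  then show "AE \<omega> in M. norm (X \<omega> * Y \<omega>) \<le> norm ((X \<omega>)\<^sup>2 + (Y \<omega>)\<^sup>2)"
    by simp
qed

lemma sq_integrable_scale: "sq_integrable M X \<Longrightarrow> sq_integrable M (\<lambda>\<omega>. c * X \<omega>)"
  by (auto simp: sq_integrable_def power_mult_distrib)

lemma sq_integrable_add:
  assumes "sq_integrable M X" "sq_integrable M Y"
  shows "sq_integrable M (\<lambda>\<omega>. X \<omega> + Y \<omega>)"
  using assms sq_integrable_mult[OF assms]
  by (auto simp: sq_integrable_def power2_sum mult.assoc)

lemma sq_integrable_diff:
  assumes "sq_integrable M X" "sq_integrable M Y"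
  shows "sq_integrable M (\<lambda>\<omega>. X \<omega> - Y \<omega>)"
  using sq_integrable_add[OF assms(1) sq_integrable_scale[OF assms(2), of "-1"]] by simp

lemma sq_integrable_zero: "sq_integrable M (\<lambda>_. 0)"
  by (simp add: sq_integrable_def)

lemma sq_integrable_sum:
  "(\<And>i. i \<in> I \<Longrightarrow> sq_integrable M (X i)) \<Longrightarrow> sq_integrable M (\<lambda>\<omega>. \<Sum>i\<in>I. X i \<omega>)"
  by (induction I rule: infinite_finite_induct) (auto simp: sq_integrable_zero sq_integrable_add)

lemma sq_integrable_divide: "sq_integrable M X \<Longrightarrow> sq_integrable M (\<lambda>\<omega>. X \<omega> / c)"
  using sq_integrable_scale[of M X "inverse c"] by (simp add: divide_inverse mult.commute)

lemma qm_norm_nonneg [simp]: "0 \<le> qm_norm M X"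
  by (simp add: qm_norm_def)

lemma qm_norm_square: "(qm_norm M X)\<^sup>2 = (\<integral>\<omega>. X \<omega> * X \<omega> \<partial>M)"
  by (simp add: qm_norm_def power2_eq_square)

lemma qm_norm_zero [simp]: "qm_norm M (\<lambda>_. 0) = 0"
  by (simp add: qm_norm_def)

lemma qm_norm_scale: "qm_norm M (\<lambda>\<omega>. c * X \<omega>) = \<bar>c\<bar> * qm_norm M X"
  by (simp add: qm_norm_def power_mult_distrib real_sqrt_mult)

lemma qm_norm_divide: "qm_norm M (\<lambda>\<omega>. X \<omega> / c) = qm_norm M X / \<bar>c\<bar>"
  using qm_norm_scale[of M "inverse c" X] by (simp add: divide_inverse mult.commute)

lemma qm_norm_minus_commute: "qm_norm M (\<lambda>\<omega>. X \<omega> - Y \<omega>) = qm_norm M (\<lambda>\<omega>. Y \<omega> - X \<omega>)"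
  by (simp add: qm_norm_def power2_commute)

lemma qm_norm_cong_AE:
  assumes "X \<in> borel_measurable M" "Y \<in> borel_measurable M" "AE \<omega> in M. X \<omega> = Y \<omega>"
  shows "qm_norm M X = qm_norm M Y"
  unfolding qm_norm_def using assms by (intro arg_cong[where f=sqrt] integral_cong_AE) auto

lemma qm_norm_eq_0_iff:
  assumes "sq_integrable M X"
  shows "qm_norm M X = 0 \<longleftrightarrow> (AE \<omega> in M. X \<omega> = 0)"
proof -
  have "qm_norm M X = 0 \<longleftrightarrow> (AE \<omega> in M. (X \<omega>)\<^sup>2 = 0)"
    unfolding qm_norm_def using assms
    by (subst integral_nonneg_eq_0_iff_AE[symmetric]) (auto simp: sq_integrable_def)
  then show ?thesis by simp
qed

lemma qm_Cauchy_Schwarz: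
  assumes "sq_integrable M X" "sq_integrable M Y"
  shows "\<bar>\<integral>\<omega>. X \<omega> * Y \<omega> \<partial>M\<bar> \<le> qm_norm M X * qm_norm M Y"
proof -
  let ?a = "\<integral>\<omega>. X \<omega> * X \<omega> \<partial>M" and ?b = "\<integral>\<omega>. X \<omega> * Y \<omega> \<partial>M" and ?c = "\<integral>\<omega>. Y \<omega> * Y \<omega> \<partial>M"
  note i = sq_integrable_mult[OF assms(1) assms(1)] sq_integrable_mult[OF assms(1) assms(2)]
    sq_integrable_mult[OF assms(2) assms(2)]
  have q: "0 \<le> ?a - 2 * t * ?b + t\<^sup>2 * ?c" for t
  proof -
    have "0 \<le> (\<integral>\<omega>. (X \<omega> - t * Y \<omega>)\<^sup>2 \<partial>M)" by simp
    also have "\<dots> = (\<integral>\<omega>. X \<omega> * X \<omega> - 2 * t * (X \<omega> * Y \<omega>) + t\<^sup>2 * (Y \<omega> * Y \<omega>) \<partial>M)"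
      by (simp add: power2_eq_square algebra_simps)
    also have "\<dots> = ?a - 2 * t * ?b + t\<^sup>2 * ?c"
      using i by simp
    finally show ?thesis .
  qed
  have "?b\<^sup>2 \<le> ?a * ?c"
  proof (cases "?c = 0")
    case True
    then have "AE \<omega> in M. Y \<omega> = 0"
      using qm_norm_eq_0_iff[OF assms(2)] qm_norm_square[of M Y] by simp
    then have "AE \<omega> in M. X \<omega> * Y \<omega> = 0" by eventually_elim simp
    then have "?b = 0" by (rule integral_eq_zero_AE)
    then show ?thesis using True by simp
  next
    case False
    have "0 \<le> ?c" by simp
    with False have c: "0 < ?c" by linarith
    have "0 \<le> ?a - 2 * (?b / ?c) * ?b + (?b / ?c)\<^sup>2 * ?c" by (rule q)
    also have "\<dots> = ?a - ?b\<^sup>2 / ?c" using c by (simp add: power2_eq_square field_simps)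
    finally show ?thesis using c by (simp add: field_simps)
  qed
  also have "?a * ?c = (qm_norm M X * qm_norm M Y)\<^sup>2"
    by (simp only: qm_norm_square power_mult_distrib)
  finally show ?thesis
    by (simp add: abs_le_square_iff[symmetric] abs_mult)
qed

lemma qm_norm_triangle:
  assumes "sq_integrable M X" "sq_integrable M Y"
  shows "qm_norm M (\<lambda>\<omega>. X \<omega> + Y \<omega>) \<le> qm_norm M X + qm_norm M Y"
proof -
  note i = sq_integrable_mult[OF assms(1) assms(1)] sq_integrable_mult[OF assms(1) assms(2)]
    sq_integrable_mult[OF assms(2) assms(2)]
  have "(qm_norm M (\<lambda>\<omega>. X \<omega> + Y \<omega>))\<^sup>2
      = (\<integral>\<omega>. X \<omega> * X \<omega> + 2 * (X \<omega> * Y \<omega>) + Y \<omega> * Y \<omega> \<partial>M)"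
    unfolding qm_norm_square by (simp add: algebra_simps)
  also have "\<dots> = (qm_norm M X)\<^sup>2 + 2 * (\<integral>\<omega>. X \<omega> * Y \<omega> \<partial>M) + (qm_norm M Y)\<^sup>2"
    using i by (simp add: qm_norm_square)
  also have "\<dots> \<le> (qm_norm M X)\<^sup>2 + 2 * (qm_norm M X * qm_norm M Y) + (qm_norm M Y)\<^sup>2"
    using qm_Cauchy_Schwarz[OF assms] by simp
  also have "\<dots> = (qm_norm M X + qm_norm M Y)\<^sup>2"
    by (simp add: power2_sum)
  finally show ?thesis by (rule power2_le_imp_le) simp
qed

lemma qm_norm_triangle_minus:
  assumes "sq_integrable M X" "sq_integrable M Y"
  shows "qm_norm M (\<lambda>\<omega>. X \<omega> - Y \<omega>) \<le> qm_norm M X + qm_norm M Y"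
  using qm_norm_triangle[OF assms(1) sq_integrable_scale[OF assms(2), of "-1"]] qm_norm_scale[of M "-1" Y]
  by simp

lemma qm_norm_triangle_diff:
  assumes "sq_integrable M X" "sq_integrable M Y" "sq_integrable M Z"
  shows "qm_norm M (\<lambda>\<omega>. X \<omega> - Z \<omega>)
    \<le> qm_norm M (\<lambda>\<omega>. X \<omega> - Y \<omega>) + qm_norm M (\<lambda>\<omega>. Y \<omega> - Z \<omega>)"
  using qm_norm_triangle[of M "\<lambda>\<omega>. X \<omega> - Y \<omega>" "\<lambda>\<omega>. Y \<omega> - Z \<omega>"] assms
  by (simp add: sq_integrable_diff)

lemma qm_norm_reverse_triangle:
  assumes "sq_integrable M X" "sq_integrable M Y"
  shows "\<bar>qm_norm M X - qm_norm M Y\<bar> \<le> qm_norm M (\<lambda>\<omega>. X \<omega> - Y \<omega>)"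
  using qm_norm_triangle_diff[of M X Y "\<lambda>_. 0"] qm_norm_triangle_diff[of M Y X "\<lambda>_. 0"] assms
    qm_norm_minus_commute[of M X Y]
  by (simp add: sq_integrable_zero abs_le_iff)

lemma qm_norm_sum_le:
  assumes "finite I" "\<And>i. i \<in> I \<Longrightarrow> sq_integrable M (X i)"
  shows "qm_norm M (\<lambda>\<omega>. \<Sum>i\<in>I. X i \<omega>) \<le> (\<Sum>i\<in>I. qm_norm M (X i))"
  using assms
proof (induction I rule: finite_induct)
  case (insert i I)
  have "qm_norm M (\<lambda>\<omega>. X i \<omega> + (\<Sum>i\<in>I. X i \<omega>)) \<le> qm_norm M (X i) + qm_norm M (\<lambda>\<omega>. \<Sum>i\<in>I. X i \<omega>)"
    using insert by (intro qm_norm_triangle sq_integrable_sum) auto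
  also have "\<dots> \<le> qm_norm M (X i) + (\<Sum>i\<in>I. qm_norm M (X i))"
    using insert by simp
  finally show ?case using insert by simp
qed simp

text \<open>
  The smoothness classes speak of norms of increments, the error analysis needs their covariances.
\<close>

lemma qm_polarization:
  assumes "sq_integrable M X" "sq_integrable M Y"
  shows "(\<integral>\<omega>. X \<omega> * Y \<omega> \<partial>M)
    = ((qm_norm M X)\<^sup>2 + (qm_norm M Y)\<^sup>2 - (qm_norm M (\<lambda>\<omega>. X \<omega> - Y \<omega>))\<^sup>2) / 2"
proof -
  note i = sq_integrable_mult[OF assms(1) assms(1)] sq_integrable_mult[OF assms(1) assms(2)]
    sq_integrable_mult[OF assms(2) assms(2)]
  have "(qm_norm M (\<lambda>\<omega>. X \<omega> - Y \<omega>))\<^sup>2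
      = (\<integral>\<omega>. X \<omega> * X \<omega> - 2 * (X \<omega> * Y \<omega>) + Y \<omega> * Y \<omega> \<partial>M)"
    unfolding qm_norm_square by (simp add: algebra_simps)
  also have "\<dots> = (qm_norm M X)\<^sup>2 - 2 * (\<integral>\<omega>. X \<omega> * Y \<omega> \<partial>M) + (qm_norm M Y)\<^sup>2"
    using i by (simp add: qm_norm_square)
  finally show ?thesis by simp
qed

section \<open>Quadratic mean derivatives\<close>

lemma has_qm_deriv_sq: "has_qm_deriv M I X Z t \<Longrightarrow> sq_integrable M Z"
  by (simp add: has_qm_deriv_def)

lemma has_qm_deriv_subset:
  "has_qm_deriv M I X Z t \<Longrightarrow> J \<subseteq> I \<Longrightarrow> has_qm_deriv M J X Z t"
  unfolding has_qm_deriv_def by (auto intro: tendsto_within_subset)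

lemma has_qm_deriv_cong_at:
  "at t within I = at t within J \<Longrightarrow> has_qm_deriv M I X Z t = has_qm_deriv M J X Z t"
  by (simp add: has_qm_deriv_def)

text \<open>
  Through this pairing the calculus of real functions replaces a calculus of functions with values
  in a space of random variables.
\<close>

lemma has_qm_deriv_inner:
  assumes D: "has_qm_deriv M I X Z t" and X: "\<And>s. s \<in> I \<Longrightarrow> sq_integrable M (X s)"
    and t: "t \<in> I" and \<xi>: "sq_integrable M \<xi>"
  shows "((\<lambda>s. \<integral>\<omega>. X s \<omega> * \<xi> \<omega> \<partial>M) has_real_derivative (\<integral>\<omega>. Z \<omega> * \<xi> \<omega> \<partial>M)) (at t within I)"
  unfolding has_field_derivative_iff
proof (rule LIM_zero_cancel, rule Lim_null_comparison)
  have Z: "sq_integrable M Z" using D by (rule has_qm_deriv_sq)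
  show "((\<lambda>s. qm_norm M (\<lambda>\<omega>. (X s \<omega> - X t \<omega>) / (s - t) - Z \<omega>) * qm_norm M \<xi>) \<longlongrightarrow> 0) (at t within I)"
    using D unfolding has_qm_deriv_def by (auto intro!: tendsto_mult_left_zero)
  have "\<bar>((\<integral>\<omega>. X s \<omega> * \<xi> \<omega> \<partial>M) - (\<integral>\<omega>. X t \<omega> * \<xi> \<omega> \<partial>M)) / (s - t) - (\<integral>\<omega>. Z \<omega> * \<xi> \<omega> \<partial>M)\<bar>
     \<le> qm_norm M (\<lambda>\<omega>. (X s \<omega> - X t \<omega>) / (s - t) - Z \<omega>) * qm_norm M \<xi>" if s: "s \<in> I" for s
  proof -
    note i = sq_integrable_mult[OF X[OF s] \<xi>] sq_integrable_mult[OF X[OF t] \<xi>] sq_integrable_mult[OF Z \<xi>]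
    have "((\<integral>\<omega>. X s \<omega> * \<xi> \<omega> \<partial>M) - (\<integral>\<omega>. X t \<omega> * \<xi> \<omega> \<partial>M)) / (s - t) - (\<integral>\<omega>. Z \<omega> * \<xi> \<omega> \<partial>M)
      = (\<integral>\<omega>. (X s \<omega> * \<xi> \<omega> - X t \<omega> * \<xi> \<omega>) / (s - t) - Z \<omega> * \<xi> \<omega> \<partial>M)"
      using i by simp
    also have "\<dots> = (\<integral>\<omega>. ((X s \<omega> - X t \<omega>) / (s - t) - Z \<omega>) * \<xi> \<omega> \<partial>M)"
      by (intro Bochner_Integration.integral_cong) (auto simp: field_simps diff_divide_distrib)
    finally show ?thesis
      using qm_Cauchy_Schwarz[of M "\<lambda>\<omega>. (X s \<omega> - X t \<omega>) / (s - t) - Z \<omega>" \<xi>] s t X Z \<xi>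
      by (simp add: sq_integrable_diff sq_integrable_divide)
  qed
  then show "\<forall>\<^sub>F s in at t within I. norm (((\<integral>\<omega>. X s \<omega> * \<xi> \<omega> \<partial>M) - (\<integral>\<omega>. X t \<omega> * \<xi> \<omega> \<partial>M)) / (s - t) - (\<integral>\<omega>. Z \<omega> * \<xi> \<omega> \<partial>M))
      \<le> qm_norm M (\<lambda>\<omega>. (X s \<omega> - X t \<omega>) / (s - t) - Z \<omega>) * qm_norm M \<xi>"
    by (auto simp: eventually_at_filter)
qed

text \<open>
  Two limits of the same difference quotients, up to null sets, are at distance \<open>0\<close> in norm.
\<close>

lemma has_qm_deriv_unique:
  assumes X: "has_qm_deriv M I X Z t" and Y: "has_qm_deriv M I Y W t"
    and J: "\<forall>\<^sub>F s in at t within I. s \<in> J" "t \<in> J" "at t within I \<noteq> bot"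
    and sX: "\<And>s. s \<in> J \<Longrightarrow> sq_integrable M (X s)" and sY: "\<And>s. s \<in> J \<Longrightarrow> sq_integrable M (Y s)"
    and eq: "\<And>s. s \<in> J \<Longrightarrow> AE \<omega> in M. X s \<omega> = Y s \<omega>"
  shows "AE \<omega> in M. Z \<omega> = W \<omega>"
proof -
  let ?p = "\<lambda>s. qm_norm M (\<lambda>\<omega>. (X s \<omega> - X t \<omega>) / (s - t) - Z \<omega>)"
  let ?q = "\<lambda>s. qm_norm M (\<lambda>\<omega>. (Y s \<omega> - Y t \<omega>) / (s - t) - W \<omega>)"
  have Z: "sq_integrable M Z" and W: "sq_integrable M W" using X Y by (auto simp: has_qm_deriv_def)
  have lim: "((\<lambda>s. ?p s + ?q s) \<longlongrightarrow> 0 + 0) (at t within I)"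
    using X Y unfolding has_qm_deriv_def by (intro tendsto_add) auto
  have le: "qm_norm M (\<lambda>\<omega>. Z \<omega> - W \<omega>) \<le> ?p s + ?q s" if s: "s \<in> J" for s
  proof -
    let ?U = "\<lambda>\<omega>. (X s \<omega> - X t \<omega>) / (s - t)" and ?U' = "\<lambda>\<omega>. (Y s \<omega> - Y t \<omega>) / (s - t)"
    have U: "sq_integrable M ?U" "sq_integrable M ?U'"
      using s J sX sY by (auto intro!: sq_integrable_divide sq_integrable_diff)
    have "AE \<omega> in M. Z \<omega> - ?U \<omega> = Z \<omega> - ?U' \<omega>"
      using eq[OF s] eq[OF J(2)] by eventually_elim simp
    then have "qm_norm M (\<lambda>\<omega>. Z \<omega> - ?U \<omega>) = qm_norm M (\<lambda>\<omega>. Z \<omega> - ?U' \<omega>)"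
      using U Z by (intro qm_norm_cong_AE) (auto simp: sq_integrable_def intro!: borel_measurable_diff)
    with qm_norm_triangle_diff[OF Z U(2) W] show ?thesis
      using qm_norm_minus_commute[of M ?U Z] by simp
  qed
  have "((\<lambda>s. qm_norm M (\<lambda>\<omega>. Z \<omega> - W \<omega>)) \<longlongrightarrow> qm_norm M (\<lambda>\<omega>. Z \<omega> - W \<omega>)) (at t within I)" by simp
  then have "qm_norm M (\<lambda>\<omega>. Z \<omega> - W \<omega>) \<le> 0 + 0"
    by (rule tendsto_le[OF J(3) lim]) (use J(1) le in \<open>auto elim: eventually_mono\<close>)
  then have "qm_norm M (\<lambda>\<omega>. Z \<omega> - W \<omega>) = 0"
    using qm_norm_nonneg[of M "\<lambda>\<omega>. Z \<omega> - W \<omega>"] by linarith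
  then show ?thesis
    using qm_norm_eq_0_iff[OF sq_integrable_diff[OF Z W]] by simp
qed

text \<open>
  Iterated derivatives are versions chosen at each order, so a derivative must survive a
  modification of the process on null sets.
\<close>

lemma has_qm_deriv_cong:
  assumes X: "has_qm_deriv M I X Z t"
    and J: "\<forall>\<^sub>F s in at t within I. s \<in> J" "t \<in> J"
    and sX: "\<And>s. s \<in> J \<Longrightarrow> sq_integrable M (X s)" and sY: "\<And>s. s \<in> J \<Longrightarrow> sq_integrable M (Y s)"
    and eq: "\<And>s. s \<in> J \<Longrightarrow> AE \<omega> in M. X s \<omega> = Y s \<omega>"
  shows "has_qm_deriv M I Y Z t"
proof -
  have Z: "sq_integrable M Z" using X by (auto simp: has_qm_deriv_def)
  have "qm_norm M (\<lambda>\<omega>. (X s \<omega> - X t \<omega>) / (s - t) - Z \<omega>)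
      = qm_norm M (\<lambda>\<omega>. (Y s \<omega> - Y t \<omega>) / (s - t) - Z \<omega>)" if s: "s \<in> J" for s
  proof (rule qm_norm_cong_AE)
    show "AE \<omega> in M. (X s \<omega> - X t \<omega>) / (s - t) - Z \<omega> = (Y s \<omega> - Y t \<omega>) / (s - t) - Z \<omega>"
      using eq[OF s] eq[OF J(2)] by eventually_elim simp
  qed (use s J Z sX sY in \<open>auto simp: sq_integrable_def intro!: borel_measurable_diff borel_measurable_divide\<close>)
  then have "((\<lambda>s. qm_norm M (\<lambda>\<omega>. (Y s \<omega> - Y t \<omega>) / (s - t) - Z \<omega>)) \<longlongrightarrow> 0) (at t within I)"
    using X unfolding has_qm_deriv_def
    by (elim conjE Lim_transform_eventually) (use J(1) in \<open>auto elim: eventually_mono\<close>)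
  with Z show ?thesis by (simp add: has_qm_deriv_def)
qed

lemma qm_deriv_eqI:
  assumes "has_qm_deriv M I X Z t" "at t within I \<noteq> bot"
    and "\<forall>\<^sub>F s in at t within I. s \<in> J" "t \<in> J" "\<And>s. s \<in> J \<Longrightarrow> sq_integrable M (X s)"
  shows "has_qm_deriv M I X (qm_deriv M I X t) t" "AE \<omega> in M. qm_deriv M I X t \<omega> = Z \<omega>"
proof -
  show *: "has_qm_deriv M I X (qm_deriv M I X t) t"
    unfolding qm_deriv_def
    using someI[of "\<lambda>Z. has_qm_deriv M I X Z t", OF assms(1)] .
  show "AE \<omega> in M. qm_deriv M I X t \<omega> = Z \<omega>"
    using has_qm_deriv_unique[OF * assms(1) assms(3,4,2)] assms(5) by simp
qed

text \<open>
  Iterated quadratic mean derivatives are selected by choice at every step.  If some family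
  \<open>Y\<close> of successive derivatives exists on a relatively open set \<open>J\<close>, then the selected ones
  agree with it there, up to null sets.
\<close>

lemma qm_derivn_unique:
  assumes J: "\<And>t. t \<in> J \<Longrightarrow> \<forall>\<^sub>F s in at t within I. s \<in> J"
    and I: "\<And>t. t \<in> J \<Longrightarrow> at t within I \<noteq> bot"
    and X: "\<And>t. t \<in> J \<Longrightarrow> X t = Y 0 t"
    and sY: "\<And>j t. j \<le> m \<Longrightarrow> t \<in> J \<Longrightarrow> sq_integrable M (Y j t)"
    and dY: "\<And>j t. j < m \<Longrightarrow> t \<in> J \<Longrightarrow> has_qm_deriv M I (Y j) (Y (Suc j) t) t"
  shows "j \<le> m \<Longrightarrow> t \<in> J \<Longrightarrow> sq_integrable M (qm_derivn M I j X t)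
      \<and> (AE \<omega> in M. qm_derivn M I j X t \<omega> = Y j t \<omega>)
      \<and> (j < m \<longrightarrow> has_qm_deriv M I (qm_derivn M I j X) (qm_derivn M I (Suc j) X t) t)"
proof (induction j arbitrary: t)
  case 0
  have s: "sq_integrable M (X t)" if "t \<in> J" for t using sY[of 0 t] X that by simp
  moreover have "has_qm_deriv M I X (qm_deriv M I X t) t" if "0 < m"
  proof -
    have "has_qm_deriv M I X (Y (Suc 0) t) t"
      by (rule has_qm_deriv_cong[OF dY[OF that 0(2)] J[OF 0(2)] 0(2)]) (use sY[of 0] X s in auto)
    then show ?thesis
      by (rule qm_deriv_eqI(1)[OF _ I[OF 0(2)] J[OF 0(2)] 0(2)]) (use s in auto)
  qed
  ultimately show ?case using 0 by (simp add: qm_derivn_def X)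
next
  case (Suc j)
  let ?D = "\<lambda>j. qm_derivn M I j X"
  have D_Suc: "?D (Suc i) t = qm_deriv M I (?D i) t" for i t by (simp add: qm_derivn_def)
  have sD: "sq_integrable M (?D j t)" "AE \<omega> in M. ?D j t \<omega> = Y j t \<omega>" if "t \<in> J" for t
    using Suc.IH[OF _ that] Suc.prems by auto
  have S: "sq_integrable M (?D (Suc j) t)" "AE \<omega> in M. ?D (Suc j) t \<omega> = Y (Suc j) t \<omega>"
    if t: "t \<in> J" for t
  proof -
    have "has_qm_deriv M I (?D j) (Y (Suc j) t) t"
      by (rule has_qm_deriv_cong[OF dY[OF _ t] J[OF t] t])
        (use sY[of j] sD Suc.prems eq_commute in \<open>auto elim: eventually_mono[OF sD(2)]\<close>)
    note * = qm_deriv_eqI[OF this I[OF t] J[OF t] t sD(1)]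
    show "sq_integrable M (?D (Suc j) t)" using *(1) by (simp add: D_Suc has_qm_deriv_def)
    show "AE \<omega> in M. ?D (Suc j) t \<omega> = Y (Suc j) t \<omega>" using *(2) by (simp add: D_Suc)
  qed
  moreover have "has_qm_deriv M I (?D (Suc j)) (?D (Suc (Suc j)) t) t" if m: "Suc j < m"
  proof -
    note t = Suc.prems(2)
    have "has_qm_deriv M I (?D (Suc j)) (Y (Suc (Suc j)) t) t"
      by (rule has_qm_deriv_cong[OF dY[OF _ t] J[OF t] t])
        (use sY[of "Suc j"] S m in \<open>auto elim: eventually_mono[OF S(2)]\<close>)
    note * = qm_deriv_eqI[OF this I[OF t] J[OF t] t S(1)]
    show ?thesis using *(1) by (simp only: D_Suc[of "Suc j" t])
  qed
  ultimately show ?case using Suc.prems by auto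
qed

lemma has_qm_deriv_imp_continuous:
  assumes D: "has_qm_deriv M I X Z t" and sX: "\<And>s. s \<in> I \<Longrightarrow> sq_integrable M (X s)" and t: "t \<in> I"
  shows "((\<lambda>s. qm_norm M (\<lambda>\<omega>. X s \<omega> - X t \<omega>)) \<longlongrightarrow> 0) (at t within I)"
proof (rule Lim_null_comparison)
  let ?d = "\<lambda>s. qm_norm M (\<lambda>\<omega>. (X s \<omega> - X t \<omega>) / (s - t) - Z \<omega>)"
  have Z: "sq_integrable M Z" using D by (rule has_qm_deriv_sq)
  have "((\<lambda>s. \<bar>s - t\<bar> * (?d s + qm_norm M Z)) \<longlongrightarrow> \<bar>t - t\<bar> * (0 + qm_norm M Z)) (at t within I)"
    using D unfolding has_qm_deriv_def by (intro tendsto_intros) auto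
  then show "((\<lambda>s. \<bar>s - t\<bar> * (?d s + qm_norm M Z)) \<longlongrightarrow> 0) (at t within I)" by simp
  have "qm_norm M (\<lambda>\<omega>. X s \<omega> - X t \<omega>) \<le> \<bar>s - t\<bar> * (?d s + qm_norm M Z)" if s: "s \<in> I" "s \<noteq> t" for s
  proof -
    let ?U = "\<lambda>\<omega>. (X s \<omega> - X t \<omega>) / (s - t)"
    have U: "sq_integrable M ?U" using s t sX by (auto intro!: sq_integrable_divide sq_integrable_diff)
    have "qm_norm M (\<lambda>\<omega>. X s \<omega> - X t \<omega>) = \<bar>s - t\<bar> * qm_norm M ?U"
      using s by (simp add: qm_norm_divide)
    also have "\<dots> \<le> \<bar>s - t\<bar> * (?d s + qm_norm M Z)"
      using qm_norm_triangle[of M "\<lambda>\<omega>. ?U \<omega> - Z \<omega>" Z] U Z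
      by (intro mult_left_mono) (auto simp: sq_integrable_diff)
    finally show ?thesis .
  qed
  then show "\<forall>\<^sub>F s in at t within I. norm (qm_norm M (\<lambda>\<omega>. X s \<omega> - X t \<omega>)) \<le> \<bar>s - t\<bar> * (?d s + qm_norm M Z)"
    by (auto simp: eventually_at_filter)
qed

section \<open>Two-point Hermite interpolation\<close>

text \<open>
  Interpolation conditions with zero data are divisibility conditions; both existence and
  uniqueness of Hermite interpolants rest on this.
\<close>

lemma higher_pderiv_zeros_iff_dvd:
  fixes p :: "real poly"
  shows "(\<forall>i<n. poly ((pderiv ^^ i) p) a = 0) \<longleftrightarrow> [:- a, 1:] ^ n dvd p"
proof (induction n arbitrary: p)
  case (Suc n)
  have "(\<forall>i<Suc n. poly ((pderiv ^^ i) p) a = 0)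
      \<longleftrightarrow> poly p a = 0 \<and> (\<forall>i<n. poly ((pderiv ^^ i) (pderiv p)) a = 0)"
    by (simp add: All_less_Suc2 funpow_swap1)
  also have "\<dots> \<longleftrightarrow> poly p a = 0 \<and> [:- a, 1:] ^ n dvd pderiv p"
    by (simp only: Suc.IH)
  also have "\<dots> \<longleftrightarrow> [:- a, 1:] ^ Suc n dvd p"
  proof (cases "p = 0")
    case False
    show ?thesis
    proof (cases "poly p a = 0")
      case True
      with False have "pderiv p \<noteq> 0"
        by (auto dest!: pderiv_iszero)
      with order_pderiv[OF False True] False True show ?thesis
        by (simp only: order_divides) simp
    next
      case False
      then show ?thesis
        by (metis dvd_trans dvd_power poly_eq_0_iff_dvd zero_less_Suc)
    qed
  qed simp
  finally show ?case .
qed simp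

text \<open>
  Newton's scheme: adding a multiple of \<open>S * (x - b) ^ n\<close> changes the derivative of order \<open>n\<close> at
  \<open>b\<close> and no lower one.  The factor \<open>S\<close> is there to preserve conditions already met at another
  node.
\<close>

lemma interpolating_multiple_exists:
  fixes S :: "real poly"
  assumes S: "poly S b \<noteq> 0"
  shows "\<exists>R. degree R \<le> n - 1 \<and> (\<forall>i<n. poly ((pderiv ^^ i) (S * R)) b = v i)"
proof (induction n)
  case 0
  show ?case by (intro exI[of _ 0]) simp
next
  case (Suc n)
  then obtain R where R: "degree R \<le> n - 1" "\<And>i. i < n \<Longrightarrow> poly ((pderiv ^^ i) (S * R)) b = v i"
    by blast
  define L where "L = [:- b, 1:]"
  have low: "poly ((pderiv ^^ i) (S * L ^ n)) b = 0" if "i < n" for i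
    using that higher_pderiv_zeros_iff_dvd[of n "S * L ^ n" b] by (simp add: L_def)
  have top: "poly ((pderiv ^^ n) (S * L ^ n)) b \<noteq> 0"
  proof
    assume "poly ((pderiv ^^ n) (S * L ^ n)) b = 0"
    with low have "\<forall>i<Suc n. poly ((pderiv ^^ i) (S * L ^ n)) b = 0"
      by (auto simp: less_Suc_eq)
    then have "L ^ Suc n dvd S * L ^ n"
      by (simp only: higher_pderiv_zeros_iff_dvd L_def)
    then have "L * L ^ n dvd S * L ^ n" by simp
    moreover have "L ^ n \<noteq> 0" by (simp add: L_def)
    ultimately have "L dvd S" by (simp only: dvd_mult_cancel_right) simp
    with S show False by (simp add: L_def poly_eq_0_iff_dvd)
  qed
  define c where "c = (v n - poly ((pderiv ^^ n) (S * R)) b) / poly ((pderiv ^^ n) (S * L ^ n)) b"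
  have eq: "poly ((pderiv ^^ i) (S * (R + smult c (L ^ n)))) b
      = poly ((pderiv ^^ i) (S * R)) b + c * poly ((pderiv ^^ i) (S * L ^ n)) b" for i
    by (simp add: distrib_left higher_pderiv_add higher_pderiv_smult)
  show ?case
  proof (intro exI[of _ "R + smult c (L ^ n)"] conjI allI impI)
    have "degree (L ^ n) \<le> n" using degree_power_le[of L n] by (simp add: L_def)
    then show "degree (R + smult c (L ^ n)) \<le> Suc n - 1"
      using R(1) by (intro degree_add_le) (auto intro: order_trans[OF degree_smult_le])
    fix i assume "i < Suc n"
    then consider "i < n" | "i = n" by linarith
    then show "poly ((pderiv ^^ i) (S * (R + smult c (L ^ n)))) b = v i"
      unfolding eq by cases (use R(2) low top in \<open>simp_all add: c_def\<close>)
  qed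
qed

text \<open>
  The powers of \<open>x - a\<close> and \<open>x - b\<close> dividing \<open>P\<close> have total degree \<open>k + 1\<close>.
\<close>

lemma hermite_data_unique:
  fixes P :: "real poly"
  assumes "a \<noteq> b" "odd k" "degree P \<le> k"
    and "\<And>i. i \<le> k div 2 \<Longrightarrow> poly ((pderiv ^^ i) P) a = 0"
    and "\<And>i. i \<le> k div 2 \<Longrightarrow> poly ((pderiv ^^ i) P) b = 0"
  shows "P = 0"
proof (rule ccontr)
  assume P: "P \<noteq> 0"
  define n where "n = Suc (k div 2)"
  have a: "[:- a, 1:] ^ n dvd P" and b: "[:- b, 1:] ^ n dvd P"
    unfolding higher_pderiv_zeros_iff_dvd[symmetric] n_def
    using assms(4,5) by (simp_all add: less_Suc_eq_le)
  from a obtain Q where Q: "P = [:- a, 1:] ^ n * Q" by (elim dvdE)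
  with P have Q0: "Q \<noteq> 0" by auto
  have "order b ([:- a, 1:] ^ n) = 0"
    using \<open>a \<noteq> b\<close> by (intro order_0I) simp
  then have "order b P = order b Q" using P unfolding Q by (simp add: order_mult)
  with b P have "n \<le> order b Q" by (simp add: order_divides)
  also have "\<dots> \<le> degree Q" using Q0 by (rule order_degree)
  finally have "n + n \<le> degree P"
    unfolding Q using Q0 by (subst degree_mult_eq) (auto simp: degree_linear_power)
  with assms(2,3) show False by (auto simp: n_def elim!: oddE)
qed

text \<open>
  The Taylor polynomial at \<open>a\<close> is corrected by a multiple of \<open>(x - a) ^ n\<close>, which leaves the data
  at \<open>a\<close> unchanged.
\<close>

lemma hermite_poly_ex1:
  fixes a b :: real
  assumes ab: "a \<noteq> b" and k: "odd k"
  shows "\<exists>!P. degree P \<le> k \<and>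
     (\<forall>i\<le>k div 2. poly ((pderiv ^^ i) P) a = u i \<and> poly ((pderiv ^^ i) P) b = v i)"
proof (rule ex_ex1I)
  define n where "n = Suc (k div 2)"
  have nk: "k = n + (n - 1)" using k by (auto simp: n_def elim!: oddE)
  obtain P where P: "degree P \<le> n - 1" "\<And>i. i < n \<Longrightarrow> poly ((pderiv ^^ i) (1 * P)) a = u i"
    using interpolating_multiple_exists[of 1 a n u] by auto
  let ?S = "[:- a, 1:] ^ n"
  have "poly ?S b \<noteq> 0" using ab by simp
  then obtain R where R: "degree R \<le> n - 1"
      "\<And>i. i < n \<Longrightarrow> poly ((pderiv ^^ i) (?S * R)) b = v i - poly ((pderiv ^^ i) P) b"
    using interpolating_multiple_exists[of ?S b n "\<lambda>i. v i - poly ((pderiv ^^ i) P) b"] by auto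
  have S0: "poly ((pderiv ^^ i) (?S * R)) a = 0" if "i < n" for i
    using that higher_pderiv_zeros_iff_dvd[of n "?S * R" a] by simp
  have "degree (?S * R) \<le> degree ?S + degree R" by (rule degree_mult_le)
  then have "degree (?S * R) \<le> k" using R(1) nk by (simp add: degree_linear_power)
  moreover have "degree P \<le> k" using P(1) nk by simp
  ultimately have "degree (P + ?S * R) \<le> k" by (intro degree_add_le)
  then show "\<exists>P. degree P \<le> k \<and>
     (\<forall>i\<le>k div 2. poly ((pderiv ^^ i) P) a = u i \<and> poly ((pderiv ^^ i) P) b = v i)"
    using P(2) R(2) S0
    by (intro exI[of _ "P + ?S * R"]) (auto simp: higher_pderiv_add n_def less_Suc_eq_le)
next
  fix P Q :: "real poly"
  assume *: "degree P \<le> k \<and> (\<forall>i\<le>k div 2. poly ((pderiv ^^ i) P) a = u i \<and> poly ((pderiv ^^ i) P) b = v i)"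
    "degree Q \<le> k \<and> (\<forall>i\<le>k div 2. poly ((pderiv ^^ i) Q) a = u i \<and> poly ((pderiv ^^ i) Q) b = v i)"
  have "P - Q = 0"
  proof (rule hermite_data_unique[OF ab k])
    show "degree (P - Q) \<le> k" using * by (intro degree_diff_le) auto
    have d: "(pderiv ^^ i) (P - Q) = (pderiv ^^ i) P - (pderiv ^^ i) Q" for i
      using higher_pderiv_add[of i P "smult (-1) Q"] by (simp only: higher_pderiv_smult) simp
    fix i assume "i \<le> k div 2"
    with * show "poly ((pderiv ^^ i) (P - Q)) a = 0" "poly ((pderiv ^^ i) (P - Q)) b = 0"
      by (auto simp: d)
  qed
  then show "P = Q" by simp
qed

lemma hermite_poly_eqI:
  assumes "a \<noteq> b" "odd k" "degree P \<le> k"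
    and "\<And>i. i \<le> k div 2 \<Longrightarrow> poly ((pderiv ^^ i) P) a = u i"
    and "\<And>i. i \<le> k div 2 \<Longrightarrow> poly ((pderiv ^^ i) P) b = v i"
  shows "hermite_poly k a b u v = P"
  unfolding hermite_poly_def
  using hermite_poly_ex1[OF assms(1,2), of u v] assms(3-) by (intro the1_equality) auto

lemma hermite_poly_props:
  assumes "a \<noteq> b" "odd k"
  shows "degree (hermite_poly k a b u v) \<le> k"
    "i \<le> k div 2 \<Longrightarrow> poly ((pderiv ^^ i) (hermite_poly k a b u v)) a = u i"
    "i \<le> k div 2 \<Longrightarrow> poly ((pderiv ^^ i) (hermite_poly k a b u v)) b = v i"
  using theI'[OF hermite_poly_ex1[OF assms, of u v]] unfolding hermite_poly_def by auto

text \<open>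
  The fundamental polynomials on \<open>[0, 1]\<close>: unit datum of order \<open>i\<close> at the left, respectively the
  right, end point.
\<close>

definition hermite_left :: "nat \<Rightarrow> nat \<Rightarrow> real poly" where
  "hermite_left k i = hermite_poly k 0 1 (\<lambda>j. if j = i then 1 else 0) (\<lambda>_. 0)"

definition hermite_right :: "nat \<Rightarrow> nat \<Rightarrow> real poly" where
  "hermite_right k i = hermite_poly k 0 1 (\<lambda>_. 0) (\<lambda>j. if j = i then 1 else 0)"

lemma hermite_poly_unit:
  assumes k: "odd k"
  shows "hermite_poly k 0 1 u v
    = (\<Sum>i\<le>k div 2. smult (u i) (hermite_left k i) + smult (v i) (hermite_right k i))"
proof (rule hermite_poly_eqI)
  note l = hermite_poly_props[of 0 1 k, OF _ k, simplified, folded hermite_left_def]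
  show "degree (\<Sum>i\<le>k div 2. smult (u i) (hermite_left k i) + smult (v i) (hermite_right k i)) \<le> k"
    using k by (intro degree_sum_le degree_add_le order_trans[OF degree_smult_le])
      (auto simp: hermite_left_def hermite_right_def hermite_poly_props)
  fix j assume j: "j \<le> k div 2"
  show "poly ((pderiv ^^ j) (\<Sum>i\<le>k div 2. smult (u i) (hermite_left k i) + smult (v i) (hermite_right k i))) 0 = u j"
    "poly ((pderiv ^^ j) (\<Sum>i\<le>k div 2. smult (u i) (hermite_left k i) + smult (v i) (hermite_right k i))) 1 = v j"
    using j k by (simp_all add: higher_pderiv_sum higher_pderiv_add higher_pderiv_smult poly_sum
      hermite_left_def hermite_right_def hermite_poly_props if_distrib[of "(*) _"] cong: if_cong)
qed (use k in auto)

text \<open>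
  The substitution \<open>a + x * w\<close> multiplies the derivative of order \<open>i\<close> by \<open>w ^ i\<close>, so all intervals
  share the fundamental polynomials of \<open>[0, 1]\<close>.
\<close>

lemma poly_hermite_poly_scale:
  assumes k: "odd k" and w: "w \<noteq> 0"
  shows "poly (hermite_poly k a (a + w) u v) (a + x * w)
    = (\<Sum>i\<le>k div 2. w ^ i * (u i * poly (hermite_left k i) x + v i * poly (hermite_right k i) x))"
proof -
  let ?P = "hermite_poly k a (a + w) u v" and ?L = "[:a, w:]"
  have d: "(pderiv ^^ i) (pcompose P ?L) = smult (w ^ i) (pcompose ((pderiv ^^ i) P) ?L)" for i and P :: "real poly"
  proof (induction i)
    case (Suc i)
    have "pderiv ?L = [:w:]" by (simp add: pderiv_pCons)
    with Suc show ?case by (simp add: pderiv_smult pderiv_pcompose mult.commute)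
  qed simp
  have "hermite_poly k 0 1 (\<lambda>i. w ^ i * u i) (\<lambda>i. w ^ i * v i) = pcompose ?P ?L"
  proof (rule hermite_poly_eqI)
    have "degree (pcompose ?P ?L) \<le> degree ?P" using degree_pcompose[of ?P ?L] w by simp
    then show "degree (pcompose ?P ?L) \<le> k"
      using hermite_poly_props(1)[of a "a + w" k u v] k w by simp
    fix i assume "i \<le> k div 2"
    then show "poly ((pderiv ^^ i) (pcompose ?P ?L)) 0 = w ^ i * u i"
      "poly ((pderiv ^^ i) (pcompose ?P ?L)) 1 = w ^ i * v i"
      using k w by (simp_all add: d poly_pcompose hermite_poly_props)
  qed (use k in auto)
  then have "poly (pcompose ?P ?L) x
    = poly (hermite_poly k 0 1 (\<lambda>i. w ^ i * u i) (\<lambda>i. w ^ i * v i)) x" by simp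
  also have "\<dots> = (\<Sum>i\<le>k div 2. w ^ i * (u i * poly (hermite_left k i) x + v i * poly (hermite_right k i) x))"
    using k by (simp add: hermite_poly_unit poly_sum algebra_simps)
  finally show ?thesis by (simp add: poly_pcompose mult.commute)
qed

text \<open>
  Here \<open>\<phi> i\<close> stands for the derivative of order \<open>i\<close> of \<open>\<phi> 0\<close>.  Keeping the derivatives as data
  makes the error a linear functional that can be applied to sample values, covariances and
  functions of one of two variables alike.
\<close>

definition hermite_error :: "nat \<Rightarrow> real \<Rightarrow> (nat \<Rightarrow> real \<Rightarrow> real) \<Rightarrow> real" where
  "hermite_error k x \<phi> = \<phi> 0 x
     - (\<Sum>i\<le>k div 2. \<phi> i 0 * poly (hermite_left k i) x + \<phi> i 1 * poly (hermite_right k i) x)"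

lemma hermite_error_diff:
  "hermite_error k x (\<lambda>i s. f i s - g i s) = hermite_error k x f - hermite_error k x g"
  unfolding hermite_error_def by (simp add: sum_subtractf[symmetric] algebra_simps)

lemma hermite_error_scale:
  "hermite_error k x (\<lambda>i s. c * f i s) = c * hermite_error k x f"
  unfolding hermite_error_def by (simp add: sum_distrib_left algebra_simps)

lemma hermite_error_integral:
  assumes "integrable M (\<lambda>\<omega>. Y 0 x \<omega>)"
    "\<And>i. i \<le> k div 2 \<Longrightarrow> integrable M (\<lambda>\<omega>. Y i 0 \<omega>)" "\<And>i. i \<le> k div 2 \<Longrightarrow> integrable M (\<lambda>\<omega>. Y i 1 \<omega>)"
  shows "(\<integral>\<omega>. hermite_error k x (\<lambda>i s. Y i s \<omega>) \<partial>M) = hermite_error k x (\<lambda>i s. \<integral>\<omega>. Y i s \<omega> \<partial>M)"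
proof -
  have "integrable M (\<lambda>\<omega>. Y i 0 \<omega> * poly (hermite_left k i) x + Y i 1 \<omega> * poly (hermite_right k i) x)"
    "(\<integral>\<omega>. Y i 0 \<omega> * poly (hermite_left k i) x + Y i 1 \<omega> * poly (hermite_right k i) x \<partial>M)
      = (\<integral>\<omega>. Y i 0 \<omega> \<partial>M) * poly (hermite_left k i) x + (\<integral>\<omega>. Y i 1 \<omega> \<partial>M) * poly (hermite_right k i) x"
    if "i \<le> k div 2" for i
    using assms(2,3)[OF that] by simp_all
  note Y = this
  let ?S = "\<lambda>\<omega>. \<Sum>i\<le>k div 2. Y i 0 \<omega> * poly (hermite_left k i) x + Y i 1 \<omega> * poly (hermite_right k i) x"
  have "integrable M ?S" by (rule Bochner_Integration.integrable_sum) (simp add: Y(1))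
  from Bochner_Integration.integral_diff[OF assms(1) this]
  have "(\<integral>\<omega>. Y 0 x \<omega> - ?S \<omega> \<partial>M) = (\<integral>\<omega>. Y 0 x \<omega> \<partial>M) - (\<integral>\<omega>. ?S \<omega> \<partial>M)" .
  also have "(\<integral>\<omega>. ?S \<omega> \<partial>M) = (\<Sum>i\<le>k div 2. (\<integral>\<omega>. Y i 0 \<omega> \<partial>M) * poly (hermite_left k i) x
      + (\<integral>\<omega>. Y i 1 \<omega> \<partial>M) * poly (hermite_right k i) x)"
    by (subst Bochner_Integration.integral_sum) (auto simp only: Y atMost_iff intro!: sum.cong)
  finally show ?thesis unfolding hermite_error_def .
qed

text \<open>
  A polynomial of degree at most \<open>k\<close> is its own interpolant.
\<close>

lemma hermite_error_poly:
  assumes "odd k" "degree P \<le> k"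
  shows "hermite_error k x (\<lambda>i. poly ((pderiv ^^ i) P)) = 0"
proof -
  have "P = hermite_poly k 0 1 (\<lambda>i. poly ((pderiv ^^ i) P) 0) (\<lambda>i. poly ((pderiv ^^ i) P) 1)"
    using assms by (intro hermite_poly_eqI[symmetric]) auto
  then have "poly P x = poly (hermite_poly k 0 1 (\<lambda>i. poly ((pderiv ^^ i) P) 0) (\<lambda>i. poly ((pderiv ^^ i) P) 1)) x"
    by simp
  then show ?thesis
    using assms by (simp add: hermite_error_def hermite_poly_unit poly_sum)
qed

text \<open>
  Subtracting the Taylor polynomial of degree \<open>m\<close> at \<open>0\<close> does not change the error, and what remains
  has all derivatives up to order \<open>m\<close> bounded by \<open>\<eta>\<close>, as \<open>m - i\<close> integrations from \<open>0\<close> over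
  \<open>[0, 1]\<close> do not increase the bound.
\<close>

lemma hermite_error_bound:
  assumes k: "odd k"
  shows "\<exists>A>0. \<forall>m \<phi> \<eta>. k div 2 \<le> m \<longrightarrow> m \<le> k \<longrightarrow>
     (\<forall>i<m. \<forall>s\<in>{0..1}. (\<phi> i has_real_derivative \<phi> (Suc i) s) (at s within {0..1})) \<longrightarrow>
     (\<forall>s\<in>{0..1}. \<bar>\<phi> m s - \<phi> m 0\<bar> \<le> \<eta>) \<longrightarrow> (\<forall>x\<in>{0..1}. \<bar>hermite_error k x \<phi>\<bar> \<le> A * \<eta>)"
proof -
  let ?c = "\<lambda>x. \<Sum>i\<le>k div 2. \<bar>poly (hermite_left k i) x\<bar> + \<bar>poly (hermite_right k i) x\<bar>"
  have "continuous_on {0..1} ?c" by (intro continuous_intros)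
  then have "bounded (?c ` {0..1})" by (intro compact_imp_bounded compact_continuous_image) auto
  then obtain A0 where A0: "A0 > 0" "\<And>x. x \<in> {0..1} \<Longrightarrow> \<bar>?c x\<bar> \<le> A0"
    unfolding bounded_pos by auto
  then have A0: "\<And>x. x \<in> {0..1} \<Longrightarrow> ?c x \<le> A0" "A0 > 0"
    by (auto dest: abs_le_D1)
  show ?thesis
  proof (intro exI[of _ "1 + A0"] conjI allI impI ballI)
    fix m \<phi> \<eta> x
    assume m: "k div 2 \<le> m" "m \<le> k"
      and d: "\<forall>i<m. \<forall>s\<in>{0..1}. (\<phi> i has_real_derivative \<phi> (Suc i) s) (at s within {0..1})"
      and \<eta>: "\<forall>s\<in>{0..1}. \<bar>\<phi> m s - \<phi> m 0\<bar> \<le> \<eta>" and x: "x \<in> {0..1::real}"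
 have \<eta>0: "0 \<le> \<eta>" using \<eta>[rule_format, of 0] by simp
    obtain T where T: "degree T \<le> m" "\<And>i. i \<le> m \<Longrightarrow> poly ((pderiv ^^ i) T) 0 = \<phi> i 0"
      using interpolating_multiple_exists[of 1 0 "Suc m" "\<lambda>i. \<phi> i 0"] by (auto simp: less_Suc_eq_le)
    \<comment> \<open>\<open>T\<close> is the Taylor polynomial; its derivative of order \<open>m\<close> is the constant \<open>\<phi> m 0\<close>.\<close>
    define \<rho> where "\<rho> i s = \<phi> i s - poly ((pderiv ^^ i) T) s" for i s
    have "degree ((pderiv ^^ m) T) = 0" using T(1) by (simp add: degree_higher_pderiv)
    then obtain c where "(pderiv ^^ m) T = [:c:]" by (auto elim: degree_eq_zeroE)
    with T(2)[of m] have top: "\<rho> m s = \<phi> m s - \<phi> m 0" for s by (simp add: \<rho>_def)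
    have \<rho>': "(\<rho> i has_real_derivative \<rho> (Suc i) s) (at s within {0..1})" if "i < m" "s \<in> {0..1}" for i s
      unfolding \<rho>_def using d that
      by (auto intro!: derivative_intros DERIV_subset[OF poly_DERIV])
    have bound: "\<forall>s\<in>{0..1}. \<bar>\<rho> i s\<bar> \<le> \<eta>" if "i \<le> m" for i
      using that
    proof (induction i rule: inc_induct)
      case base
      then show ?case using \<eta> by (simp add: top)
    next
      case (step i)
      show ?case
      proof
        fix s :: real assume s: "s \<in> {0..1}"
        have "norm (\<rho> i s - \<rho> i 0) \<le> \<eta> * norm (s - 0)"
          by (rule field_differentiable_bound[where S="{0..1}" and f'="\<rho> (Suc i)"])
            (use step \<rho>' s in auto)
        also have "\<dots> \<le> \<eta> * 1" using s \<eta>0 by (intro mult_left_mono) auto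
        finally show "\<bar>\<rho> i s\<bar> \<le> \<eta>" using T(2)[of i] step by (simp add: \<rho>_def)
      qed
    qed
    have "hermite_error k x \<phi> = hermite_error k x \<rho>"
      unfolding \<rho>_def hermite_error_diff using hermite_error_poly[OF k, of T x] T(1) m by simp
    also have "\<bar>\<dots>\<bar> \<le> \<bar>\<rho> 0 x\<bar> + (\<Sum>i\<le>k div 2. \<bar>\<rho> i 0\<bar> * \<bar>poly (hermite_left k i) x\<bar> + \<bar>\<rho> i 1\<bar> * \<bar>poly (hermite_right k i) x\<bar>)"
      unfolding hermite_error_def
      by (intro order_trans[OF abs_triangle_ineq4] add_left_mono order_trans[OF sum_abs] sum_mono)
        (auto intro: order_trans[OF abs_triangle_ineq] simp: abs_mult)
    also have "\<dots> \<le> \<eta> + (\<Sum>i\<le>k div 2. \<eta> * \<bar>poly (hermite_left k i) x\<bar> + \<eta> * \<bar>poly (hermite_right k i) x\<bar>)"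
      using bound m x by (intro add_mono sum_mono mult_right_mono) auto
    also have "\<dots> = \<eta> + \<eta> * ?c x" by (simp add: sum_distrib_left algebra_simps)
    also have "\<dots> \<le> \<eta> + \<eta> * A0" using A0(1)[OF x] \<eta>0 by (intro add_left_mono mult_left_mono)
    finally show "\<bar>hermite_error k x \<phi>\<bar> \<le> (1 + A0) * \<eta>" by (simp add: algebra_simps)
  qed (use A0 in auto)
qed

text \<open>
  The error functional in the variable \<open>t\<close> commutes with derivatives in \<open>s\<close>, so the one-variable
  bound can be used twice.
\<close>

lemma hermite_error_double_bound:
  assumes k: "odd k"
  shows "\<exists>A>0. \<forall>m F \<eta>. k div 2 \<le> m \<longrightarrow> m \<le> k \<longrightarrow>
     (\<forall>i<m. \<forall>j\<le>m. \<forall>s\<in>{0..1}. \<forall>t\<in>{0..1}.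
        ((\<lambda>s. F i j s t) has_real_derivative F (Suc i) j s t) (at s within {0..1})) \<longrightarrow>
     (\<forall>j<m. \<forall>s\<in>{0..1}. \<forall>t\<in>{0..1}.
        (F m j s has_real_derivative F m (Suc j) s t) (at t within {0..1})) \<longrightarrow>
     (\<forall>s\<in>{0..1}. \<forall>t\<in>{0..1}. \<bar>F m m s t - F m m 0 t - F m m s 0 + F m m 0 0\<bar> \<le> \<eta>) \<longrightarrow>
     (\<forall>x\<in>{0..1}. \<bar>hermite_error k x (\<lambda>i s. hermite_error k x (\<lambda>j t. F i j s t))\<bar> \<le> A * \<eta>)"
proof -
  obtain A where A: "A > 0" and bnd: "\<And>m \<phi> \<eta> x. k div 2 \<le> m \<Longrightarrow> m \<le> k \<Longrightarrow>
     (\<And>i s. i < m \<Longrightarrow> s \<in> {0..1} \<Longrightarrow> (\<phi> i has_real_derivative \<phi> (Suc i) s) (at s within {0..1})) \<Longrightarrow>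
     (\<And>s. s \<in> {0..1} \<Longrightarrow> \<bar>\<phi> m s - \<phi> m 0\<bar> \<le> \<eta>) \<Longrightarrow> x \<in> {0..1} \<Longrightarrow> \<bar>hermite_error k x \<phi>\<bar> \<le> A * \<eta>"
    using hermite_error_bound[OF k] by metis
  show ?thesis
  proof (intro exI[of _ "A * A"] conjI allI impI ballI)
    fix m F \<eta> x
    assume m: "k div 2 \<le> m" "m \<le> k"
      and d1: "\<forall>i<m. \<forall>j\<le>m. \<forall>s\<in>{0..1}. \<forall>t\<in>{0..1}.
        ((\<lambda>s. F i j s t) has_real_derivative F (Suc i) j s t) (at s within {0..1})"
      and d2: "\<forall>j<m. \<forall>s\<in>{0..1}. \<forall>t\<in>{0..1}.
        (F m j s has_real_derivative F m (Suc j) s t) (at t within {0..1})"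
      and \<eta>: "\<forall>s\<in>{0..1}. \<forall>t\<in>{0..1}. \<bar>F m m s t - F m m 0 t - F m m s 0 + F m m 0 0\<bar> \<le> \<eta>"
      and x: "x \<in> {0..1::real}"
    define \<psi> where "\<psi> i s = hermite_error k x (\<lambda>j t. F i j s t)" for i s
    have "\<bar>hermite_error k x \<psi>\<bar> \<le> A * (A * \<eta>)"
    proof (rule bnd[OF m _ _ x])
      fix i s assume i: "i < m" and s: "s \<in> {0..1::real}"
      show "(\<psi> i has_real_derivative \<psi> (Suc i) s) (at s within {0..1})"
        unfolding \<psi>_def hermite_error_def using d1 i s m x
        by (auto intro!: derivative_eq_intros sum.cong) 
    next
      fix s assume s: "s \<in> {0..1::real}"
      have "\<bar>hermite_error k x (\<lambda>j t. F m j s t - F m j 0 t)\<bar> \<le> A * \<eta>"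
      proof (rule bnd[OF m _ _ x])
        fix j t assume "j < m" "t \<in> {0..1::real}"
        then show "((\<lambda>t. F m j s t - F m j 0 t) has_real_derivative F m (Suc j) s t - F m (Suc j) 0 t) (at t within {0..1})"
          using d2 s by (auto intro!: derivative_intros)
      next
        fix t assume "t \<in> {0..1::real}"
        with \<eta> s have "\<bar>F m m s t - F m m 0 t - F m m s 0 + F m m 0 0\<bar> \<le> \<eta>" by blast
        then show "\<bar>F m m s t - F m m 0 t - (F m m s 0 - F m m 0 0)\<bar> \<le> \<eta>" by (simp add: algebra_simps)
      qed
      then show "\<bar>\<psi> m s - \<psi> m 0\<bar> \<le> A * \<eta>" by (simp add: \<psi>_def hermite_error_diff)
    qed
    then show "\<bar>hermite_error k x (\<lambda>i s. hermite_error k x (\<lambda>j t. F i j s t))\<bar> \<le> A * A * \<eta>"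
      by (simp add: \<psi>_def[abs_def] mult.assoc)
  qed (use A in auto)
qed

section \<open>Regular variation at zero\<close>

text \<open>
  For \<open>y > 0\<close> the ratio \<open>r (y * s) / r s\<close> is bounded for small \<open>s\<close>, with a bound and a range of \<open>s\<close>
  that depend on \<open>y\<close>.  Let \<open>E n\<close> collect the \<open>y\<close> for which \<open>n + 1\<close> serves as bound on
  \<open>(0, 1 / (n + 1))\<close>.  These sets cover \<open>(0, \<infinity>)\<close>, so by Baire's theorem one of them is dense in an
  interval; finitely many multiples of that interval cover \<open>[1/2, 2]\<close>, and each multiplication
  costs a constant factor.  Without measurability of \<open>r\<close> density is the most that can be said.
\<close>

lemma regularly_varying_0_dense_bound:
  assumes r: "regularly_varying_0 r \<rho>"
  shows "\<exists>C>0. \<exists>s0>0. \<exists>\<Lambda>. {1/2..2} \<subseteq> closure \<Lambda> \<and>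
    (\<forall>s. 0 < s \<and> s < s0 \<longrightarrow> 0 < r s \<and> (\<forall>y\<in>\<Lambda>. r (y * s) \<le> C * r s))"
proof -
  have pos: "\<forall>\<^sub>F s in at_right 0. 0 < r s" using r by (simp add: regularly_varying_0_def)
  have ev: "\<forall>\<^sub>F s in at_right 0. r (y * s) \<le> (y powr \<rho> + 1) * r s" if "0 < y" for y
  proof -
    have "((\<lambda>x. r (y * x) / r x) \<longlongrightarrow> y powr \<rho>) (at_right 0)"
      using r that by (simp add: regularly_varying_0_def)
    then have "\<forall>\<^sub>F x in at_right 0. r (y * x) / r x < y powr \<rho> + 1"
      by (rule order_tendstoD) simp
    with pos show ?thesis by eventually_elim (simp add: field_simps)
  qed
  \<comment> \<open>Baire's theorem is applied to the complements of the closures of these sets, whose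
    intersection misses \<open>(0, \<infinity>)\<close>.\<close>
  define E where "E n = {y. 0 < y \<and> (\<forall>s. 0 < s \<and> s < 1 / real (Suc n) \<longrightarrow> r (y * s) \<le> real (Suc n) * r s)}" for n
  have cover: "\<exists>n. y \<in> E n" if y: "0 < y" for y
  proof -
    obtain d where d: "0 < d" "\<And>s. 0 < s \<Longrightarrow> s < d \<Longrightarrow> 0 < r s \<and> r (y * s) \<le> (y powr \<rho> + 1) * r s"
      using eventually_conj[OF pos ev[OF y]] by (auto simp: eventually_at_right_field)
    obtain n :: nat where n: "max (1 / d) (y powr \<rho> + 1) < real n" using reals_Archimedean2 by blast
    then have "1 / d < real (Suc n)" "y powr \<rho> + 1 \<le> real (Suc n)" by auto
    then have 1: "1 / real (Suc n) < d" using d(1) by (simp add: field_simps)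
    have "r (y * s) \<le> real (Suc n) * r s" if "0 < s" "s < 1 / real (Suc n)" for s
      using d(2)[of s] that 1 \<open>y powr \<rho> + 1 \<le> real (Suc n)\<close>
      by (meson less_trans less_imp_le mult_right_mono order_trans)
    with y show ?thesis by (auto simp: E_def)
  qed
  obtain n where n: "interior (closure (E n)) \<noteq> {}"
  proof (rule ccontr)
    assume "\<not> thesis"
    with that have e: "interior (closure (E n)) = {}" for n by blast
    have "UNIV \<subseteq> closure (\<Inter> (range (\<lambda>n. - closure (E n))))"
    proof (rule Baire)
      fix T assume "T \<in> range (\<lambda>n. - closure (E n))"
      then obtain n where T: "T = - closure (E n)" by blast
      then have "closure T = UNIV" using e by (simp add: closure_complement)
      with T show "openin (top_of_set UNIV) T \<and> UNIV \<subseteq> closure T" by (auto simp: open_openin[symmetric])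
    qed auto
    moreover have "\<Inter> (range (\<lambda>n. - closure (E n))) \<subseteq> {..0}"
    proof
      fix y assume y: "y \<in> \<Inter> (range (\<lambda>n. - closure (E n)))"
      then have "y \<notin> E n" for n using closure_subset[of "E n"] by auto
      with cover show "y \<in> {..0}" by (metis atMost_iff not_less)
    qed
    then have "closure (\<Inter> (range (\<lambda>n. - closure (E n)))) \<subseteq> {..0}" by (rule closure_minimal) simp
    ultimately have "(1::real) \<in> {..0}" by blast
    then show False by simp
  qed
  define U where "U = interior (closure (E n)) \<inter> {0<..}"
  have U: "open U" unfolding U_def by (intro open_Int open_interior open_greaterThan)
  obtain u0 where u0: "u0 \<in> U"
  proof -
    obtain x where x: "x \<in> interior (closure (E n))" using n by blast
    then obtain e where e: "0 < e" "ball x e \<subseteq> interior (closure (E n))"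
      using open_interior open_contains_ball by blast
    have "E n \<subseteq> {0..}" by (auto simp: E_def)
    then have "closure (E n) \<subseteq> {0..}" by (rule closure_minimal) simp
    with x interior_subset have "0 \<le> x" by fastforce
    with e have "x + e / 2 \<in> U" by (auto simp: U_def subset_iff dist_real_def)
    then show ?thesis by (rule that)
  qed
  have "{1/2..2} \<subseteq> (\<Union>w\<in>{0<..}. (*) w ` U)"
  proof
    fix x :: real assume "x \<in> {1/2..2}"
    then have "x = (x / u0) * u0" "0 < x / u0" using u0 by (auto simp: U_def)
    with u0 show "x \<in> (\<Union>w\<in>{0<..}. (*) w ` U)" by blast
  qed
  moreover have "open ((*) w ` U)" if "w \<in> {0<..}" for w :: real
    using open_scaling[OF _ U, of w] that by simp
  ultimately obtain W where W: "W \<subseteq> {0<..}" "finite W" "{1/2..2} \<subseteq> (\<Union>w\<in>W. (*) w ` U)"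
    using compactE_image[of "{1/2..2::real}" "{0<..}" "\<lambda>w. (*) w ` U"] by auto
  have "\<forall>\<^sub>F s in at_right 0. \<forall>w\<in>W. r (w * s) \<le> (w powr \<rho> + 1) * r s"
    using W ev by (intro eventually_ball_finite) auto
  with pos have "\<forall>\<^sub>F s in at_right 0. 0 < r s \<and> (\<forall>w\<in>W. r (w * s) \<le> (w powr \<rho> + 1) * r s)"
    by (rule eventually_conj)
  then obtain d where d: "0 < d" "\<And>s w. 0 < s \<Longrightarrow> s < d \<Longrightarrow> 0 < r s"
     "\<And>s w. 0 < s \<Longrightarrow> s < d \<Longrightarrow> w \<in> W \<Longrightarrow> r (w * s) \<le> (w powr \<rho> + 1) * r s"
    by (auto simp: eventually_at_right_field)
  define K where "K = (\<Sum>w\<in>W. w powr \<rho> + 1)"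
  define L where "L = (\<Sum>w\<in>W. w) + 1"
  have K: "w powr \<rho> + 1 \<le> K" if "w \<in> W" for w
    unfolding K_def using that W by (intro member_le_sum) (auto intro: add_nonneg_nonneg)
  have L: "w \<le> L" if "w \<in> W" for w
    unfolding L_def using that W member_le_sum[of w W "\<lambda>w. w"] by (force simp: subset_iff)
  have L0: "0 < L" unfolding L_def using W by (intro add_nonneg_pos sum_nonneg) (auto simp: subset_iff)
  have "K \<ge> 0" unfolding K_def by (intro sum_nonneg) auto
  \<comment> \<open>The factor \<open>w * y\<close> is applied in two steps; the bound on \<open>s0\<close> keeps \<open>w * s\<close> in the range of
    validity for \<open>y\<close>.\<close>
  define \<Lambda> where "\<Lambda> = {w * y | w y. w \<in> W \<and> y \<in> E n}"
  have dense: "{1/2..2} \<subseteq> closure \<Lambda>"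
  proof
    fix x :: real assume "x \<in> {1/2..2}"
    with W obtain w u where wu: "w \<in> W" "u \<in> U" "x = w * u" by blast
    then have "u \<in> closure (E n)" using interior_subset by (auto simp: U_def)
    then obtain f where f: "\<And>i. f i \<in> E n" "f \<longlonglongrightarrow> u" unfolding closure_sequential by blast
    have "(\<lambda>i. w * f i) \<longlonglongrightarrow> x" unfolding wu(3) by (intro tendsto_intros f)
    moreover have "w * f i \<in> \<Lambda>" for i using f(1) wu(1) by (auto simp: \<Lambda>_def)
    ultimately show "x \<in> closure \<Lambda>"
      unfolding closure_sequential by (intro exI[of _ "\<lambda>i. w * f i"]) auto
  qed
  define s0 where "s0 = min d (1 / real (Suc n) / L)"
  have "0 < s0" using d L0 by (simp add: s0_def)
  moreover have "0 < real (Suc n) * (K + 1)" using \<open>K \<ge> 0\<close> by simp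
  moreover have "\<forall>s. 0 < s \<and> s < s0 \<longrightarrow> 0 < r s \<and> (\<forall>y\<in>\<Lambda>. r (y * s) \<le> real (Suc n) * (K + 1) * r s)"
  proof (intro conjI allI impI ballI)
    fix s assume s: "0 < s \<and> s < s0"
    then show rs: "0 < r s" using d by (simp add: s0_def)
    fix z assume "z \<in> \<Lambda>"
    then obtain w y where wy: "z = w * y" "w \<in> W" "y \<in> E n" by (auto simp: \<Lambda>_def)
    then have w0: "0 < w" using W by auto
    have "w * s \<le> L * s" using L[OF wy(2)] s by (intro mult_right_mono) auto
    also have "s < 1 / real (Suc n) / L" using s by (simp add: s0_def del: of_nat_Suc)
    then have "L * s < 1 / real (Suc n)" using L0 by (simp only: pos_less_divide_eq mult.commute)
    finally have ws: "w * s < 1 / real (Suc n)" .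
    have "r (z * s) = r (y * (w * s))" by (simp add: wy mult_ac)
    also have "\<dots> \<le> real (Suc n) * r (w * s)"
      using wy(3) ws w0 s by (auto simp: E_def)
    also have "\<dots> \<le> real (Suc n) * ((w powr \<rho> + 1) * r s)"
      using d(3)[of s w] s wy by (intro mult_left_mono) (auto simp: s0_def)
    also have "\<dots> \<le> real (Suc n) * ((K + 1) * r s)"
      using K[OF wy(2)] rs by (intro mult_left_mono mult_right_mono) auto
    finally show "r (z * s) \<le> real (Suc n) * (K + 1) * r s" by (simp add: mult.assoc)
  qed
  ultimately show ?thesis using dense by blast
qed

text \<open>
  A continuous minorant \<open>g\<close> of \<open>r\<close> inherits the bound from a dense set of factors to all factors.
\<close>

lemma regularly_varying_0_majorant_bound:
  assumes r: "regularly_varying_0 r \<rho>" and a: "0 < a"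
    and g: "continuous_on {0<..a} g" "\<And>s. s \<in> {0<..a} \<Longrightarrow> g s \<le> r s"
  shows "\<exists>C>0. \<exists>s0>0. \<forall>s. 0 < s \<and> s < s0 \<longrightarrow> 0 < r s \<and> (\<forall>x\<in>{s/2..2 * s}. g x \<le> C * r s)"
proof -
  obtain C s0 \<Lambda> where C: "0 < C" "0 < s0" "{1/2..2} \<subseteq> closure \<Lambda>"
    and b: "\<And>s. 0 < s \<Longrightarrow> s < s0 \<Longrightarrow> 0 < r s" "\<And>s y. 0 < s \<Longrightarrow> s < s0 \<Longrightarrow> y \<in> \<Lambda> \<Longrightarrow> r (y * s) \<le> C * r s"
    using regularly_varying_0_dense_bound[OF r] by metis
  have "\<forall>s. 0 < s \<and> s < min s0 (a / 4) \<longrightarrow> 0 < r s \<and> (\<forall>x\<in>{s/2..2 * s}. g x \<le> C * r s)"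
  proof (intro conjI allI impI ballI)
   fix s assume s: "0 < s \<and> s < min s0 (a / 4)" 
    then show "0 < r s" using b by simp
    fix x assume x: "x \<in> {s/2..2 * s}"
    then have "x / s \<in> {1/2..2}" using s by (auto simp: field_simps)
    then have "x / s \<in> closure \<Lambda>" using C(3) by blast
    then obtain f where f: "\<And>i. f i \<in> \<Lambda>" "f \<longlonglongrightarrow> x / s" unfolding closure_sequential by blast
    have "(\<lambda>i. f i * s) \<longlonglongrightarrow> x / s * s" by (intro tendsto_intros f)
    then have lim: "(\<lambda>i. f i * s) \<longlonglongrightarrow> x" using s by simp
    have xa: "0 < x" "x < a" using x s by auto
    have ev: "\<forall>\<^sub>F i in sequentially. f i * s \<in> {0<..a}"
      using order_tendstoD(1)[OF lim xa(1)] order_tendstoD(2)[OF lim xa(2)] by eventually_elim auto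
    have "(\<lambda>i. g (f i * s)) \<longlonglongrightarrow> g x"
      using continuous_on_tendsto_compose[OF g(1) lim _ ev] xa by simp
    moreover have "\<forall>\<^sub>F i in sequentially. g (f i * s) \<le> C * r s"
      using ev
    proof eventually_elim
      case (elim i)
      from g(2)[OF elim] b(2)[of s "f i"] f(1) s show ?case by (auto intro: order_trans)
    qed
    ultimately show "g x \<le> C * r s" by (intro tendsto_upperbound) auto
  qed
  moreover have "0 < min s0 (a / 4)" using C a by simp
  ultimately show ?thesis using C(1) by blast
qed

section \<open>Quasi regular designs\<close>

lemma design_density_pos: "design_density h \<Longrightarrow> t \<in> {0<..1} \<Longrightarrow> 0 < h t"
  by (auto simp: design_density_def pos_cont_on_def)

lemma design_density_cont: "design_density h \<Longrightarrow> continuous_on {0<..1} h"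
  by (auto simp: design_density_def pos_cont_on_def)

lemma design_density_integrable:
  assumes "design_density h"
  shows "set_integrable lborel {0..1} h" "(LBINT t:{0..1}. h t) = 1"
proof -
  have h: "set_integrable lborel {0<..1} h" "(LBINT t:{0<..1}. h t) = 1"
    using assms by (auto simp: design_density_def)
  have "(\<lambda>x. indicator {0} x *\<^sub>R h x) = (\<lambda>x. indicator {0} x *\<^sub>R h 0)"
    by (auto simp: indicator_def)
  then have "set_integrable lborel {0} h" by (simp add: set_integrable_def)
  then have "set_integrable lborel ({0} \<union> {0<..1}) h" using h(1) by (intro set_integrable_Un) auto
  also have "{0} \<union> {0<..1} = {0..1::real}" by auto
  finally show i: "set_integrable lborel {0..1} h" .
  have "AE x in lborel. x \<noteq> (0::real)" by (rule AE_lborel_singleton)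
  then have "AE x in lborel. indicator {0..1} x *\<^sub>R h x = indicator {0<..1} x *\<^sub>R h x"
    by eventually_elim (auto simp: indicator_def)
  then have "(LBINT t:{0..1}. h t) = (LBINT t:{0<..1}. h t)"
    unfolding set_lebesgue_integral_def using i h(1)
    by (intro integral_cong_AE) (auto simp: set_integrable_def dest: borel_measurable_integrable)
  with h(2) show "(LBINT t:{0..1}. h t) = 1" by simp
qed

lemma cdf_of_eq_integral:
  assumes "design_density h" "t \<in> {0..1}"
  shows "cdf_of h t = integral {0..t} h"
proof -
  have "set_integrable lborel {0..t} h"
    by (rule set_integrable_subset[OF design_density_integrable(1)[OF assms(1)]]) (use assms(2) in auto)
  then show ?thesis unfolding cdf_of_def by (rule set_borel_integral_eq_integral)
qed

lemma cdf_of_0: "design_density h \<Longrightarrow> cdf_of h 0 = 0"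
  by (subst cdf_of_eq_integral) auto

lemma cdf_of_1: "design_density h \<Longrightarrow> cdf_of h 1 = 1"
  by (simp add: cdf_of_def design_density_integrable)

lemma cdf_of_continuous:
  assumes h: "design_density h"
  shows "continuous_on {0..1} (cdf_of h)"
proof -
  have "h integrable_on {0..1}"
    using set_borel_integral_eq_integral(1)[OF design_density_integrable(1)[OF h]] .
  then have "continuous_on {0..1} (\<lambda>t. integral {0..t} h)" by (rule indefinite_integral_continuous_1)
  then show ?thesis by (rule continuous_on_eq) (simp add: cdf_of_eq_integral h)
qed

lemma cdf_of_DERIV:
  assumes h: "design_density h" and t: "0 < t" "t < 1"
  shows "(cdf_of h has_real_derivative h t) (at t)"
proof -
  have i: "h integrable_on {0..1}"
    using set_borel_integral_eq_integral(1)[OF design_density_integrable(1)[OF h]] .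
  have "open {0<..<1::real}" "t \<in> {0<..<1}" using t by auto
  have "continuous_on {0<..<1} h" using design_density_cont[OF h] by (rule continuous_on_subset) auto
  then have "isCont h t" using t by (simp add: continuous_on_eq_continuous_at)
  then have "continuous (at t within ({0..1} - {})) h" by (rule continuous_at_imp_continuous_at_within)
  then have "((\<lambda>u. integral {0..u} h) has_vector_derivative h t) (at t within ({0..1} - {}))"
    using t by (intro integral_has_vector_derivative_continuous_at[OF i]) auto
  then have "((\<lambda>u. integral {0..u} h) has_real_derivative h t) (at t within {0..1})"
    by (simp add: has_real_derivative_iff_has_vector_derivative)
  then have "(cdf_of h has_real_derivative h t) (at t within {0..1})"
    by (rule has_field_derivative_transform_within[where d=1]) (use h t in \<open>auto simp: cdf_of_eq_integral\<close>)
  moreover have "at t within {0..1} = at t" using t by (simp add: at_within_Icc_at)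
  ultimately show ?thesis by simp
qed

text \<open>
  At \<open>0\<close> the density may be unbounded; the mean value theorem needs only continuity there.
\<close>

lemma cdf_of_mvt:
  assumes h: "design_density h" and st: "0 \<le> s" "s < t" "t \<le> 1"
  shows "\<exists>x. s < x \<and> x < t \<and> cdf_of h t - cdf_of h s = (t - s) * h x"
proof -
  have "continuous_on {s..t} (cdf_of h)"
    using cdf_of_continuous[OF h] by (rule continuous_on_subset) (use st in auto)
  moreover have "cdf_of h differentiable (at x)" if "s < x" "x < t" for x
    unfolding real_differentiable_def using cdf_of_DERIV[OF h, of x] that st by auto
  ultimately obtain l x where x: "s < x" "x < t" "DERIV (cdf_of h) x :> l"
      "cdf_of h t - cdf_of h s = (t - s) * l"
    using MVT[OF st(2)] by blast
  have "l = h x" using x(3) cdf_of_DERIV[OF h, of x] x(1,2) st by (auto intro: DERIV_unique)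
  with x show ?thesis by blast
qed

lemma cdf_of_less:
  assumes h: "design_density h" and st: "0 \<le> s" "s < t" "t \<le> 1"
  shows "cdf_of h s < cdf_of h t"
proof -
  obtain x where x: "s < x" "x < t" "cdf_of h t - cdf_of h s = (t - s) * h x"
    using cdf_of_mvt[OF assms] by blast
  have "0 < h x" using x st by (intro design_density_pos[OF h]) auto
  with x have "0 < cdf_of h t - cdf_of h s" by simp
  then show ?thesis by simp
qed

lemma cdf_of_less_iff:
  "design_density h \<Longrightarrow> s \<in> {0..1} \<Longrightarrow> t \<in> {0..1} \<Longrightarrow> cdf_of h s < cdf_of h t \<longleftrightarrow> s < t"
  using cdf_of_less[of h s t] cdf_of_less[of h t s] by (cases s t rule: linorder_cases) auto

lemma cdf_of_le_iff:
  "design_density h \<Longrightarrow> s \<in> {0..1} \<Longrightarrow> t \<in> {0..1} \<Longrightarrow> cdf_of h s \<le> cdf_of h t \<longleftrightarrow> s \<le> t"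
  using cdf_of_less_iff[of h t s] by (metis not_less)

lemma cdf_of_inj_on: "design_density h \<Longrightarrow> inj_on (cdf_of h) {0..1}"
  by (rule inj_onI) (metis cdf_of_le_iff order_antisym order_refl)

lemma cdf_of_image: "design_density h \<Longrightarrow> cdf_of h ` {0..1} = {0..1}"
proof
  assume h: "design_density h"
  show "cdf_of h ` {0..1} \<subseteq> {0..1}"
  proof (rule image_subsetI)
    fix t :: real assume t: "t \<in> {0..1}"
    have "cdf_of h 0 \<le> cdf_of h t" "cdf_of h t \<le> cdf_of h 1"
      using t by (subst cdf_of_le_iff[OF h]; simp)+
    then show "cdf_of h t \<in> {0..1}" by (simp add: cdf_of_0[OF h] cdf_of_1[OF h])
  qed
  show "{0..1} \<subseteq> cdf_of h ` {0..1}"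
  proof
    fix y :: real assume "y \<in> {0..1}"
    then show "y \<in> cdf_of h ` {0..1}"
      using IVT'[OF _ _ _ cdf_of_continuous[OF h], of y] by (auto simp: cdf_of_0[OF h] cdf_of_1[OF h])
  qed
qed

lemma cdf_of_in: "design_density h \<Longrightarrow> t \<in> {0..1} \<Longrightarrow> cdf_of h t \<in> {0..1}"
  using cdf_of_image by blast

lemma cdf_of_pos: "design_density h \<Longrightarrow> t \<in> {0<..1} \<Longrightarrow> 0 < cdf_of h t"
  using cdf_of_less[of h 0 t] by (auto simp: cdf_of_0)

lemma quantile_of_cdf: "design_density h \<Longrightarrow> t \<in> {0..1} \<Longrightarrow> quantile_of h (cdf_of h t) = t"
  unfolding quantile_of_def by (intro inv_into_f_f cdf_of_inj_on)

lemma cdf_of_quantile: "design_density h \<Longrightarrow> s \<in> {0..1} \<Longrightarrow> cdf_of h (quantile_of h s) = s"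
  unfolding quantile_of_def by (intro f_inv_into_f) (simp only: cdf_of_image)

lemma quantile_of_in: "design_density h \<Longrightarrow> s \<in> {0..1} \<Longrightarrow> quantile_of h s \<in> {0..1}"
  unfolding quantile_of_def by (intro inv_into_into) (simp only: cdf_of_image)

lemma quantile_of_pos: "design_density h \<Longrightarrow> s \<in> {0<..1} \<Longrightarrow> quantile_of h s \<in> {0<..1}"
  using quantile_of_in[of h s] cdf_of_quantile[of h s] cdf_of_0[of h]
  by (cases "quantile_of h s = 0") (simp_all add: less_le)

lemma quantile_of_continuous:
  assumes h: "design_density h"
  shows "continuous_on {0..1} (quantile_of h)"
proof -
  have "continuous_on (cdf_of h ` {0..1}) (quantile_of h)"
    by (intro continuous_on_inv cdf_of_continuous h) (auto simp: quantile_of_cdf h)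
  then show ?thesis by (simp add: cdf_of_image h)
qed

lemma quantile_density_cdf:
  "design_density h \<Longrightarrow> t \<in> {0<..1} \<Longrightarrow> quantile_density h (cdf_of h t) = 1 / h t"
  using cdf_of_pos[of h t] by (auto simp: quantile_density_def quantile_of_cdf)

lemma quantile_density_continuous: "design_density h \<Longrightarrow> continuous_on {0..1} (quantile_density h)"
  by (simp add: design_density_def)

lemma quantile_density_pos: "design_density h \<Longrightarrow> s \<in> {0<..1} \<Longrightarrow> 0 < quantile_density h s"
proof -
  assume h: "design_density h" and s: "s \<in> {0<..1}"
  note q = quantile_of_pos[OF h s]
  have "cdf_of h (quantile_of h s) = s" using s by (intro cdf_of_quantile[OF h]) auto
  with quantile_density_cdf[OF h q] have "quantile_density h s = 1 / h (quantile_of h s)" by simp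
  with design_density_pos[OF h q] show ?thesis by simp
qed

lemma qRS_knots:
  assumes h: "design_density h" and T: "qRS h T" and n: "1 \<le> n"
  shows "T n 0 = 0" "T n n = 1"
    "i < j \<Longrightarrow> j \<le> n \<Longrightarrow> T n i < T n j"
    "i \<le> n \<Longrightarrow> T n i \<in> {0..1}"
    "i \<le> n \<Longrightarrow> cdf_of h (T n i) = real i / real n"
proof -
  have d: "design n (T n)" "\<And>i. i \<in> {1..n} \<Longrightarrow> cdf_of h (T n i) = real i / real n"
    using T n by (simp_all add: qRS_def cdf_of_def)
  then show 0: "T n 0 = 0" "T n n = 1" by (auto simp: design_def)
  show lt: "T n i < T n j" if "i < j" "j \<le> n" for i j
    using that
  proof (induction j)
    case (Suc j)
    then have "T n j < T n (Suc j)" using d(1) by (auto simp: design_def)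
    with Suc show ?case by (cases "i = j") (auto intro: less_trans)
  qed simp
  show "T n i \<in> {0..1}" if "i \<le> n"
  proof -
    have "T n 0 \<le> T n i" using lt[of 0 i] that by (cases "i = 0") auto
    moreover have "T n i \<le> T n n" using lt[of i n] that by (cases "i = n") auto
    ultimately show ?thesis using 0 by simp
  qed
  show "cdf_of h (T n i) = real i / real n" if "i \<le> n"
    using d(2)[of i] that 0 cdf_of_0[OF h] by (cases "i = 0") simp_all
qed

text \<open>
  The mean value theorem for the distribution function on a knot interval, which has mass \<open>1 / n\<close>.
\<close>

lemma qRS_spacing:
  assumes h: "design_density h" and T: "qRS h T" and j: "1 \<le> j" "j \<le> n"
  shows "\<exists>\<xi>. real (j - 1) / real n < \<xi> \<and> \<xi> < real j / real n
    \<and> real n * (T n j - T n (j - 1)) = quantile_density h \<xi>"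
proof -
  have n: "1 \<le> n" using j by simp
  note k = qRS_knots[OF h T n]
  have lt: "T n (j - 1) < T n j" using j by (intro k) auto
  have I: "T n (j - 1) \<in> {0..1}" "T n j \<in> {0..1}" using j by (auto intro!: k(4) simp del: atLeastAtMost_iff)
  then obtain x where x: "T n (j - 1) < x" "x < T n j"
      "cdf_of h (T n j) - cdf_of h (T n (j - 1)) = (T n j - T n (j - 1)) * h x"
    using cdf_of_mvt[OF h _ lt] by auto
  have "cdf_of h (T n j) - cdf_of h (T n (j - 1)) = real j / real n - real (j - 1) / real n"
    using k(5)[of j] k(5)[of "j - 1"] j by simp
  also have "\<dots> = 1 / real n" using j by (simp add: field_simps of_nat_diff)
  finally have "(T n j - T n (j - 1)) * h x = 1 / real n" using x by simp
  moreover have hx: "0 < h x" using x I by (intro design_density_pos[OF h]) auto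
  ultimately have "real n * (T n j - T n (j - 1)) = 1 / h x" using n by (simp add: field_simps)
  also have "\<dots> = quantile_density h (cdf_of h x)" using x I by (intro quantile_density_cdf[OF h, symmetric]) auto
  finally have 1: "real n * (T n j - T n (j - 1)) = quantile_density h (cdf_of h x)" .
  have "cdf_of h (T n (j - 1)) < cdf_of h x" "cdf_of h x < cdf_of h (T n j)"
    using x I by (auto intro!: cdf_of_less[OF h])
  with 1 k(5)[of j] k(5)[of "j - 1"] j show ?thesis by auto
qed

text \<open>
  With \<open>H\<close> the distribution function, the hypothesis says that \<open>H powr \<sigma>\<close> has derivative at least
  \<open>\<sigma> / \<epsilon>\<close> near \<open>0\<close>.
\<close>

lemma cdf_of_power_bound:
  assumes h: "design_density h" and \<sigma>: "0 < \<sigma>" and \<epsilon>: "0 < \<epsilon>"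
    and g: "\<And>s. 0 < s \<Longrightarrow> s \<le> d \<Longrightarrow> s \<le> 1 \<Longrightarrow> quantile_density h s \<le> \<epsilon> * s powr (\<sigma> - 1)"
    and t: "0 < t" "t \<le> 1" "cdf_of h t \<le> d"
  shows "t \<le> \<epsilon> / \<sigma> * cdf_of h t powr \<sigma>"
proof -
  let ?P = "\<lambda>x. cdf_of h x powr \<sigma>"
  have "continuous_on {0..t} (cdf_of h)"
    using cdf_of_continuous[OF h] by (rule continuous_on_subset) (use t in auto)
  moreover have "0 \<le> cdf_of h x" if "x \<in> {0..t}" for x using cdf_of_in[OF h, of x] that t by auto
  ultimately have "continuous_on {0..t} ?P" using \<sigma> by (intro continuous_on_powr') auto
  moreover have D: "(?P has_real_derivative \<sigma> * cdf_of h x powr (\<sigma> - 1) * h x) (at x)" if "0 < x" "x < t" for x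
  proof -
    have "0 < cdf_of h x" using that t by (intro cdf_of_pos[OF h]) auto
    moreover have "(cdf_of h has_real_derivative h x) (at x)" using that t by (intro cdf_of_DERIV[OF h]) auto
    ultimately show ?thesis by (intro DERIV_chain2[OF has_real_derivative_powr])
  qed
  moreover have "?P differentiable (at x)" if "0 < x" "x < t" for x
    unfolding real_differentiable_def using D[OF that] by blast
  ultimately obtain l x where x: "0 < x" "x < t" "DERIV ?P x :> l" "?P t - ?P 0 = (t - 0) * l"
    using MVT[OF t(1), of ?P] by blast
  have l: "l = \<sigma> * cdf_of h x powr (\<sigma> - 1) * h x" using x(3) D[OF x(1,2)] by (rule DERIV_unique)
  have hx: "0 < h x" using x t by (intro design_density_pos[OF h]) auto
  have H: "0 < cdf_of h x" "cdf_of h x \<le> d" "cdf_of h x \<le> 1"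
    using x t cdf_of_pos[OF h, of x] cdf_of_less[OF h, of x t] cdf_of_in[OF h, of x] by auto
  have "1 / h x \<le> \<epsilon> * cdf_of h x powr (\<sigma> - 1)"
    using g[OF H] quantile_density_cdf[OF h, of x] x t by auto
  then have "1 \<le> \<epsilon> * (cdf_of h x powr (\<sigma> - 1) * h x)" using hx by (simp add: field_simps)
  then have "\<sigma> * 1 \<le> \<sigma> * (\<epsilon> * (cdf_of h x powr (\<sigma> - 1) * h x))" using \<sigma> by (intro mult_left_mono) auto
  then have "\<sigma> \<le> \<epsilon> * l" by (simp add: l mult_ac)
  then have "t * \<sigma> \<le> t * (\<epsilon> * l)" using t by (intro mult_left_mono) auto
  also have "\<dots> = \<epsilon> * ?P t" using x(4) \<sigma> cdf_of_0[OF h] by simp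
  finally show ?thesis using \<sigma> by (simp add: field_simps)
qed

section \<open>Integrated fractional Brownian motion\<close>

lemma set_integral_continuous_real:
  fixes f :: "real \<Rightarrow> real"
  assumes "continuous_on {a..b} f"
  shows "(LBINT s:{a..b}. f s) = integral {a..b} f"
  using borel_integrable_atLeastAtMost'[OF assms] by (rule set_borel_integral_eq_integral)

text \<open>
  The binomial expansion of \<open>(t - s) ^ j\<close> removes the parameter \<open>t\<close> from the integrand, so that the
  fundamental theorem of calculus applies to each term.
\<close>

lemma fbm_integral_path_deriv:
  assumes b: "continuous_on {0..1} (\<lambda>t. B t \<omega>)" and t: "t \<in> {0..1}"
  shows "((\<lambda>t. fbm_integral B (Suc j) t \<omega>) has_real_derivative fbm_integral B j t \<omega>) (at t within {0..1})"
proof -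
  define P where "P k t = integral {0..t} (\<lambda>s. s ^ k * B s \<omega>)" for k :: nat and t
  define F where "F j t = (\<Sum>k\<le>j. of_nat (j choose k) * (-1) ^ k * (t ^ (j - k) * P k t))" for j t
  have P': "(P k has_real_derivative t ^ k * B t \<omega>) (at t within {0..1})" if "t \<in> {0..1}" for k t
    unfolding P_def[abs_def] using that b
    by (intro integral_has_real_derivative continuous_intros) auto
  have F: "(LBINT s:{0..t}. (t - s) ^ j * B s \<omega>) = F j t" if t: "t \<in> {0..1}" for j t
  proof -
    have b': "continuous_on {0..t} (\<lambda>t. B t \<omega>)" using b by (rule continuous_on_subset) (use t in auto)
    have "(LBINT s:{0..t}. (t - s) ^ j * B s \<omega>) = integral {0..t} (\<lambda>s. (t - s) ^ j * B s \<omega>)"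
      using b' by (intro set_integral_continuous_real continuous_intros)
    also have "\<dots> = integral {0..t} (\<lambda>s. \<Sum>k\<le>j. of_nat (j choose k) * (-1) ^ k * t ^ (j - k) * (s ^ k * B s \<omega>))"
    proof (rule integral_cong)
      fix s
      have expand: "(t - s) ^ j = (\<Sum>k\<le>j. of_nat (j choose k) * (- s) ^ k * t ^ (j - k))"
        using binomial_ring[of "- s" t j] by simp
      show "(t - s) ^ j * B s \<omega> = (\<Sum>k\<le>j. of_nat (j choose k) * (-1) ^ k * t ^ (j - k) * (s ^ k * B s \<omega>))"
        unfolding expand sum_distrib_right by (intro sum.cong refl) (simp add: power_minus[of s] mult_ac)
    qed
    also have "\<dots> = (\<Sum>k\<le>j. integral {0..t} (\<lambda>s. of_nat (j choose k) * (-1) ^ k * t ^ (j - k) * (s ^ k * B s \<omega>)))"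
      using b' by (intro Henstock_Kurzweil_Integration.integral_sum integrable_continuous_real continuous_intros) auto
    also have "\<dots> = F j t" by (simp add: F_def P_def mult.assoc)
    finally show ?thesis .
  qed
  have F0': "(F j has_real_derivative (\<Sum>k\<le>j. of_nat (j choose k) * (-1) ^ k *
      (real (j - k) * t ^ (j - k - 1) * P k t + t ^ k * B t \<omega> * t ^ (j - k)))) (at t within {0..1})" for j
    unfolding F_def[abs_def]
    by (rule DERIV_sum, rule DERIV_cmult, rule DERIV_mult[OF _ P'[OF t]])
      (auto intro!: derivative_eq_intros)
  have zero: "(\<Sum>k\<le>j. of_nat (j choose k) * (-1) ^ k * (t ^ k * B t \<omega> * t ^ (j - k))) = 0 ^ j * B t \<omega>" for j
  proof -
    have "(\<Sum>k\<le>j. of_nat (j choose k) * (-1) ^ k * (t ^ k * B t \<omega> * t ^ (j - k)))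
      = (\<Sum>k\<le>j. of_nat (j choose k) * (- t) ^ k * t ^ (j - k)) * B t \<omega>"
      unfolding sum_distrib_right by (intro sum.cong refl) (simp add: power_minus[of t] mult_ac)
    also have "\<dots> = 0 ^ j * B t \<omega>" using binomial_ring[of "- t" t j] by simp
    finally show ?thesis .
  qed
  have F': "(F j has_real_derivative (if j = 0 then B t \<omega> else real j * F (j - 1) t)) (at t within {0..1})" for j
  proof (cases j)
    case 0
    then show ?thesis using F0'[of 0] by (simp add: mult.commute)
  next
    case (Suc i)
    have "(\<Sum>k\<le>j. of_nat (j choose k) * (-1) ^ k * (real (j - k) * t ^ (j - k - 1) * P k t))
       = (\<Sum>k\<le>i. of_nat (j choose k) * (-1) ^ k * (real (j - k) * t ^ (j - k - 1) * P k t))"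
      using Suc by (intro sum.mono_neutral_right) auto
    also have "\<dots> = real j * F i t"
      unfolding F_def sum_distrib_left
    proof (rule sum.cong)
      fix k assume "k \<in> {..i}"
      have "real (j - k) * real (j choose k) = real j * real (i choose k)"
        using binomial_absorb_comp[of j k] Suc by (metis diff_Suc_1 of_nat_mult)
      moreover have "j - k - 1 = i - k" using Suc by simp
      ultimately show "of_nat (j choose k) * (-1) ^ k * (real (j - k) * t ^ (j - k - 1) * P k t)
        = real j * (of_nat (i choose k) * (-1) ^ k * (t ^ (i - k) * P k t))"
        by (simp add: mult_ac)
    qed simp
    finally have "(\<Sum>k\<le>j. of_nat (j choose k) * (-1) ^ k *
      (real (j - k) * t ^ (j - k - 1) * P k t + t ^ k * B t \<omega> * t ^ (j - k))) = real j * F i t"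
      using zero[of j] Suc by (simp add: distrib_left sum.distrib)
    with F0'[of j] Suc show ?thesis by simp
  qed
  have "((\<lambda>t. F j t / fact j) has_real_derivative (if j = 0 then B t \<omega> else real j * F (j - 1) t) / fact j) (at t within {0..1})"
    by (intro DERIV_cdivide F')
  moreover have "(if j = 0 then B t \<omega> else real j * F (j - 1) t) / fact j = fbm_integral B j t \<omega>"
    using F[OF t] by (cases j) (auto simp: fbm_integral_def)
  ultimately have "((\<lambda>t. F j t / fact j) has_real_derivative fbm_integral B j t \<omega>) (at t within {0..1})"
    by simp
  then show ?thesis
    by (rule has_field_derivative_transform_within[where d=1])
      (use t F in \<open>auto simp: fbm_integral_def\<close>)
qed

text \<open>
  The process is the limit of its values at the grid points \<open>\<lfloor>n x\<rfloor> / n\<close>.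
\<close>

lemma borel_measurable_Caratheodory:
  fixes Y :: "real \<Rightarrow> 'a \<Rightarrow> real"
  assumes Y[measurable]: "\<And>x. Y x \<in> borel_measurable N"
    and c: "\<And>\<omega>. \<omega> \<in> space N \<Longrightarrow> continuous_on UNIV (\<lambda>x. Y x \<omega>)"
  shows "(\<lambda>z. Y (snd z) (fst z)) \<in> borel_measurable (N \<Otimes>\<^sub>M lborel)"
proof (rule borel_measurable_LIMSEQ_real)
  fix n :: nat
  have [measurable]: "(\<lambda>z. \<lfloor>real (Suc n) * snd z\<rfloor>) \<in> measurable (N \<Otimes>\<^sub>M lborel) (count_space UNIV)"
    by measurable
  show "(\<lambda>z. Y (of_int \<lfloor>real (Suc n) * snd z\<rfloor> / real (Suc n)) (fst z)) \<in> borel_measurable (N \<Otimes>\<^sub>M lborel)"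
    by (rule measurable_compose_countable[where f="\<lambda>i z. Y (of_int i / real (Suc n)) (fst z)"]) measurable
next
  fix z assume "z \<in> space (N \<Otimes>\<^sub>M (lborel :: real measure))"
  then have \<omega>: "fst z \<in> space N" by (auto simp: space_pair_measure)
  have "(\<lambda>n. of_int \<lfloor>real (Suc n) * snd z\<rfloor> / real (Suc n)) \<longlonglongrightarrow> snd z"
  proof (rule LIMSEQ_I)
    fix e :: real assume e: "0 < e"
    obtain n0 where n0: "1 / e < real n0" using reals_Archimedean2 by blast
    have "norm (of_int \<lfloor>real (Suc n) * snd z\<rfloor> / real (Suc n) - snd z) < e" if "n \<ge> n0" for n
    proof -
      have "1 / e < real (Suc n)" using n0 that by simp
      then have "1 / real (Suc n) < e" using e by (simp add: field_simps)
      moreover have "\<bar>of_int \<lfloor>real (Suc n) * snd z\<rfloor> - real (Suc n) * snd z\<bar> \<le> 1" by linarith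
      then have "\<bar>of_int \<lfloor>real (Suc n) * snd z\<rfloor> - real (Suc n) * snd z\<bar> / real (Suc n) \<le> 1 / real (Suc n)"
        by (intro divide_right_mono) auto
      moreover have "norm (of_int \<lfloor>real (Suc n) * snd z\<rfloor> / real (Suc n) - snd z)
        = \<bar>of_int \<lfloor>real (Suc n) * snd z\<rfloor> - real (Suc n) * snd z\<bar> / real (Suc n)"
      proof -
        have "of_int \<lfloor>real (Suc n) * snd z\<rfloor> / real (Suc n) - snd z
          = (of_int \<lfloor>real (Suc n) * snd z\<rfloor> - real (Suc n) * snd z) / real (Suc n)"
          by (simp add: diff_divide_distrib del: of_nat_Suc)
        then show ?thesis by (simp only: real_norm_def abs_divide abs_of_nat)
      qed
      ultimately show ?thesis by linarith
    qed
    then show "\<exists>no. \<forall>n\<ge>no. norm (of_int \<lfloor>real (Suc n) * snd z\<rfloor> / real (Suc n) - snd z) < e" by blast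
  qed
  then show "(\<lambda>n. Y (of_int \<lfloor>real (Suc n) * snd z\<rfloor> / real (Suc n)) (fst z)) \<longlonglongrightarrow> Y (snd z) (fst z)"
    using c[OF \<omega>] by (intro continuous_on_tendsto_compose[of UNIV "\<lambda>x. Y x (fst z)"]) auto
qed

text \<open>
  The mean of \<open>(f - A)\<^sup>2\<close> is nonnegative when \<open>A\<close> is the mean of \<open>f\<close>.
\<close>

lemma integral_square_le:
  fixes f :: "real \<Rightarrow> real"
  assumes f: "continuous_on {s..t} f" and st: "s < t"
  shows "(integral {s..t} f)\<^sup>2 \<le> (t - s) * (LBINT x:{s..t}. (f x)\<^sup>2)"
proof -
  define L where "L = t - s"
  define A where "A = integral {s..t} f / L"
  have L: "0 < L" using st by (simp add: L_def)
  have i: "f integrable_on {s..t}" "(\<lambda>x. (f x)\<^sup>2) integrable_on {s..t}"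
    using f by (auto intro!: integrable_continuous_real continuous_intros)
  have "0 \<le> integral {s..t} (\<lambda>x. (f x - A)\<^sup>2)"
    using f by (intro integral_nonneg integrable_continuous_real continuous_intros) auto
  also have "(\<lambda>x. (f x - A)\<^sup>2) = (\<lambda>x. (f x)\<^sup>2 - 2 * A * f x + A\<^sup>2)"
    by (simp add: power2_diff algebra_simps)
  also have "integral {s..t} (\<lambda>x. (f x)\<^sup>2 - 2 * A * f x + A\<^sup>2)
    = integral {s..t} (\<lambda>x. (f x)\<^sup>2) - 2 * A * integral {s..t} f + A\<^sup>2 * L"
  proof -
    have j: "(\<lambda>x. 2 * A * f x) integrable_on {s..t}" using i(1) by (rule integrable_on_mult_right)
    have "integral {s..t} (\<lambda>x. (f x)\<^sup>2 - 2 * A * f x) = integral {s..t} (\<lambda>x. (f x)\<^sup>2) - integral {s..t} (\<lambda>x. 2 * A * f x)"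
      using i(2) j by (rule Henstock_Kurzweil_Integration.integral_diff)
    moreover have "integral {s..t} (\<lambda>x. (f x)\<^sup>2 - 2 * A * f x + A\<^sup>2)
      = integral {s..t} (\<lambda>x. (f x)\<^sup>2 - 2 * A * f x) + integral {s..t} (\<lambda>x. A\<^sup>2)"
      using i(2) j by (intro Henstock_Kurzweil_Integration.integral_add integrable_diff) auto
    ultimately show ?thesis using st by (simp add: L_def)
  qed
  also have "\<dots> = integral {s..t} (\<lambda>x. (f x)\<^sup>2) - (integral {s..t} f)\<^sup>2 / L"
    using L by (simp add: A_def power2_eq_square field_simps)
  finally have "(integral {s..t} f)\<^sup>2 \<le> L * integral {s..t} (\<lambda>x. (f x)\<^sup>2)"
    using L by (simp add: field_simps)
  also have "integral {s..t} (\<lambda>x. (f x)\<^sup>2) = (LBINT x:{s..t}. (f x)\<^sup>2)"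
    using f by (intro set_integral_continuous_real[symmetric] continuous_intros)
  finally show ?thesis by (simp add: L_def)
qed

text \<open>
  The square of the path integral of \<open>Y - W\<close> is at most the length of the interval times the integral of the
  square; Tonelli's theorem exchanges expectation and time integral.
\<close>

lemma qm_norm_pathwise_increment_le:
  assumes N: "prob_space N"
    and Y: "\<And>t. t \<in> {0..1} \<Longrightarrow> sq_integrable N (Y t)"
    and paths: "\<And>\<omega>. \<omega> \<in> space N \<Longrightarrow> continuous_on {0..1} (\<lambda>t. Y t \<omega>)"
    and Z: "\<And>\<omega> t. \<omega> \<in> space N \<Longrightarrow> t \<in> {0..1} \<Longrightarrow>
        ((\<lambda>t. Z t \<omega>) has_real_derivative Y t \<omega>) (at t within {0..1})"
    and W: "sq_integrable N W" and st: "0 \<le> s" "s < t" "t \<le> 1"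
    and \<eta>: "\<And>x. x \<in> {s..t} \<Longrightarrow> qm_norm N (\<lambda>\<omega>. Y x \<omega> - W \<omega>) \<le> \<eta>"
  shows "sq_integrable N (\<lambda>\<omega>. Z t \<omega> - Z s \<omega> - (t - s) * W \<omega>)"
    "qm_norm N (\<lambda>\<omega>. Z t \<omega> - Z s \<omega> - (t - s) * W \<omega>) \<le> (t - s) * \<eta>"
proof -
  interpret N: prob_space N by fact
  have [measurable]: "W \<in> borel_measurable N" using W by (simp add: sq_integrable_def)
  \<comment> \<open>Clamping extends the paths continuously to the real line, as joint measurability requires.\<close>
  define c where "c x = max s (min t x)" for x
  have c: "c x \<in> {s..t}" "x \<in> {s..t} \<Longrightarrow> c x = x" for x using st by (auto simp: c_def)
  have cc: "continuous_on UNIV c" unfolding c_def by (intro continuous_intros)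
  define U where "U x \<omega> = Y (c x) \<omega> - W \<omega>" for x \<omega>
  have U: "sq_integrable N (U x)" for x
    unfolding U_def using Y[of "c x"] W c[of x] st by (intro sq_integrable_diff) auto
  have Uc: "continuous_on UNIV (\<lambda>x. U x \<omega>)" if "\<omega> \<in> space N" for \<omega>
  proof -
    have "c x \<in> {0..1}" for x using c(1)[of x] st by auto
    then have "range c \<subseteq> {0..1}" by blast
    then show ?thesis unfolding U_def
      by (intro continuous_on_diff continuous_on_compose2[OF paths[OF that] cc] continuous_on_const)
  qed
  have joint[measurable]: "(\<lambda>z. U (snd z) (fst z)) \<in> borel_measurable (N \<Otimes>\<^sub>M lborel)"
    using U Uc by (intro borel_measurable_Caratheodory) (auto simp: sq_integrable_def)
  define D where "D \<omega> = Z t \<omega> - Z s \<omega> - (t - s) * W \<omega>" for \<omega>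
  have Di: "D \<omega> = integral {s..t} (\<lambda>x. U x \<omega>)" if \<omega>: "\<omega> \<in> space N" for \<omega>
  proof -
    have "((\<lambda>x. Y x \<omega>) has_integral Z t \<omega> - Z s \<omega>) {s..t}"
      using st by (intro fundamental_theorem_of_calculus)
        (auto intro!: DERIV_subset[OF Z[OF \<omega>]]
          simp: has_real_derivative_iff_has_vector_derivative[symmetric])
    from has_integral_diff[OF this has_integral_const_real[of "W \<omega>" s t]]
    have "((\<lambda>x. Y x \<omega> - W \<omega>) has_integral D \<omega>) {s..t}" using st by (simp add: D_def)
    then have "((\<lambda>x. U x \<omega>) has_integral D \<omega>) {s..t}"
      by (rule has_integral_eq[rotated]) (simp add: U_def c)
    then show ?thesis by (simp add: integral_unique)
  qed
  have U1: "continuous_on {s..t} (\<lambda>x. U x \<omega>)" if "\<omega> \<in> space N" for \<omega>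
    using Uc[OF that] by (rule continuous_on_subset) simp
  have DL: "D \<omega> = (\<integral>x. indicator {s..t} x * U x \<omega> \<partial>lborel)" if \<omega>: "\<omega> \<in> space N" for \<omega>
    using Di[OF \<omega>] set_integral_continuous_real[OF U1[OF \<omega>]] by (simp add: set_lebesgue_integral_def)
  have Dm[measurable]: "D \<in> borel_measurable N"
  proof -
    have "(\<lambda>\<omega>. \<integral>x. indicator {s..t} x * U x \<omega> \<partial>lborel) \<in> borel_measurable N"
      by (rule lborel.borel_measurable_lebesgue_integral) (simp add: case_prod_beta)
    then show ?thesis by (rule measurable_cong[THEN iffD2, rotated]) (simp add: DL)
  qed
  have \<eta>0: "0 \<le> \<eta>" using order_trans[OF qm_norm_nonneg \<eta>[of s]] st by simp
  have "(\<integral>\<^sup>+\<omega>. ennreal ((D \<omega>)\<^sup>2) \<partial>N)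
      \<le> (\<integral>\<^sup>+\<omega>. ennreal (t - s) * (\<integral>\<^sup>+x. ennreal (indicator {s..t} x * (U x \<omega>)\<^sup>2) \<partial>lborel) \<partial>N)"
  proof (rule nn_integral_mono)
    fix \<omega> assume \<omega>: "\<omega> \<in> space N"
    have i: "set_integrable lborel {s..t} (\<lambda>x. (U x \<omega>)\<^sup>2)"
      using U1[OF \<omega>] by (intro borel_integrable_atLeastAtMost' continuous_intros)
    have "(D \<omega>)\<^sup>2 \<le> (t - s) * (LBINT x:{s..t}. (U x \<omega>)\<^sup>2)"
      unfolding Di[OF \<omega>] using U1[OF \<omega>] st(2) by (rule integral_square_le)
    then have "ennreal ((D \<omega>)\<^sup>2) \<le> ennreal ((t - s) * (LBINT x:{s..t}. (U x \<omega>)\<^sup>2))" by (rule ennreal_leI)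
    also have "\<dots> = ennreal (t - s) * ennreal (LBINT x:{s..t}. (U x \<omega>)\<^sup>2)" using st by (intro ennreal_mult') simp
    also have "ennreal (LBINT x:{s..t}. (U x \<omega>)\<^sup>2) = (\<integral>\<^sup>+x. ennreal (indicator {s..t} x * (U x \<omega>)\<^sup>2) \<partial>lborel)"
      using i unfolding set_lebesgue_integral_def set_integrable_def
      by (subst nn_integral_eq_integral) (auto simp: indicator_def)
    finally show "ennreal ((D \<omega>)\<^sup>2) \<le> ennreal (t - s) * (\<integral>\<^sup>+x. ennreal (indicator {s..t} x * (U x \<omega>)\<^sup>2) \<partial>lborel)" .
  qed
  also have "\<dots> = ennreal (t - s) * (\<integral>\<^sup>+\<omega>. (\<integral>\<^sup>+x. ennreal (indicator {s..t} x * (U x \<omega>)\<^sup>2) \<partial>lborel) \<partial>N)"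
    by (rule nn_integral_cmult) (rule lborel.borel_measurable_nn_integral, simp add: case_prod_beta)
  also have "(\<integral>\<^sup>+\<omega>. (\<integral>\<^sup>+x. ennreal (indicator {s..t} x * (U x \<omega>)\<^sup>2) \<partial>lborel) \<partial>N)
      = (\<integral>\<^sup>+x. (\<integral>\<^sup>+\<omega>. ennreal (indicator {s..t} x * (U x \<omega>)\<^sup>2) \<partial>N) \<partial>lborel)"
  proof -
    interpret P: pair_sigma_finite N lborel ..
    show ?thesis
      using P.Fubini[of "\<lambda>z. ennreal (indicator {s..t} (snd z) * (U (snd z) (fst z))\<^sup>2)"] by simp
  qed
  also have "\<dots> \<le> (\<integral>\<^sup>+x. ennreal (\<eta>\<^sup>2) * indicator {s..t} x \<partial>lborel)"
  proof (rule nn_integral_mono)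
    fix x :: real
    show "(\<integral>\<^sup>+\<omega>. ennreal (indicator {s..t} x * (U x \<omega>)\<^sup>2) \<partial>N) \<le> ennreal (\<eta>\<^sup>2) * indicator {s..t} x"
    proof (cases "x \<in> {s..t}")
      case True
      have "(\<integral>\<^sup>+\<omega>. ennreal ((U x \<omega>)\<^sup>2) \<partial>N) = ennreal (\<integral>\<omega>. (U x \<omega>)\<^sup>2 \<partial>N)"
        using U[of x] by (intro nn_integral_eq_integral) (auto simp: sq_integrable_def)
      also have "(\<integral>\<omega>. (U x \<omega>)\<^sup>2 \<partial>N) = (qm_norm N (\<lambda>\<omega>. Y x \<omega> - W \<omega>))\<^sup>2"
        unfolding qm_norm_square using True by (simp add: power2_eq_square U_def c)
      also have "ennreal \<dots> \<le> ennreal (\<eta>\<^sup>2)" using \<eta>[OF True] by (intro ennreal_leI power_mono) auto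
      finally show ?thesis using True by simp
    qed simp
  qed
  also have "\<dots> = ennreal (\<eta>\<^sup>2) * ennreal (t - s)" using st by (simp add: nn_integral_cmult_indicator)
  finally have "(\<integral>\<^sup>+\<omega>. ennreal ((D \<omega>)\<^sup>2) \<partial>N) \<le> ennreal (t - s) * (ennreal (\<eta>\<^sup>2) * ennreal (t - s))"
    by (simp add: mult_left_mono)
  also have "\<dots> = ennreal (((t - s) * \<eta>)\<^sup>2)"
    using st by (simp add: ennreal_mult'[symmetric] power2_eq_square mult_ac)
  finally have le: "(\<integral>\<^sup>+\<omega>. ennreal ((D \<omega>)\<^sup>2) \<partial>N) \<le> ennreal (((t - s) * \<eta>)\<^sup>2)" .
  then have int: "integrable N (\<lambda>\<omega>. (D \<omega>)\<^sup>2)"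
    by (intro integrableI_bounded) (auto intro: le_less_trans)
  then show "sq_integrable N (\<lambda>\<omega>. Z t \<omega> - Z s \<omega> - (t - s) * W \<omega>)"
    using Dm int by (simp add: sq_integrable_def D_def[abs_def])
  have "(\<integral>\<omega>. (D \<omega>)\<^sup>2 \<partial>N) \<le> ((t - s) * \<eta>)\<^sup>2"
    using le int by (subst (asm) nn_integral_eq_integral) auto
  then have "qm_norm N D \<le> (t - s) * \<eta>"
    unfolding qm_norm_def using st \<eta>0 by (intro real_le_lsqrt) auto
  then show "qm_norm N (\<lambda>\<omega>. Z t \<omega> - Z s \<omega> - (t - s) * W \<omega>) \<le> (t - s) * \<eta>" by (simp add: D_def[abs_def])
qed

lemma qm_continuous_norm:
  assumes "qm_continuous_on N I Y" "\<And>t. t \<in> I \<Longrightarrow> sq_integrable N (Y t)"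
  shows "continuous_on I (\<lambda>t. qm_norm N (Y t))"
  unfolding continuous_on_def
proof
  fix t assume t: "t \<in> I"
  show "((\<lambda>t. qm_norm N (Y t)) \<longlongrightarrow> qm_norm N (Y t)) (at t within I)"
  proof (rule LIM_zero_cancel, rule Lim_null_comparison)
    show "((\<lambda>s. qm_norm N (\<lambda>\<omega>. Y s \<omega> - Y t \<omega>)) \<longlongrightarrow> 0) (at t within I)"
      using assms(1) t by (simp add: qm_continuous_on_def)
    show "\<forall>\<^sub>F s in at t within I. norm (qm_norm N (Y s) - qm_norm N (Y t)) \<le> qm_norm N (\<lambda>\<omega>. Y s \<omega> - Y t \<omega>)"
      using assms(2) t by (auto simp: eventually_at_filter intro!: always_eventually qm_norm_reverse_triangle)
  qed
qed

text \<open>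
  The error of the difference quotient is the mean of \<open>Y x - Y t\<close> over the interval between \<open>s\<close> and
  \<open>t\<close>, hence at most the supremum of \<open>qm_norm N (Y x - Y t)\<close> there.
\<close>

lemma qm_deriv_pathwise_integral:
  assumes N: "prob_space N"
    and Y: "\<And>t. t \<in> {0..1} \<Longrightarrow> sq_integrable N (Y t)"
    and paths: "\<And>\<omega>. \<omega> \<in> space N \<Longrightarrow> continuous_on {0..1} (\<lambda>t. Y t \<omega>)"
    and qmc: "qm_continuous_on N {0..1} Y"
    and Z: "\<And>\<omega> t. \<omega> \<in> space N \<Longrightarrow> t \<in> {0..1} \<Longrightarrow>
        ((\<lambda>t. Z t \<omega>) has_real_derivative Y t \<omega>) (at t within {0..1})"
    and Z0: "sq_integrable N (Z 0)" and t: "t \<in> {0..1}"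
  shows "sq_integrable N (Z t)" "has_qm_deriv N {0..1} Z (Y t) t"
proof -
  have "bounded ((\<lambda>t. qm_norm N (Y t)) ` {0..1})"
    by (intro compact_imp_bounded compact_continuous_image qm_continuous_norm qmc Y) auto
  then obtain K where "\<forall>x\<in>{0..1}. \<bar>qm_norm N (Y x)\<bar> \<le> K" unfolding bounded_iff by auto
  then have K: "\<And>x. x \<in> {0..1} \<Longrightarrow> qm_norm N (Y x) \<le> K" by auto
  show Zt: "sq_integrable N (Z t)"
  proof (cases "t = 0")
    case False
    have "sq_integrable N (\<lambda>\<omega>. Z t \<omega> - Z 0 \<omega> - (t - 0) * 0)"
      by (rule qm_norm_pathwise_increment_le(1)[OF N Y paths Z sq_integrable_zero, where \<eta>=K])
        (use t False K in auto)
    from sq_integrable_add[OF this Z0] show ?thesis by simp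
  qed (use Z0 in simp)
  have "((\<lambda>s. qm_norm N (\<lambda>\<omega>. (Z s \<omega> - Z t \<omega>) / (s - t) - Y t \<omega>)) \<longlongrightarrow> 0) (at t within {0..1})"
  proof (rule tendstoI)
    fix e' :: real assume e': "0 < e'"
    define e where "e = e' / 2"
    have e: "0 < e" "e < e'" using e' by (auto simp: e_def)
    have "\<forall>\<^sub>F s in at t within {0..1}. qm_norm N (\<lambda>\<omega>. Y s \<omega> - Y t \<omega>) < e"
      using qmc t e(1) unfolding qm_continuous_on_def by (intro order_tendstoD) auto
    then obtain d where d: "0 < d" "\<And>s. s \<in> {0..1} \<Longrightarrow> \<bar>s - t\<bar> < d \<Longrightarrow> s \<noteq> t \<Longrightarrow> qm_norm N (\<lambda>\<omega>. Y s \<omega> - Y t \<omega>) < e"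
      by (auto simp: eventually_at dist_real_def)
    have d': "qm_norm N (\<lambda>\<omega>. Y s \<omega> - Y t \<omega>) \<le> e" if "s \<in> {0..1}" "\<bar>s - t\<bar> < d" for s
      using d(2)[OF that] e by (cases "s = t") auto
    have "qm_norm N (\<lambda>\<omega>. (Z s \<omega> - Z t \<omega>) / (s - t) - Y t \<omega>) \<le> e"
      if s: "s \<in> {0..1}" "\<bar>s - t\<bar> < d" "s \<noteq> t" for s
    proof -
      have eq: "(\<lambda>\<omega>. (Z s \<omega> - Z t \<omega>) / (s - t) - Y t \<omega>) = (\<lambda>\<omega>. (Z s \<omega> - Z t \<omega> - (s - t) * Y t \<omega>) / (s - t))"
        "(\<lambda>\<omega>. (Z s \<omega> - Z t \<omega>) / (s - t) - Y t \<omega>) = (\<lambda>\<omega>. (Z t \<omega> - Z s \<omega> - (t - s) * Y t \<omega>) / (t - s))"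
        using s by (auto simp: field_simps)
      show ?thesis
      proof (cases "s < t")
        case True
        have "qm_norm N (\<lambda>\<omega>. Z t \<omega> - Z s \<omega> - (t - s) * Y t \<omega>) \<le> (t - s) * e"
          by (rule qm_norm_pathwise_increment_le(2)[OF N Y paths Z Y[OF t]])
            (use t s True in \<open>auto intro!: d'\<close>)
        then show ?thesis unfolding eq(2) qm_norm_divide using True by (simp add: field_simps)
      next
        case False
        with s have st: "t < s" by simp
        have "qm_norm N (\<lambda>\<omega>. Z s \<omega> - Z t \<omega> - (s - t) * Y t \<omega>) \<le> (s - t) * e"
          by (rule qm_norm_pathwise_increment_le(2)[OF N Y paths Z Y[OF t]])
            (use t s st in \<open>auto intro!: d'\<close>)
        then show ?thesis unfolding eq(1) qm_norm_divide using st by (simp add: field_simps)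
      qed
    qed
    then show "\<forall>\<^sub>F s in at t within {0..1}. dist (qm_norm N (\<lambda>\<omega>. (Z s \<omega> - Z t \<omega>) / (s - t) - Y t \<omega>)) 0 < e'"
      using d(1) e by (fastforce simp: eventually_at dist_real_def)
  qed
  with Y[OF t] show "has_qm_deriv N {0..1} Z (Y t) t" by (simp add: has_qm_deriv_def)
qed

lemma fractional_BM_increment:
  assumes B: "fractional_BM N \<beta> B" and \<beta>: "0 < \<beta>" and st: "s \<in> {0..1}" "t \<in> {0..1}"
  shows "qm_norm N (\<lambda>\<omega>. B s \<omega> - B t \<omega>) = \<bar>s - t\<bar> powr \<beta>"
proof -
  have sq: "sq_integrable N (B s)" "sq_integrable N (B t)" using B st by (auto simp: fractional_BM_def)
  have cov: "(\<integral>\<omega>. B x \<omega> * B y \<omega> \<partial>N) = (x powr (2 * \<beta>) + y powr (2 * \<beta>) - \<bar>x - y\<bar> powr (2 * \<beta>)) / 2"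
    if "x \<in> {0..1}" "y \<in> {0..1}" for x y using B that by (auto simp: fractional_BM_def)
  have "(qm_norm N (\<lambda>\<omega>. B s \<omega> - B t \<omega>))\<^sup>2 = (qm_norm N (B s))\<^sup>2 + (qm_norm N (B t))\<^sup>2 - 2 * (\<integral>\<omega>. B s \<omega> * B t \<omega> \<partial>N)"
    using qm_polarization[OF sq] by simp
  also have "\<dots> = \<bar>s - t\<bar> powr (2 * \<beta>)"
  proof -
    have "(qm_norm N (B s))\<^sup>2 = s powr (2 * \<beta>)" "(qm_norm N (B t))\<^sup>2 = t powr (2 * \<beta>)"
      using \<beta> by (simp_all add: qm_norm_square cov[OF st(1) st(1)] cov[OF st(2) st(2)])
    moreover have "x = a \<Longrightarrow> y = b \<Longrightarrow> z = (a + b - c) / 2 \<Longrightarrow> x + y - 2 * z = c" for x y z a b c :: real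
      by (simp add: field_simps)
    ultimately show ?thesis using cov[OF st] by blast
  qed
  also have "\<dots> = (\<bar>s - t\<bar> powr \<beta>)\<^sup>2" by (simp add: power2_eq_square powr_add[symmetric])
  finally show ?thesis by simp
qed

lemma fbm_integral_qm:
  assumes B: "fractional_BM N \<beta> B" and \<beta>: "0 < \<beta>"
  shows "t \<in> {0..1} \<Longrightarrow> sq_integrable N (fbm_integral B j t)"
    "\<omega> \<in> space N \<Longrightarrow> continuous_on {0..1} (\<lambda>t. fbm_integral B j t \<omega>)"
    "qm_continuous_on N {0..1} (fbm_integral B j)"
    "t \<in> {0..1} \<Longrightarrow> has_qm_deriv N {0..1} (fbm_integral B (Suc j)) (fbm_integral B j t) t"
proof -
  have N: "prob_space N" and sq: "\<And>t. t \<in> {0..1} \<Longrightarrow> sq_integrable N (B t)"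
    and paths: "\<And>\<omega>. \<omega> \<in> space N \<Longrightarrow> continuous_on {0..1} (\<lambda>t. B t \<omega>)"
    using B by (auto simp: fractional_BM_def)
  note D = fbm_integral_path_deriv[of B, OF paths]
  have zero: "sq_integrable N (fbm_integral B (Suc j) 0)" for j
  proof -
    have "AE x in lborel. x \<noteq> (0::real)" by (rule AE_lborel_singleton)
    then have "(LBINT s:{0..0}. (0 - s) ^ j * B s \<omega>) = 0" for \<omega>
      unfolding set_lebesgue_integral_def by (intro integral_eq_zero_AE) (auto elim: eventually_mono)
    then have "fbm_integral B (Suc j) 0 = (\<lambda>_. 0)" by (auto simp: fbm_integral_def fun_eq_iff)
    then show ?thesis by (simp add: sq_integrable_zero)
  qed
  define P where "P j \<longleftrightarrow> (\<forall>t\<in>{0..1}. sq_integrable N (fbm_integral B j t))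
    \<and> (\<forall>\<omega>\<in>space N. continuous_on {0..1} (\<lambda>t. fbm_integral B j t \<omega>))
    \<and> qm_continuous_on N {0..1} (fbm_integral B j)" for j
  have step: "sq_integrable N (fbm_integral B (Suc j) t)"
      "has_qm_deriv N {0..1} (fbm_integral B (Suc j)) (fbm_integral B j t) t"
    if "P j" "t \<in> {0..1}" for j t
    by (rule qm_deriv_pathwise_integral[where Y="fbm_integral B j" and Z="fbm_integral B (Suc j)"];
        use N zero D that in \<open>auto simp: P_def\<close>)+
  have P: "P j" for j
  proof (induction j)
    case 0
    have "((\<lambda>s. qm_norm N (\<lambda>\<omega>. B s \<omega> - B t \<omega>)) \<longlongrightarrow> 0) (at t within {0..1})" if t: "t \<in> {0..1}" for t
    proof (rule Lim_transform_within[where d=1])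
      have "((\<lambda>s. \<bar>s - t\<bar> powr \<beta>) \<longlongrightarrow> \<bar>t - t\<bar> powr \<beta>) (at t within {0..1})"
        using \<beta> by (intro tendsto_powr2 tendsto_intros) (auto simp: eventually_at_filter)
      then show "((\<lambda>s. \<bar>s - t\<bar> powr \<beta>) \<longlongrightarrow> 0) (at t within {0..1})" by simp
    qed (use t fractional_BM_increment[OF B \<beta>] in auto)
    moreover have "fbm_integral B 0 = B" by (auto simp: fbm_integral_def fun_eq_iff)
    ultimately show ?case using sq paths by (simp add: P_def qm_continuous_on_def)
  next
    case (Suc j)
    have "continuous_on {0..1} (\<lambda>t. fbm_integral B (Suc j) t \<omega>)" if "\<omega> \<in> space N" for \<omega>
      using D[OF that, of _ j] unfolding continuous_on_eq_continuous_within
      by (blast intro: DERIV_continuous)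
    moreover have "qm_continuous_on N {0..1} (fbm_integral B (Suc j))"
      unfolding qm_continuous_on_def
      using has_qm_deriv_imp_continuous[OF step(2)[OF Suc]] step(1)[OF Suc] by blast
    ultimately show ?case using step(1)[OF Suc] by (simp add: P_def)
  qed
  show "t \<in> {0..1} \<Longrightarrow> sq_integrable N (fbm_integral B j t)"
    "\<omega> \<in> space N \<Longrightarrow> continuous_on {0..1} (\<lambda>t. fbm_integral B j t \<omega>)"
    "qm_continuous_on N {0..1} (fbm_integral B j)"
    using P[of j] by (auto simp: P_def)
  show "t \<in> {0..1} \<Longrightarrow> has_qm_deriv N {0..1} (fbm_integral B (Suc j)) (fbm_integral B j t) t"
    by (rule step(2)[OF P])
qed

section \<open>Jets of processes and their Hermite residuals\<close>

text \<open>
  One constant that serves all orders \<open>m\<close> and all functions of two variables admitted in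
  \<open>hermite_error_double_bound\<close>.
\<close>

definition hermite_bound :: "nat \<Rightarrow> real" where
  "hermite_bound k = (SOME A. A > 0 \<and> (\<forall>m F \<eta>. k div 2 \<le> m \<longrightarrow> m \<le> k \<longrightarrow>
     (\<forall>i<m. \<forall>j\<le>m. \<forall>s\<in>{0..1}. \<forall>t\<in>{0..1}.
        ((\<lambda>s. F i j s t) has_real_derivative F (Suc i) j s t) (at s within {0..1})) \<longrightarrow>
     (\<forall>j<m. \<forall>s\<in>{0..1}. \<forall>t\<in>{0..1}.
        (F m j s has_real_derivative F m (Suc j) s t) (at t within {0..1})) \<longrightarrow>
     (\<forall>s\<in>{0..1}. \<forall>t\<in>{0..1}. \<bar>F m m s t - F m m 0 t - F m m s 0 + F m m 0 0\<bar> \<le> \<eta>) \<longrightarrow>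
     (\<forall>x\<in>{0..1}. \<bar>hermite_error k x (\<lambda>i s. hermite_error k x (\<lambda>j t. F i j s t))\<bar> \<le> A * \<eta>)))"

lemma hermite_bound:
  assumes "odd k"
  shows "0 < hermite_bound k"
    and "\<lbrakk>k div 2 \<le> m; m \<le> k;
      \<And>i j s t. i < m \<Longrightarrow> j \<le> m \<Longrightarrow> s \<in> {0..1} \<Longrightarrow> t \<in> {0..1} \<Longrightarrow>
        ((\<lambda>s. F i j s t) has_real_derivative F (Suc i) j s t) (at s within {0..1});
      \<And>j s t. j < m \<Longrightarrow> s \<in> {0..1} \<Longrightarrow> t \<in> {0..1} \<Longrightarrow>
        (F m j s has_real_derivative F m (Suc j) s t) (at t within {0..1});
      \<And>s t. s \<in> {0..1} \<Longrightarrow> t \<in> {0..1} \<Longrightarrow> \<bar>F m m s t - F m m 0 t - F m m s 0 + F m m 0 0\<bar> \<le> \<eta>;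
      x \<in> {0..1}\<rbrakk>
     \<Longrightarrow> \<bar>hermite_error k x (\<lambda>i s. hermite_error k x (\<lambda>j t. F i j s t))\<bar> \<le> hermite_bound k * \<eta>"
  using someI_ex[OF hermite_error_double_bound[OF assms], folded hermite_bound_def] by auto

text \<open>
  A process together with versions of its derivatives.  Continuity is required for the highest
  order only, as the lower ones are differentiable.
\<close>

definition qm_jet :: "'a measure \<Rightarrow> real set \<Rightarrow> nat \<Rightarrow> (nat \<Rightarrow> real \<Rightarrow> 'a \<Rightarrow> real) \<Rightarrow> bool" where
  "qm_jet M I m D \<longleftrightarrow> (\<forall>i\<le>m. \<forall>t\<in>I. sq_integrable M (D i t)) \<and>
     (\<forall>i<m. \<forall>t\<in>I. has_qm_deriv M I (D i) (D (Suc i) t) t) \<and> qm_continuous_on M I (D m)"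

lemma qm_jet_sq: "qm_jet M I m D \<Longrightarrow> i \<le> m \<Longrightarrow> t \<in> I \<Longrightarrow> sq_integrable M (D i t)"
  by (simp add: qm_jet_def)

lemma qm_jet_deriv: "qm_jet M I m D \<Longrightarrow> i < m \<Longrightarrow> t \<in> I \<Longrightarrow> has_qm_deriv M I (D i) (D (Suc i) t) t"
  by (simp add: qm_jet_def)

lemma qm_jet_subset: "qm_jet M I m D \<Longrightarrow> J \<subseteq> I \<Longrightarrow> qm_jet M J m D"
  unfolding qm_jet_def qm_continuous_on_def
  by (blast intro: has_qm_deriv_subset tendsto_within_subset)

lemma qm_jet_continuous:
  assumes "qm_jet M I m D" "i \<le> m"
  shows "qm_continuous_on M I (D i)"
proof (cases "i = m")
  case False
  with assms have "i < m" by simp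
  then show ?thesis unfolding qm_continuous_on_def
    using has_qm_deriv_imp_continuous[OF qm_jet_deriv[OF assms(1)]] qm_jet_sq[OF assms] by blast
qed (use assms in \<open>simp add: qm_jet_def\<close>)

lemma qm_jet_rescale:
  assumes D: "qm_jet M {a..a + w} m D" and w: "0 < w"
  shows "qm_jet M {0..1} m (\<lambda>i s \<omega>. w ^ i * D i (a + s * w) \<omega>)"
proof -
  have in': "a + s * w \<in> {a..a + w}" if "s \<in> {0..1}" for s
    using that w by (auto simp: mult_left_le_one_le)
  have lim: "filterlim (\<lambda>s. a + s * w) (at (a + t * w) within {a..a + w}) (at t within {0..1})"
    if "t \<in> {0..1}" for t
    unfolding filterlim_at using w in'
    by (auto simp: eventually_at_filter intro!: tendsto_eq_intros always_eventually)
  show ?thesis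
    unfolding qm_jet_def
  proof (intro conjI allI impI ballI)
    show "sq_integrable M (\<lambda>\<omega>. w ^ i * D i (a + s * w) \<omega>)" if "i \<le> m" "s \<in> {0..1}" for i s
      using qm_jet_sq[OF D that(1) in'[OF that(2)]] by (rule sq_integrable_scale)
    fix i t assume i: "i < m" and t: "t \<in> {0..1::real}"
    have d: "has_qm_deriv M {a..a + w} (D i) (D (Suc i) (a + t * w)) (a + t * w)"
      by (rule qm_jet_deriv[OF D i in'[OF t]])
    let ?\<phi> = "\<lambda>u. qm_norm M (\<lambda>\<omega>. (D i u \<omega> - D i (a + t * w) \<omega>) / (u - (a + t * w)) - D (Suc i) (a + t * w) \<omega>)"
    have lim\<phi>: "((\<lambda>s. w ^ Suc i * ?\<phi> (a + s * w)) \<longlongrightarrow> w ^ Suc i * 0) (at t within {0..1})"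
      using d unfolding has_qm_deriv_def
      by (intro tendsto_mult tendsto_const filterlim_compose[OF _ lim[OF t], of ?\<phi>]) auto
    have "w ^ Suc i * ?\<phi> (a + s * w) = qm_norm M (\<lambda>\<omega>. (w ^ i * D i (a + s * w) \<omega> - w ^ i * D i (a + t * w) \<omega>) / (s - t)
        - w ^ Suc i * D (Suc i) (a + t * w) \<omega>)" if "s \<noteq> t" for s
    proof -
      have e: "a + s * w - (a + t * w) = (s - t) * w" by (simp add: algebra_simps)
      have f: "(\<lambda>\<omega>. w ^ Suc i * ((D i (a + s * w) \<omega> - D i (a + t * w) \<omega>) / (a + s * w - (a + t * w)) - D (Suc i) (a + t * w) \<omega>))
        = (\<lambda>\<omega>. (w ^ i * D i (a + s * w) \<omega> - w ^ i * D i (a + t * w) \<omega>) / (s - t) - w ^ Suc i * D (Suc i) (a + t * w) \<omega>)"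
        unfolding e using w that by (auto simp: fun_eq_iff field_simps)
      have "w ^ Suc i * ?\<phi> (a + s * w) = qm_norm M (\<lambda>\<omega>. w ^ Suc i * ((D i (a + s * w) \<omega> - D i (a + t * w) \<omega>) / (a + s * w - (a + t * w)) - D (Suc i) (a + t * w) \<omega>))"
        unfolding qm_norm_scale using w by simp
      also have "\<dots> = qm_norm M (\<lambda>\<omega>. (w ^ i * D i (a + s * w) \<omega> - w ^ i * D i (a + t * w) \<omega>) / (s - t) - w ^ Suc i * D (Suc i) (a + t * w) \<omega>)"
        by (simp only: f)
      finally show ?thesis .
    qed
    then have "\<forall>\<^sub>F s in at t within {0..1}. w ^ Suc i * ?\<phi> (a + s * w) = qm_norm M (\<lambda>\<omega>. (w ^ i * D i (a + s * w) \<omega> - w ^ i * D i (a + t * w) \<omega>) / (s - t)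
        - w ^ Suc i * D (Suc i) (a + t * w) \<omega>)"
      by (simp only: eventually_at_filter) simp
    from Lim_transform_eventually[OF lim\<phi> this]
    have "((\<lambda>s. qm_norm M (\<lambda>\<omega>. (w ^ i * D i (a + s * w) \<omega> - w ^ i * D i (a + t * w) \<omega>) / (s - t)
        - w ^ Suc i * D (Suc i) (a + t * w) \<omega>)) \<longlongrightarrow> 0) (at t within {0..1})"
      by simp
    moreover have "sq_integrable M (\<lambda>\<omega>. w ^ Suc i * D (Suc i) (a + t * w) \<omega>)"
      using qm_jet_sq[OF D _ in'[OF t], of "Suc i"] i by (intro sq_integrable_scale) auto
    ultimately show "has_qm_deriv M {0..1} (\<lambda>s \<omega>. w ^ i * D i (a + s * w) \<omega>) (\<lambda>\<omega>. w ^ Suc i * D (Suc i) (a + t * w) \<omega>) t"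
      by (simp add: has_qm_deriv_def)
  next
    show "qm_continuous_on M {0..1} (\<lambda>s \<omega>. w ^ m * D m (a + s * w) \<omega>)"
      unfolding qm_continuous_on_def
    proof
      fix t :: real assume t: "t \<in> {0..1}"
      let ?\<phi> = "\<lambda>u. qm_norm M (\<lambda>\<omega>. D m u \<omega> - D m (a + t * w) \<omega>)"
      have "(?\<phi> \<longlongrightarrow> 0) (at (a + t * w) within {a..a + w})"
        using D in'[OF t] by (auto simp: qm_jet_def qm_continuous_on_def)
      from filterlim_compose[OF this lim[OF t]]
      have "((\<lambda>s. w ^ m * ?\<phi> (a + s * w)) \<longlongrightarrow> w ^ m * 0) (at t within {0..1})"
        by (intro tendsto_mult tendsto_const) 
      moreover have "w ^ m * ?\<phi> (a + s * w) = qm_norm M (\<lambda>\<omega>. w ^ m * D m (a + s * w) \<omega> - w ^ m * D m (a + t * w) \<omega>)" for s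
        using w by (simp add: right_diff_distrib[symmetric] qm_norm_scale del: right_diff_distrib)
      ultimately show "((\<lambda>s. qm_norm M (\<lambda>\<omega>. w ^ m * D m (a + s * w) \<omega> - w ^ m * D m (a + t * w) \<omega>)) \<longlongrightarrow> 0) (at t within {0..1})"
        by simp
    qed
  qed
qed

lemma hermite_residual:
  assumes k: "odd k" and w: "0 < w"
  shows "X (a + x * w) \<omega> - hermite M k a (a + w) X (a + x * w) \<omega>
    = hermite_error k x (\<lambda>i s. w ^ i * qm_derivn M {0..1} i X (a + s * w) \<omega>)"
  using w unfolding hermite_def
  by (subst poly_hermite_poly_scale[OF k])
    (auto simp: hermite_error_def qm_derivn_def algebra_simps)

lemma hermite_error_cong:
  assumes "\<phi> 0 x = \<psi> 0 x" "\<And>i. i \<le> k div 2 \<Longrightarrow> \<phi> i 0 = \<psi> i 0" "\<And>i. i \<le> k div 2 \<Longrightarrow> \<phi> i 1 = \<psi> i 1"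
  shows "hermite_error k x \<phi> = hermite_error k x \<psi>"
  using assms by (simp add: hermite_error_def)

lemma sq_integrable_hermite_error:
  assumes D: "qm_jet M {0..1} m D" and k: "k div 2 \<le> m" and x: "x \<in> {0..1}"
  shows "sq_integrable M (\<lambda>\<omega>. hermite_error k x (\<lambda>i s. D i s \<omega>))"
proof -
  have "sq_integrable M (\<lambda>\<omega>. D i s \<omega> * c)" if "i \<le> k div 2" "s \<in> {0..1}" for i s c
    using sq_integrable_scale[OF qm_jet_sq[OF D _ that(2)], of i c] that k by (simp add: mult.commute)
  then show ?thesis unfolding hermite_error_def
    using qm_jet_sq[OF D _ x, of 0] by (intro sq_integrable_diff sq_integrable_sum sq_integrable_add) auto
qed

text \<open>
  The error is a finite linear combination, so it commutes with covariances; applied twice this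
  expresses the second moment of the error of a process through its covariances.
\<close>

lemma inner_hermite_error:
  assumes D: "qm_jet M {0..1} m D" and k: "k div 2 \<le> m" and x: "x \<in> {0..1}" and \<xi>: "sq_integrable M \<xi>"
  shows "(\<integral>\<omega>. hermite_error k x (\<lambda>i s. D i s \<omega>) * \<xi> \<omega> \<partial>M)
    = hermite_error k x (\<lambda>i s. \<integral>\<omega>. D i s \<omega> * \<xi> \<omega> \<partial>M)"
proof -
  have i: "integrable M (\<lambda>\<omega>. D i s \<omega> * \<xi> \<omega>)" if "i \<le> m" "s \<in> {0..1}" for i s
    using qm_jet_sq[OF D that] \<xi> by (rule sq_integrable_mult)
  have "hermite_error k x (\<lambda>i s. D i s \<omega>) * \<xi> \<omega> = hermite_error k x (\<lambda>i s. D i s \<omega> * \<xi> \<omega>)" for \<omega>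
    using hermite_error_scale[of k x "\<xi> \<omega>" "\<lambda>i s. D i s \<omega>"] by (simp add: mult.commute)
  moreover have "(\<integral>\<omega>. hermite_error k x (\<lambda>i s. D i s \<omega> * \<xi> \<omega>) \<partial>M)
      = hermite_error k x (\<lambda>i s. \<integral>\<omega>. D i s \<omega> * \<xi> \<omega> \<partial>M)"
    using k x by (intro hermite_error_integral i) auto
  ultimately show ?thesis by simp
qed

lemma qm_norm_hermite_error:
  assumes D: "qm_jet M {0..1} m D" and k: "k div 2 \<le> m" and x: "x \<in> {0..1}"
  shows "(qm_norm M (\<lambda>\<omega>. hermite_error k x (\<lambda>i s. D i s \<omega>)))\<^sup>2
    = hermite_error k x (\<lambda>i s. hermite_error k x (\<lambda>j t. \<integral>\<omega>. D i s \<omega> * D j t \<omega> \<partial>M))"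
proof -
  let ?E = "\<lambda>\<omega>. hermite_error k x (\<lambda>i s. D i s \<omega>)"
  have "(qm_norm M ?E)\<^sup>2 = hermite_error k x (\<lambda>i s. \<integral>\<omega>. D i s \<omega> * ?E \<omega> \<partial>M)"
    unfolding qm_norm_square by (rule inner_hermite_error[OF D k x sq_integrable_hermite_error[OF D k x]])
  also have "\<dots> = hermite_error k x (\<lambda>i s. hermite_error k x (\<lambda>j t. \<integral>\<omega>. D i s \<omega> * D j t \<omega> \<partial>M))"
  proof -
    have "(\<integral>\<omega>. D i s \<omega> * ?E \<omega> \<partial>M) = hermite_error k x (\<lambda>j t. \<integral>\<omega>. D i s \<omega> * D j t \<omega> \<partial>M)"
      if "i \<le> m" "s \<in> {0..1}" for i s
      using inner_hermite_error[OF D k x qm_jet_sq[OF D that]] by (simp add: mult.commute)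
    then show ?thesis using k x by (intro hermite_error_cong) auto
  qed
  finally show ?thesis .
qed

text \<open>
  The squared norms on the left are the error functional applied in both variables to the covariance
  functions of \<open>D\<close> and \<open>E\<close>.  The difference of these covariances has as double difference of its
  mixed derivative of order \<open>(m, m)\<close> the difference of covariances of increments.
\<close>

lemma hermite_error_compare:
  assumes k: "odd k" "k div 2 \<le> m" "m \<le> k" and D: "qm_jet M {0..1} m D" and E: "qm_jet N {0..1} m E"
    and \<eta>: "\<And>s t. s \<in> {0..1} \<Longrightarrow> t \<in> {0..1} \<Longrightarrow>
      \<bar>(\<integral>\<omega>. (D m s \<omega> - D m 0 \<omega>) * (D m t \<omega> - D m 0 \<omega>) \<partial>M)
        - \<kappa> * (\<integral>\<omega>. (E m s \<omega> - E m 0 \<omega>) * (E m t \<omega> - E m 0 \<omega>) \<partial>N)\<bar> \<le> \<eta>"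
    and x: "x \<in> {0..1}"
  shows "\<bar>(qm_norm M (\<lambda>\<omega>. hermite_error k x (\<lambda>i s. D i s \<omega>)))\<^sup>2
    - \<kappa> * (qm_norm N (\<lambda>\<omega>. hermite_error k x (\<lambda>i s. E i s \<omega>)))\<^sup>2\<bar> \<le> hermite_bound k * \<eta>"
proof -
  define F1 where "F1 i j s t = (\<integral>\<omega>. D i s \<omega> * D j t \<omega> \<partial>M)" for i j s t
  define F2 where "F2 i j s t = (\<integral>\<omega>. E i s \<omega> * E j t \<omega> \<partial>N)" for i j s t
  have sym: "F1 i j s t = F1 j i t s" "F2 i j s t = F2 j i t s" for i j s t
    by (simp_all add: F1_def F2_def mult.commute)
  have d: "((\<lambda>s. F1 i j s t) has_real_derivative F1 (Suc i) j s t) (at s within {0..1})"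
     "((\<lambda>s. F2 i j s t) has_real_derivative F2 (Suc i) j s t) (at s within {0..1})"
    if "i < m" "j \<le> m" "s \<in> {0..1}" "t \<in> {0..1}" for i j s t
    unfolding F1_def F2_def
    using has_qm_deriv_inner[OF qm_jet_deriv[OF D that(1,3)] _ that(3) qm_jet_sq[OF D that(2,4)]]
      has_qm_deriv_inner[OF qm_jet_deriv[OF E that(1,3)] _ that(3) qm_jet_sq[OF E that(2,4)]]
      qm_jet_sq[OF D, of i] qm_jet_sq[OF E, of i] that by auto
  have top: "(\<integral>\<omega>. (D m s \<omega> - D m 0 \<omega>) * (D m t \<omega> - D m 0 \<omega>) \<partial>M)
      = F1 m m s t - F1 m m 0 t - F1 m m s 0 + F1 m m 0 0"
    "(\<integral>\<omega>. (E m s \<omega> - E m 0 \<omega>) * (E m t \<omega> - E m 0 \<omega>) \<partial>N)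
      = F2 m m s t - F2 m m 0 t - F2 m m s 0 + F2 m m 0 0"
    if "s \<in> {0..1}" "t \<in> {0..1}" for s t
  proof -
    have z: "(0::real) \<in> {0..1}" by simp
    note i = sq_integrable_mult[OF qm_jet_sq[OF D order_refl] qm_jet_sq[OF D order_refl]]
      sq_integrable_mult[OF qm_jet_sq[OF E order_refl] qm_jet_sq[OF E order_refl]]
    show "(\<integral>\<omega>. (D m s \<omega> - D m 0 \<omega>) * (D m t \<omega> - D m 0 \<omega>) \<partial>M)
      = F1 m m s t - F1 m m 0 t - F1 m m s 0 + F1 m m 0 0"
      unfolding F1_def left_diff_distrib right_diff_distrib
      using i(1)[OF that] i(1)[OF z z] i(1)[OF z that(2)] i(1)[OF that(1) z] by simp
    show "(\<integral>\<omega>. (E m s \<omega> - E m 0 \<omega>) * (E m t \<omega> - E m 0 \<omega>) \<partial>N)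
      = F2 m m s t - F2 m m 0 t - F2 m m s 0 + F2 m m 0 0"
      unfolding F2_def left_diff_distrib right_diff_distrib
      using i(2)[OF that] i(2)[OF z z] i(2)[OF z that(2)] i(2)[OF that(1) z] by simp
  qed
  have "\<bar>hermite_error k x (\<lambda>i s. hermite_error k x (\<lambda>j t. F1 i j s t - \<kappa> * F2 i j s t))\<bar> \<le> hermite_bound k * \<eta>"
  proof (rule hermite_bound(2)[OF k(1-3), where F="\<lambda>i j s t. F1 i j s t - \<kappa> * F2 i j s t"])
    fix i j :: nat and s t :: real assume *: "i < m" "j \<le> m" "s \<in> {0..1}" "t \<in> {0..1}"
    show "((\<lambda>s. F1 i j s t - \<kappa> * F2 i j s t) has_real_derivative F1 (Suc i) j s t - \<kappa> * F2 (Suc i) j s t) (at s within {0..1})"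
      by (intro DERIV_diff DERIV_cmult d *)
  next
    fix j :: nat and s t :: real assume *: "j < m" "s \<in> {0..1}" "t \<in> {0..1}"
    have "((\<lambda>t. F1 j m t s - \<kappa> * F2 j m t s) has_real_derivative F1 (Suc j) m t s - \<kappa> * F2 (Suc j) m t s) (at t within {0..1})"
      using * by (intro DERIV_diff DERIV_cmult d) auto
    then show "((\<lambda>t. F1 m j s t - \<kappa> * F2 m j s t) has_real_derivative F1 m (Suc j) s t - \<kappa> * F2 m (Suc j) s t) (at t within {0..1})"
      by (simp only: sym[of m])
  next
    fix s t :: real assume st: "s \<in> {0..1}" "t \<in> {0..1}"
    show "\<bar>F1 m m s t - \<kappa> * F2 m m s t - (F1 m m 0 t - \<kappa> * F2 m m 0 t) - (F1 m m s 0 - \<kappa> * F2 m m s 0)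
        + (F1 m m 0 0 - \<kappa> * F2 m m 0 0)\<bar> \<le> \<eta>"
      using \<eta>[OF st] unfolding top[OF st] by (simp add: algebra_simps)
  qed (rule x)
  also have "hermite_error k x (\<lambda>i s. hermite_error k x (\<lambda>j t. F1 i j s t - \<kappa> * F2 i j s t))
    = (qm_norm M (\<lambda>\<omega>. hermite_error k x (\<lambda>i s. D i s \<omega>)))\<^sup>2
    - \<kappa> * (qm_norm N (\<lambda>\<omega>. hermite_error k x (\<lambda>i s. E i s \<omega>)))\<^sup>2"
    unfolding qm_norm_hermite_error[OF D k(2) x] qm_norm_hermite_error[OF E k(2) x] F1_def F2_def
    by (simp only: hermite_error_diff hermite_error_scale)
  finally show ?thesis .
qed


text \<open>
  The comparison with \<open>\<kappa> = 0\<close> bounds a single error; the Cauchy-Schwarz inequality supplies its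
  hypothesis.
\<close>

lemma hermite_error_dominated:
  assumes k: "odd k" "k div 2 \<le> m" "m \<le> k" and D: "qm_jet M {a..a + w} m D" and w: "0 < w"
    and \<eta>: "\<And>s. s \<in> {a..a + w} \<Longrightarrow> qm_norm M (\<lambda>\<omega>. D m s \<omega> - D m a \<omega>) \<le> \<eta>"
    and x: "x \<in> {0..1}"
  shows "qm_norm M (\<lambda>\<omega>. hermite_error k x (\<lambda>i s. w ^ i * D i (a + s * w) \<omega>)) \<le> sqrt (hermite_bound k) * (w ^ m * \<eta>)"
proof -
  let ?D = "\<lambda>i s \<omega>. w ^ i * D i (a + s * w) \<omega>"
  note D' = qm_jet_rescale[OF D w]
  have \<eta>0: "0 \<le> \<eta>" using order_trans[OF qm_norm_nonneg \<eta>[of a]] w by simp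
  have inc: "qm_norm M (\<lambda>\<omega>. ?D m s \<omega> - ?D m 0 \<omega>) \<le> w ^ m * \<eta>" if "s \<in> {0..1}" for s
  proof -
    have "qm_norm M (\<lambda>\<omega>. ?D m s \<omega> - ?D m 0 \<omega>) = w ^ m * qm_norm M (\<lambda>\<omega>. D m (a + s * w) \<omega> - D m a \<omega>)"
      using w qm_norm_scale[of M "w ^ m" "\<lambda>\<omega>. D m (a + s * w) \<omega> - D m a \<omega>"] by (simp add: right_diff_distrib)
    also have "\<dots> \<le> w ^ m * \<eta>"
      using that w by (intro mult_left_mono \<eta>) (auto simp: mult_left_le_one_le)
    finally show ?thesis .
  qed
  have "\<bar>(qm_norm M (\<lambda>\<omega>. hermite_error k x (\<lambda>i s. ?D i s \<omega>)))\<^sup>2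
    - 0 * (qm_norm M (\<lambda>\<omega>. hermite_error k x (\<lambda>i s. ?D i s \<omega>)))\<^sup>2\<bar> \<le> hermite_bound k * (w ^ m * \<eta>)\<^sup>2"
  proof (rule hermite_error_compare[OF k D' D' _ x])
    fix s t :: real assume st: "s \<in> {0..1}" "t \<in> {0..1}"
    have sq: "sq_integrable M (\<lambda>\<omega>. ?D m s \<omega> - ?D m 0 \<omega>)" if "s \<in> {0..1}" for s
      using qm_jet_sq[OF D' order_refl that] qm_jet_sq[OF D' order_refl, of 0] by (intro sq_integrable_diff) auto
    have "\<bar>\<integral>\<omega>. (?D m s \<omega> - ?D m 0 \<omega>) * (?D m t \<omega> - ?D m 0 \<omega>) \<partial>M\<bar>
      \<le> qm_norm M (\<lambda>\<omega>. ?D m s \<omega> - ?D m 0 \<omega>) * qm_norm M (\<lambda>\<omega>. ?D m t \<omega> - ?D m 0 \<omega>)"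
      by (rule qm_Cauchy_Schwarz[OF sq[OF st(1)] sq[OF st(2)]])
    also have "\<dots> \<le> (w ^ m * \<eta>) * (w ^ m * \<eta>)" 
      using w \<eta>0 by (intro mult_mono inc st) auto
    finally show "\<bar>(\<integral>\<omega>. (?D m s \<omega> - ?D m 0 \<omega>) * (?D m t \<omega> - ?D m 0 \<omega>) \<partial>M)
      - 0 * (\<integral>\<omega>. (?D m s \<omega> - ?D m 0 \<omega>) * (?D m t \<omega> - ?D m 0 \<omega>) \<partial>M)\<bar> \<le> (w ^ m * \<eta>)\<^sup>2"
      by (simp add: power2_eq_square)
  qed
  then have "(qm_norm M (\<lambda>\<omega>. hermite_error k x (\<lambda>i s. ?D i s \<omega>)))\<^sup>2 \<le> (sqrt (hermite_bound k) * (w ^ m * \<eta>))\<^sup>2"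
    using hermite_bound(1)[OF k(1)] by (simp add: power_mult_distrib)
  then show ?thesis
    by (rule power2_le_imp_le) (use hermite_bound(1)[OF k(1)] w \<eta>0 in auto)
qed

text \<open>
  Here \<open>E\<close> is a process whose derivative of order \<open>m\<close> has the increments of fractional Brownian
  motion.  Polarisation writes each covariance of two increments as half a combination of three
  squared norms, which accounts for the factor \<open>3 / 2\<close>.
\<close>

lemma hermite_error_asymptotic:
  assumes k: "odd k" "k div 2 \<le> m" "m \<le> k" and D: "qm_jet M {a..a + w} m D" and w: "0 < w"
    and E: "qm_jet N {0..1} m E"
    and incE: "\<And>s t. s \<in> {0..1} \<Longrightarrow> t \<in> {0..1} \<Longrightarrow> qm_norm N (\<lambda>\<omega>. E m s \<omega> - E m t \<omega>) = \<bar>s - t\<bar> powr \<beta>"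
    and incD: "\<And>s t. s \<in> {a..a + w} \<Longrightarrow> t \<in> {a..a + w} \<Longrightarrow>
      \<bar>(qm_norm M (\<lambda>\<omega>. D m s \<omega> - D m t \<omega>))\<^sup>2 - c * \<bar>s - t\<bar> powr (2 * \<beta>)\<bar> \<le> \<epsilon> * \<bar>s - t\<bar> powr (2 * \<beta>)"
    and \<epsilon>: "0 \<le> \<epsilon>" and \<beta>: "0 < \<beta>" and x: "x \<in> {0..1}"
  shows "\<bar>(qm_norm M (\<lambda>\<omega>. hermite_error k x (\<lambda>i s. w ^ i * D i (a + s * w) \<omega>)))\<^sup>2
     - w powr (2 * (real m + \<beta>)) * c * (qm_norm N (\<lambda>\<omega>. hermite_error k x (\<lambda>i s. E i s \<omega>)))\<^sup>2\<bar>
    \<le> hermite_bound k * (3 / 2 * \<epsilon> * w powr (2 * (real m + \<beta>)))"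
proof (rule hermite_error_compare[OF k qm_jet_rescale[OF D w] E _ x])
  fix s t :: real assume st: "s \<in> {0..1}" "t \<in> {0..1}"
  define W where "W = w powr (2 * \<beta>)"
  have W: "0 \<le> W" by (simp add: W_def)
  have wm: "w powr (2 * (real m + \<beta>)) = w ^ m * w ^ m * W"
  proof -
    have "2 * (real m + \<beta>) = real m + real m + 2 * \<beta>" by simp
    then have "w powr (2 * (real m + \<beta>)) = w powr real m * w powr real m * W"
      by (simp only: powr_add W_def)
    then show ?thesis using w by (simp add: powr_realpow)
  qed
  have in': "a + s * w \<in> {a..a + w}" if "s \<in> {0..1}" for s
    using that w by (auto simp: mult_left_le_one_le)
  have z: "(0::real) \<in> {0..1}" by simp
  have sqD: "sq_integrable M (D m (a + s * w))" if "s \<in> {0..1}" for s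
    by (rule qm_jet_sq[OF D order_refl in'[OF that]])
  have sqE: "sq_integrable N (E m s)" if "s \<in> {0..1}" for s
    by (rule qm_jet_sq[OF E order_refl that])
  define p where "p s t = (qm_norm M (\<lambda>\<omega>. D m (a + s * w) \<omega> - D m (a + t * w) \<omega>))\<^sup>2" for s t
  have p: "\<bar>p s t - c * W * \<bar>s - t\<bar> powr (2 * \<beta>)\<bar> \<le> \<epsilon> * W" if "s \<in> {0..1}" "t \<in> {0..1}" for s t
  proof -
    have "\<bar>a + s * w - (a + t * w)\<bar> = \<bar>s - t\<bar> * w" using w by (simp add: left_diff_distrib[symmetric] abs_mult)
    then have e: "\<bar>a + s * w - (a + t * w)\<bar> powr (2 * \<beta>) = W * \<bar>s - t\<bar> powr (2 * \<beta>)"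
      using w by (simp add: W_def powr_mult)
    have "\<bar>s - t\<bar> powr (2 * \<beta>) \<le> 1 powr (2 * \<beta>)" using that \<beta> by (intro powr_mono2) auto
    then have "\<epsilon> * (W * \<bar>s - t\<bar> powr (2 * \<beta>)) \<le> \<epsilon> * (W * 1)"
      using \<epsilon> W by (intro mult_left_mono) auto
    then show ?thesis using incD[OF in'[OF that(1)] in'[OF that(2)]] unfolding e p_def
      by (simp add: mult.assoc)
  qed
  have "(\<integral>\<omega>. (w ^ m * D m (a + s * w) \<omega> - w ^ m * D m (a + 0 * w) \<omega>) * (w ^ m * D m (a + t * w) \<omega> - w ^ m * D m (a + 0 * w) \<omega>) \<partial>M)
    = (\<integral>\<omega>. w ^ m * w ^ m * ((D m (a + s * w) \<omega> - D m (a + 0 * w) \<omega>) * (D m (a + t * w) \<omega> - D m (a + 0 * w) \<omega>)) \<partial>M)"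
    by (simp add: algebra_simps)
  also have "\<dots> = w ^ m * w ^ m * (\<integral>\<omega>. (D m (a + s * w) \<omega> - D m (a + 0 * w) \<omega>) * (D m (a + t * w) \<omega> - D m (a + 0 * w) \<omega>) \<partial>M)"
    by simp
  also have "(\<integral>\<omega>. (D m (a + s * w) \<omega> - D m (a + 0 * w) \<omega>) * (D m (a + t * w) \<omega> - D m (a + 0 * w) \<omega>) \<partial>M)
    = (p s 0 + p t 0 - p s t) / 2"
    using qm_polarization[OF sq_integrable_diff[OF sqD[OF st(1)] sqD[OF z]] sq_integrable_diff[OF sqD[OF st(2)] sqD[OF z]]]
    by (simp add: p_def)
  finally have 1: "(\<integral>\<omega>. (w ^ m * D m (a + s * w) \<omega> - w ^ m * D m (a + 0 * w) \<omega>) * (w ^ m * D m (a + t * w) \<omega> - w ^ m * D m (a + 0 * w) \<omega>) \<partial>M)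
    = w ^ m * w ^ m * ((p s 0 + p t 0 - p s t) / 2)" .
  have sq: "(\<bar>u\<bar> powr \<beta>)\<^sup>2 = \<bar>u\<bar> powr (2 * \<beta>)" for u :: real
    by (simp add: power2_eq_square powr_add[symmetric])
  have 2: "(\<integral>\<omega>. (E m s \<omega> - E m 0 \<omega>) * (E m t \<omega> - E m 0 \<omega>) \<partial>N)
    = (\<bar>s - 0\<bar> powr (2 * \<beta>) + \<bar>t - 0\<bar> powr (2 * \<beta>) - \<bar>s - t\<bar> powr (2 * \<beta>)) / 2"
    using qm_polarization[OF sq_integrable_diff[OF sqE[OF st(1)] sqE[OF z]] sq_integrable_diff[OF sqE[OF st(2)] sqE[OF z]]]
      incE[OF st] incE[OF st(1) z] incE[OF st(2) z] sq[of s] sq[of t] sq[of "s - t"] by simp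
  have "(\<integral>\<omega>. (w ^ m * D m (a + s * w) \<omega> - w ^ m * D m (a + 0 * w) \<omega>) * (w ^ m * D m (a + t * w) \<omega> - w ^ m * D m (a + 0 * w) \<omega>) \<partial>M)
      - w powr (2 * (real m + \<beta>)) * c * (\<integral>\<omega>. (E m s \<omega> - E m 0 \<omega>) * (E m t \<omega> - E m 0 \<omega>) \<partial>N)
    = w ^ m * w ^ m * ((p s 0 - c * W * \<bar>s - 0\<bar> powr (2 * \<beta>)) + (p t 0 - c * W * \<bar>t - 0\<bar> powr (2 * \<beta>))
        - (p s t - c * W * \<bar>s - t\<bar> powr (2 * \<beta>))) / 2"
    unfolding 1 2 wm by (simp add: field_simps)
  also have "\<bar>\<dots>\<bar> = w ^ m * w ^ m * \<bar>(p s 0 - c * W * \<bar>s - 0\<bar> powr (2 * \<beta>)) + (p t 0 - c * W * \<bar>t - 0\<bar> powr (2 * \<beta>))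
        - (p s t - c * W * \<bar>s - t\<bar> powr (2 * \<beta>))\<bar> / 2"
    using w by (simp add: abs_mult)
  also have "\<dots> \<le> w ^ m * w ^ m * (3 * (\<epsilon> * W)) / 2"
  proof -
    have "\<bar>u + v - r\<bar> \<le> 3 * e" if "\<bar>u\<bar> \<le> e" "\<bar>v\<bar> \<le> e" "\<bar>r\<bar> \<le> e" for u v r e :: real
      using that by linarith
    then show ?thesis using w p[OF st(1) z] p[OF st(2) z] p[OF st]
      by (intro divide_right_mono mult_left_mono) auto
  qed
  also have "\<dots> = 3 / 2 * \<epsilon> * w powr (2 * (real m + \<beta>))" unfolding wm by simp
  finally show "\<bar>(\<integral>\<omega>. (w ^ m * D m (a + s * w) \<omega> - w ^ m * D m (a + 0 * w) \<omega>) * (w ^ m * D m (a + t * w) \<omega> - w ^ m * D m (a + 0 * w) \<omega>) \<partial>M)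
      - w powr (2 * (real m + \<beta>)) * c * (\<integral>\<omega>. (E m s \<omega> - E m 0 \<omega>) * (E m t \<omega> - E m 0 \<omega>) \<partial>N)\<bar>
    \<le> 3 / 2 * \<epsilon> * w powr (2 * (real m + \<beta>))" .
qed

lemma continuous_on_hermite_error_norm:
  assumes D: "qm_jet M {0..1} m D" and k: "k div 2 \<le> m"
  shows "continuous_on {0..1} (\<lambda>x. qm_norm M (\<lambda>\<omega>. hermite_error k x (\<lambda>i s. D i s \<omega>)))"
proof (rule qm_continuous_norm)
  show "sq_integrable M (\<lambda>\<omega>. hermite_error k x (\<lambda>i s. D i s \<omega>))" if "x \<in> {0..1}" for x
    by (rule sq_integrable_hermite_error[OF D k that])
  show "qm_continuous_on M {0..1} (\<lambda>x \<omega>. hermite_error k x (\<lambda>i s. D i s \<omega>))"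
    unfolding qm_continuous_on_def
  proof
    fix x :: real assume x: "x \<in> {0..1}"
    let ?A = "hermite_left k" and ?C = "hermite_right k"
    let ?g = "\<lambda>y. qm_norm M (\<lambda>\<omega>. D 0 y \<omega> - D 0 x \<omega>)
      + (\<Sum>i\<le>k div 2. \<bar>poly (?A i) y - poly (?A i) x\<bar> * qm_norm M (D i 0) + \<bar>poly (?C i) y - poly (?C i) x\<bar> * qm_norm M (D i 1))"
    have sq: "sq_integrable M (D i 0)" "sq_integrable M (D i 1)" if "i \<le> k div 2" for i
      using qm_jet_sq[OF D, of i] that k by auto
    have sq0: "sq_integrable M (D 0 y)" if "y \<in> {0..1}" for y using qm_jet_sq[OF D, of 0] that by auto
    have lim: "(?g \<longlongrightarrow> 0 + (\<Sum>i\<le>k div 2. \<bar>poly (?A i) x - poly (?A i) x\<bar> * qm_norm M (D i 0) + \<bar>poly (?C i) x - poly (?C i) x\<bar> * qm_norm M (D i 1)))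
        (at x within {0..1})"
      using qm_jet_continuous[OF D, of 0] x unfolding qm_continuous_on_def
      by (intro tendsto_add tendsto_sum tendsto_mult tendsto_rabs tendsto_diff tendsto_const
          isCont_tendsto_compose[OF poly_isCont] tendsto_ident_at) auto
    have le: "qm_norm M (\<lambda>\<omega>. hermite_error k y (\<lambda>i s. D i s \<omega>) - hermite_error k x (\<lambda>i s. D i s \<omega>)) \<le> ?g y"
      if y: "y \<in> {0..1}" for y
    proof -
      let ?S = "\<lambda>i \<omega>. (poly (?A i) y - poly (?A i) x) * D i 0 \<omega> + (poly (?C i) y - poly (?C i) x) * D i 1 \<omega>"
      have sS: "sq_integrable M (?S i)" if "i \<le> k div 2" for i
        using sq[OF that] by (intro sq_integrable_add sq_integrable_scale)
      have "(\<lambda>\<omega>. hermite_error k y (\<lambda>i s. D i s \<omega>) - hermite_error k x (\<lambda>i s. D i s \<omega>))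
        = (\<lambda>\<omega>. (D 0 y \<omega> - D 0 x \<omega>) - (\<Sum>i\<le>k div 2. ?S i \<omega>))"
      proof
        fix \<omega>
        have "(\<Sum>i\<le>k div 2. ?S i \<omega>) = (\<Sum>i\<le>k div 2. D i 0 \<omega> * poly (?A i) y + D i 1 \<omega> * poly (?C i) y)
          - (\<Sum>i\<le>k div 2. D i 0 \<omega> * poly (?A i) x + D i 1 \<omega> * poly (?C i) x)"
          unfolding sum_subtractf[symmetric] by (intro sum.cong refl) (simp add: algebra_simps)
        then show "hermite_error k y (\<lambda>i s. D i s \<omega>) - hermite_error k x (\<lambda>i s. D i s \<omega>)
          = (D 0 y \<omega> - D 0 x \<omega>) - (\<Sum>i\<le>k div 2. ?S i \<omega>)"
          unfolding hermite_error_def by linarith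
      qed
      moreover have "qm_norm M (\<lambda>\<omega>. (D 0 y \<omega> - D 0 x \<omega>) - (\<Sum>i\<le>k div 2. ?S i \<omega>))
        \<le> qm_norm M (\<lambda>\<omega>. D 0 y \<omega> - D 0 x \<omega>) + qm_norm M (\<lambda>\<omega>. \<Sum>i\<le>k div 2. ?S i \<omega>)"
        using sS sq0[OF x] sq0[OF y] by (intro qm_norm_triangle_minus sq_integrable_diff sq_integrable_sum) auto
      moreover have "qm_norm M (\<lambda>\<omega>. \<Sum>i\<le>k div 2. ?S i \<omega>) \<le> (\<Sum>i\<le>k div 2. qm_norm M (?S i))"
        using sS by (intro qm_norm_sum_le) auto
      moreover have "(\<Sum>i\<le>k div 2. qm_norm M (?S i)) \<le> (\<Sum>i\<le>k div 2. \<bar>poly (?A i) y - poly (?A i) x\<bar> * qm_norm M (D i 0) + \<bar>poly (?C i) y - poly (?C i) x\<bar> * qm_norm M (D i 1))"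
      proof (rule sum_mono)
        fix i assume "i \<in> {..k div 2}"
        then have i: "i \<le> k div 2" by simp
        show "qm_norm M (?S i) \<le> \<bar>poly (?A i) y - poly (?A i) x\<bar> * qm_norm M (D i 0) + \<bar>poly (?C i) y - poly (?C i) x\<bar> * qm_norm M (D i 1)"
          unfolding qm_norm_scale[symmetric] using sq[OF i] by (intro qm_norm_triangle sq_integrable_scale)
      qed
      ultimately show ?thesis by simp
    qed
    show "((\<lambda>y. qm_norm M (\<lambda>\<omega>. hermite_error k y (\<lambda>i s. D i s \<omega>) - hermite_error k x (\<lambda>i s. D i s \<omega>))) \<longlongrightarrow> 0) (at x within {0..1})"
    proof (rule Lim_null_comparison)
      show "(?g \<longlongrightarrow> 0) (at x within {0..1})" using lim by simp
    qed (use le in \<open>auto simp: eventually_at_filter\<close>)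
  qed
qed

section \<open>The Hermite error of integrated fractional Brownian motion\<close>

lemma at_within_unit_interval: "t \<in> {0..1::real} \<Longrightarrow> at t within {0..1} \<noteq> bot"
  using trivial_limit_within[of t "{0..1::real}"] by simp

lemma has_qm_deriv_deterministic_combination:
  assumes \<xi>: "\<And>i. i \<in> S \<Longrightarrow> sq_integrable M (\<xi> i)" "\<And>i. i \<in> S \<Longrightarrow> sq_integrable M (\<zeta> i)" and S: "finite S"
    and f: "\<And>i. i \<in> S \<Longrightarrow> (f i has_real_derivative f' i) (at t within I)"
    and g: "\<And>i. i \<in> S \<Longrightarrow> (g i has_real_derivative g' i) (at t within I)"
  shows "has_qm_deriv M I (\<lambda>s \<omega>. \<Sum>i\<in>S. f i s * \<xi> i \<omega> + g i s * \<zeta> i \<omega>) (\<lambda>\<omega>. \<Sum>i\<in>S. f' i * \<xi> i \<omega> + g' i * \<zeta> i \<omega>) t"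
  unfolding has_qm_deriv_def
proof
  show "sq_integrable M (\<lambda>\<omega>. \<Sum>i\<in>S. f' i * \<xi> i \<omega> + g' i * \<zeta> i \<omega>)"
    using \<xi> by (intro sq_integrable_sum sq_integrable_add sq_integrable_scale) auto
  let ?q = "\<lambda>f f' i s. (f i s - f i t) / (s - t) - f' i"
  show "((\<lambda>s. qm_norm M (\<lambda>\<omega>. ((\<Sum>i\<in>S. f i s * \<xi> i \<omega> + g i s * \<zeta> i \<omega>) - (\<Sum>i\<in>S. f i t * \<xi> i \<omega> + g i t * \<zeta> i \<omega>)) / (s - t)
      - (\<Sum>i\<in>S. f' i * \<xi> i \<omega> + g' i * \<zeta> i \<omega>))) \<longlongrightarrow> 0) (at t within I)"
  proof (rule Lim_null_comparison)
    have "((\<lambda>s. ?q f f' i s) \<longlongrightarrow> 0) (at t within I)" "((\<lambda>s. ?q g g' i s) \<longlongrightarrow> 0) (at t within I)" if "i \<in> S" for i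
      using f[OF that] g[OF that] unfolding has_field_derivative_iff by (auto intro: LIM_zero)
    then have "((\<lambda>s. \<Sum>i\<in>S. \<bar>?q f f' i s\<bar> * qm_norm M (\<xi> i) + \<bar>?q g g' i s\<bar> * qm_norm M (\<zeta> i))
        \<longlongrightarrow> (\<Sum>i\<in>S. \<bar>0\<bar> * qm_norm M (\<xi> i) + \<bar>0\<bar> * qm_norm M (\<zeta> i))) (at t within I)"
      by (intro tendsto_sum tendsto_add tendsto_mult tendsto_rabs tendsto_const) auto
    then show "((\<lambda>s. \<Sum>i\<in>S. \<bar>?q f f' i s\<bar> * qm_norm M (\<xi> i) + \<bar>?q g g' i s\<bar> * qm_norm M (\<zeta> i)) \<longlongrightarrow> 0) (at t within I)"
      by simp
    have "qm_norm M (\<lambda>\<omega>. ((\<Sum>i\<in>S. f i s * \<xi> i \<omega> + g i s * \<zeta> i \<omega>) - (\<Sum>i\<in>S. f i t * \<xi> i \<omega> + g i t * \<zeta> i \<omega>)) / (s - t)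
      - (\<Sum>i\<in>S. f' i * \<xi> i \<omega> + g' i * \<zeta> i \<omega>))
      \<le> (\<Sum>i\<in>S. \<bar>?q f f' i s\<bar> * qm_norm M (\<xi> i) + \<bar>?q g g' i s\<bar> * qm_norm M (\<zeta> i))" for s
    proof -
      have "(\<lambda>\<omega>. ((\<Sum>i\<in>S. f i s * \<xi> i \<omega> + g i s * \<zeta> i \<omega>) - (\<Sum>i\<in>S. f i t * \<xi> i \<omega> + g i t * \<zeta> i \<omega>)) / (s - t)
          - (\<Sum>i\<in>S. f' i * \<xi> i \<omega> + g' i * \<zeta> i \<omega>))
        = (\<lambda>\<omega>. \<Sum>i\<in>S. ?q f f' i s * \<xi> i \<omega> + ?q g g' i s * \<zeta> i \<omega>)"
        unfolding sum_subtractf[symmetric] sum_divide_distrib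
        by (intro ext sum.cong refl) (simp add: diff_divide_distrib add_divide_distrib algebra_simps)
      moreover have "qm_norm M (\<lambda>\<omega>. \<Sum>i\<in>S. ?q f f' i s * \<xi> i \<omega> + ?q g g' i s * \<zeta> i \<omega>)
        \<le> (\<Sum>i\<in>S. qm_norm M (\<lambda>\<omega>. ?q f f' i s * \<xi> i \<omega> + ?q g g' i s * \<zeta> i \<omega>))"
        using \<xi> S by (intro qm_norm_sum_le sq_integrable_add sq_integrable_scale) auto
      moreover have "\<dots> \<le> (\<Sum>i\<in>S. \<bar>?q f f' i s\<bar> * qm_norm M (\<xi> i) + \<bar>?q g g' i s\<bar> * qm_norm M (\<zeta> i))"
        unfolding qm_norm_scale[symmetric]
        using \<xi> by (intro sum_mono qm_norm_triangle sq_integrable_scale) auto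
      ultimately show ?thesis by simp
    qed
    then show "\<forall>\<^sub>F s in at t within I. norm (qm_norm M (\<lambda>\<omega>. ((\<Sum>i\<in>S. f i s * \<xi> i \<omega> + g i s * \<zeta> i \<omega>) - (\<Sum>i\<in>S. f i t * \<xi> i \<omega> + g i t * \<zeta> i \<omega>)) / (s - t)
      - (\<Sum>i\<in>S. f' i * \<xi> i \<omega> + g' i * \<zeta> i \<omega>)))
      \<le> (\<Sum>i\<in>S. \<bar>?q f f' i s\<bar> * qm_norm M (\<xi> i) + \<bar>?q g g' i s\<bar> * qm_norm M (\<zeta> i))"
      by (intro always_eventually) simp
  qed
qed

text \<open>
  The quadratic mean derivatives of the integrated process are versions of the less integrated ones;
  at order \<open>m\<close> the increments are those of fractional Brownian motion.
\<close>

lemma fbm_jet: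
  assumes B: "fractional_BM N \<beta> B" and \<beta>: "0 < \<beta>"
  shows "qm_jet N {0..1} m (\<lambda>i. qm_derivn N {0..1} i (fbm_integral B m))"
    and "s \<in> {0..1} \<Longrightarrow> t \<in> {0..1} \<Longrightarrow> qm_norm N (\<lambda>\<omega>. qm_derivn N {0..1} m (fbm_integral B m) s \<omega>
       - qm_derivn N {0..1} m (fbm_integral B m) t \<omega>) = \<bar>s - t\<bar> powr \<beta>"
proof -
  let ?D = "\<lambda>i. qm_derivn N {0..1} i (fbm_integral B m)"
  note I = fbm_integral_qm[OF B \<beta>]
  have u: "sq_integrable N (?D j t) \<and> (AE \<omega> in N. ?D j t \<omega> = fbm_integral B (m - j) t \<omega>)
      \<and> (j < m \<longrightarrow> has_qm_deriv N {0..1} (?D j) (?D (Suc j) t) t)" if "j \<le> m" "t \<in> {0..1}" for j t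
  proof (rule qm_derivn_unique[where J="{0..1}" and Y="\<lambda>j. fbm_integral B (m - j)", OF _ at_within_unit_interval])
    fix j t assume "j < m" "t \<in> {0..1::real}"
    then have "has_qm_deriv N {0..1} (fbm_integral B (Suc (m - Suc j))) (fbm_integral B (m - Suc j) t) t"
      by (intro I(4))
    then show "has_qm_deriv N {0..1} (fbm_integral B (m - j)) (fbm_integral B (m - Suc j) t) t"
      using \<open>j < m\<close> by (simp add: Suc_diff_Suc)
  qed (use that I(1) in \<open>auto simp: eventually_at_filter\<close>)
  show inc: "qm_norm N (\<lambda>\<omega>. ?D m s \<omega> - ?D m t \<omega>) = \<bar>s - t\<bar> powr \<beta>" if "s \<in> {0..1}" "t \<in> {0..1}" for s t
  proof -
    have B0: "fbm_integral B 0 = B" by (auto simp: fbm_integral_def fun_eq_iff)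
    have "qm_norm N (\<lambda>\<omega>. ?D m s \<omega> - ?D m t \<omega>) = qm_norm N (\<lambda>\<omega>. B s \<omega> - B t \<omega>)"
    proof (rule qm_norm_cong_AE)
      have "AE \<omega> in N. ?D m s \<omega> = B s \<omega>" "AE \<omega> in N. ?D m t \<omega> = B t \<omega>"
        using u[OF order_refl that(1)] u[OF order_refl that(2)] by (simp_all add: B0)
      then show "AE \<omega> in N. ?D m s \<omega> - ?D m t \<omega> = B s \<omega> - B t \<omega>" by eventually_elim simp
    qed (use that u[of m s] u[of m t] I(1)[of s 0] I(1)[of t 0] in \<open>auto simp: sq_integrable_def B0\<close>)
    then show ?thesis using fractional_BM_increment[OF B \<beta> that] by simp
  qed
  have "qm_continuous_on N {0..1} (?D m)"
    unfolding qm_continuous_on_def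
  proof
    fix t :: real assume t: "t \<in> {0..1}"
    have "((\<lambda>s. \<bar>s - t\<bar> powr \<beta>) \<longlongrightarrow> \<bar>t - t\<bar> powr \<beta>) (at t within {0..1})"
      using \<beta> by (intro tendsto_powr2 tendsto_intros) (auto simp: eventually_at_filter)
    then have "((\<lambda>s. \<bar>s - t\<bar> powr \<beta>) \<longlongrightarrow> 0) (at t within {0..1})" by simp
    then show "((\<lambda>s. qm_norm N (\<lambda>\<omega>. ?D m s \<omega> - ?D m t \<omega>)) \<longlongrightarrow> 0) (at t within {0..1})"
      by (rule Lim_transform_within[where d=1]) (use t inc in auto)
  qed
  with u show "qm_jet N {0..1} m ?D" by (simp add: qm_jet_def)
qed

definition fbm_residual :: "'b measure \<Rightarrow> (real \<Rightarrow> 'b \<Rightarrow> real) \<Rightarrow> nat \<Rightarrow> nat \<Rightarrow> real \<Rightarrow> real" where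
  "fbm_residual N B m k x =
     qm_norm N (\<lambda>\<omega>. hermite_error k x (\<lambda>i s. qm_derivn N {0..1} i (fbm_integral B m) s \<omega>))"

lemma fbm_residual_nonneg [simp]: "0 \<le> fbm_residual N B m k x"
  by (simp add: fbm_residual_def)

lemma hermite_const_eq:
  assumes "odd k"
  shows "hermite_const N B m k p = Lp_norm p {0..1} (fbm_residual N B m k)"
proof -
  have "qm_norm N (\<lambda>\<omega>. fbm_integral B m t \<omega> - hermite N k 0 1 (fbm_integral B m) t \<omega>) = fbm_residual N B m k t" for t
    unfolding fbm_residual_def
    using hermite_residual[OF assms, of 1 "fbm_integral B m" 0 t _ N] by simp
  then show ?thesis by (simp add: hermite_const_def process_norm_def)
qed

lemma fbm_residual_continuous:
  assumes "fractional_BM N \<beta> B" "0 < \<beta>" "k div 2 \<le> m"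
  shows "continuous_on {0..1} (fbm_residual N B m k)"
  unfolding fbm_residual_def[abs_def]
  by (rule continuous_on_hermite_error_norm[OF fbm_jet(1)[OF assms(1,2)] assms(3)])

text \<open>
  If the residual vanished, the integrated process would be a polynomial with random
  coefficients, so fractional Brownian motion would be differentiable in quadratic mean; its
  difference quotients at \<open>0\<close> have norm \<open>s powr (\<beta> - 1)\<close>, which is unbounded for \<open>\<beta> < 1\<close>.
\<close>

lemma fbm_residual_nontrivial:
  assumes B: "fractional_BM N \<beta> B" and \<beta>: "0 < \<beta>" "\<beta> < 1" and k: "k div 2 \<le> m"
  shows "\<exists>x\<in>{0..1}. 0 < fbm_residual N B m k x"
proof (rule ccontr)
  let ?D = "\<lambda>i. qm_derivn N {0..1} i (fbm_integral B m)"
  note D = fbm_jet(1)[OF B \<beta>(1), of m]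
  assume "\<not> ?thesis"
  then have zero: "fbm_residual N B m k x = 0" if "x \<in> {0..1}" for x
    using that fbm_residual_nonneg[of N B m k x] by (metis order_le_less)
  \<comment> \<open>\<open>W j\<close> is the derivative of order \<open>j\<close> of the interpolating random polynomial.\<close>
  define W where "W j x \<omega> = (\<Sum>i\<le>k div 2. poly ((pderiv ^^ j) (hermite_left k i)) x * ?D i 0 \<omega>
     + poly ((pderiv ^^ j) (hermite_right k i)) x * ?D i 1 \<omega>)" for j x \<omega>
  have sD: "sq_integrable N (?D i 0)" "sq_integrable N (?D i 1)" if "i \<in> {..k div 2}" for i
    using qm_jet_sq[OF D, of i] that k by auto
  have sW: "sq_integrable N (W j x)" for j x
    unfolding W_def using sD by (intro sq_integrable_sum sq_integrable_add sq_integrable_scale) auto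
  have W': "has_qm_deriv N {0..1} (W j) (W (Suc j) x) x" for j x
    unfolding W_def[abs_def]
    by (rule has_qm_deriv_deterministic_combination[OF sD]) (auto intro: DERIV_subset[OF poly_DERIV])
  have eq: "\<forall>x\<in>{0..1}. AE \<omega> in N. ?D j x \<omega> = W j x \<omega>" if "j \<le> m" for j
    using that
  proof (induction j)
    case 0
    show ?case
    proof
      fix x :: real assume x: "x \<in> {0..1}"
      have "AE \<omega> in N. hermite_error k x (\<lambda>i s. ?D i s \<omega>) = 0"
        using zero[OF x] qm_norm_eq_0_iff[OF sq_integrable_hermite_error[OF D k x]]
        by (simp add: fbm_residual_def)
      then show "AE \<omega> in N. ?D 0 x \<omega> = W 0 x \<omega>"
        by eventually_elim (simp add: hermite_error_def W_def mult.commute)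
    qed
  next
    case (Suc j)
    show ?case
    proof
      fix x :: real assume x: "x \<in> {0..1}"
      show "AE \<omega> in N. ?D (Suc j) x \<omega> = W (Suc j) x \<omega>"
        by (rule has_qm_deriv_unique[where J="{0..1}", OF qm_jet_deriv[OF D _ x] W'])
          (use Suc x sW qm_jet_sq[OF D, of j] at_within_unit_interval in \<open>auto simp: eventually_at_filter\<close>)
    qed
  qed
  have z: "(0::real) \<in> {0..1}" by simp
  have eq': "AE \<omega> in N. W m x \<omega> = ?D m x \<omega>" if "x \<in> {0..1}" for x
  proof -
    have "AE \<omega> in N. ?D m x \<omega> = W m x \<omega>" using eq[OF order_refl] that by blast
    then show ?thesis by eventually_elim simp
  qed
  have "has_qm_deriv N {0..1} (?D m) (W (Suc m) 0) 0"
    by (rule has_qm_deriv_cong[OF W', where J="{0..1}"])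
      (use eq' sW qm_jet_sq[OF D order_refl] in \<open>auto simp: eventually_at_filter\<close>)
  then have "\<forall>\<^sub>F s in at 0 within {0..1}. qm_norm N (\<lambda>\<omega>. (?D m s \<omega> - ?D m 0 \<omega>) / (s - 0) - W (Suc m) 0 \<omega>) < 1"
    unfolding has_qm_deriv_def by (intro order_tendstoD) auto
  then obtain d where d: "0 < d" "\<And>s. 0 < s \<Longrightarrow> s \<le> 1 \<Longrightarrow> s < d \<Longrightarrow> qm_norm N (\<lambda>\<omega>. (?D m s \<omega> - ?D m 0 \<omega>) / (s - 0) - W (Suc m) 0 \<omega>) < 1"
    by (auto simp: eventually_at dist_real_def)
  define K where "K = 1 + qm_norm N (W (Suc m) 0)"
  have K: "1 \<le> K" by (simp add: K_def)
  have bound: "s powr (\<beta> - 1) \<le> K" if s: "0 < s" "s \<le> 1" "s < d" for s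
  proof -
    have sI: "s \<in> {0..1}" using s by simp
    let ?U = "\<lambda>\<omega>. (?D m s \<omega> - ?D m 0 \<omega>) / (s - 0)"
    have sU: "sq_integrable N ?U"
      using qm_jet_sq[OF D order_refl sI] qm_jet_sq[OF D order_refl z]
      by (intro sq_integrable_divide sq_integrable_diff)
    have "s powr (\<beta> - 1) = qm_norm N ?U"
      unfolding qm_norm_divide fbm_jet(2)[OF B \<beta>(1) sI z] using s by (simp add: powr_diff)
    also have "\<dots> \<le> qm_norm N (\<lambda>\<omega>. ?U \<omega> - W (Suc m) 0 \<omega>) + qm_norm N (W (Suc m) 0)"
      using qm_norm_triangle[OF sq_integrable_diff[OF sU sW] sW, of "Suc m" 0 "Suc m" 0] by simp
    also have "\<dots> \<le> K" using d(2)[OF s] by (simp add: K_def)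
    finally show ?thesis .
  qed
  \<comment> \<open>Chosen so small that \<open>s powr (\<beta> - 1)\<close> is at least \<open>K + 1\<close>.\<close>
  define s where "s = min (d / 2) (min 1 ((K + 1) powr (1 / (\<beta> - 1))))"
  have s: "0 < s" "s \<le> 1" "s < d" using d(1) K by (auto simp: s_def min_def)
  have "s powr (\<beta> - 1) \<ge> ((K + 1) powr (1 / (\<beta> - 1))) powr (\<beta> - 1)"
    using s \<beta> by (intro powr_mono2') (auto simp: s_def)
  then have "K + 1 \<le> s powr (\<beta> - 1)" using \<beta> K by (simp add: powr_powr)
  with bound[OF s] show False by simp
qed

section \<open>The error of the composite Hermite spline\<close>

lemma continuous_on_Icc_bounded:
  fixes f :: "real \<Rightarrow> real"
  assumes "continuous_on {a..b} f"
  shows "\<exists>C>0. \<forall>x\<in>{a..b}. \<bar>f x\<bar> \<le> C"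
  using compact_imp_bounded[OF compact_continuous_image[OF assms compact_Icc]]
  unfolding bounded_pos by auto

text \<open>
  What the cases \<open>p < \<infinity>\<close> and \<open>p = \<infinity>\<close> have in common.  The growth conditions at \<open>0\<close> depend on \<open>p\<close> and
  are left to the lemmas that use them.
\<close>

locale composite_hermite_spline =
  fixes M :: "'a measure" and X :: "real \<Rightarrow> 'a \<Rightarrow> real"
    and N :: "'b measure" and B :: "real \<Rightarrow> 'b \<Rightarrow> real"
    and l m q k :: nat and \<alpha> \<beta> K :: real
    and c V h :: "real \<Rightarrow> real" and T :: "nat \<Rightarrow> nat \<Rightarrow> real"
  assumes \<alpha>: "0 < \<alpha>" and \<beta>: "0 < \<beta>" "\<beta> < 1" and K: "0 < K"
    and X0: "X \<in> class_C M l \<alpha> 0 1 (\<lambda>_. K)"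
    and X1: "X \<in> class_CB M m \<beta> c V"
    and odd_q: "odd q" and odd_k: "odd k"
    and q_le: "q \<le> 2 * l + 1" "l \<le> q" and k_le: "k \<le> 2 * m + 1" "m \<le> k"
    and h: "design_density h" and T: "qRS h T" and B: "fractional_BM N \<beta> B"
begin

abbreviation D :: "nat \<Rightarrow> real \<Rightarrow> 'a \<Rightarrow> real" where
  "D i \<equiv> qm_derivn M {0..1} i X"

abbreviation b :: "real \<Rightarrow> real" where
  "b \<equiv> fbm_residual N B m k"

definition \<gamma> :: real where "\<gamma> = real m + \<beta>"

definition \<psi> :: "real \<Rightarrow> real" where "\<psi> t = sqrt (c t) * h t powr (- \<gamma>)"

definition width :: "nat \<Rightarrow> nat \<Rightarrow> real" where "width n j = T n j - T n (j - 1)"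

text \<open>
  The norm of the error on the \<open>j\<close>-th knot interval, in the coordinate \<open>x\<close> of the unit interval.
\<close>

definition residual :: "nat \<Rightarrow> nat \<Rightarrow> real \<Rightarrow> real" where
  "residual n j x = qm_norm M (\<lambda>\<omega>. hermite_error (if j = 1 then q else k) x
     (\<lambda>i s. width n j ^ i * D i (T n (j - 1) + s * width n j) \<omega>))"

definition spline_error :: "nat \<Rightarrow> real \<Rightarrow> real" where
  "spline_error n t = qm_norm M (\<lambda>\<omega>. X t \<omega> - composite_hermite M q k (T n) X t \<omega>)"

lemma \<gamma>_pos: "0 < \<gamma>" using \<beta> by (simp add: \<gamma>_def)

lemma k2: "k div 2 \<le> m" and q2: "q div 2 \<le> l" using k_le q_le by auto

lemma c_pos: "t \<in> {0<..1} \<Longrightarrow> 0 < c t" and c_cont: "continuous_on {0<..1} c"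
  and V_pos: "t \<in> {0<..1} \<Longrightarrow> 0 < V t" and V_cont: "continuous_on {0<..1} V"
  using X1 by (auto simp: class_CB_def pos_cont_on_def)

lemma jet_low: "qm_jet M {0..1} l D"
proof -
  have C: "X \<in> qm_C M l {0..1}" using X0 by (simp add: class_C_def)
  have "sq_integrable M (D i t)" if "i \<le> l" "t \<in> {0..1}" for i t
  proof (cases i)
    case 0
    then show ?thesis using C that by (simp add: qm_C_def qm_derivn_def)
  next
    case (Suc j)
    then have "has_qm_deriv M {0..1} (D j) (D (Suc j) t) t" using C that by (simp add: qm_C_def)
    then show ?thesis using Suc by (simp add: has_qm_deriv_def)
  qed
  with C show ?thesis by (simp add: qm_jet_def qm_C_def)
qed

lemma hoelder_low:
  assumes "t \<in> {0..1}" "u \<in> {0..1}"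
  shows "qm_norm M (\<lambda>\<omega>. D l u \<omega> - D l t \<omega>) \<le> sqrt K * \<bar>u - t\<bar> powr \<alpha>"
  using X0 assms by (auto simp: class_C_def)

text \<open>
  Differentiability is local, so on \<open>(a, 1]\<close> the derivatives chosen relative to \<open>[0, 1]\<close>, which the
  splines use, agree almost surely with those relative to \<open>[a, 1]\<close>, to which the local conditions
  refer.
\<close>

lemma derivs_local:
  assumes a: "0 < a" "a < 1" and j: "j \<le> m" and t: "a < t" "t \<le> 1"
  shows "sq_integrable M (D j t) \<and> (AE \<omega> in M. D j t \<omega> = qm_derivn M {a..1} j X t \<omega>)
    \<and> (j < m \<longrightarrow> has_qm_deriv M {0..1} (D j) (D (Suc j) t) t)"
proof (rule qm_derivn_unique[where J="{a<..1}" and Y="\<lambda>j. qm_derivn M {a..1} j X"])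
  have "X \<in> class_C M m \<beta> a 1 V" using X1 a by (simp add: class_CB_def)
  then have C: "X \<in> qm_C M m {a..1}" by (simp add: class_C_def)
  have at_eq: "at t within {0..1} = at t within {a..1}" if "t \<in> {a<..1}" for t
    using that a by (intro at_within_nhd[of t "{a<..}"]) auto
  fix t assume t: "t \<in> {a<..1::real}"
  show "at t within {0..1} \<noteq> bot" using t a by (intro at_within_unit_interval) auto
  show "\<forall>\<^sub>F s in at t within {0..1}. s \<in> {a<..1}"
    unfolding at_eq[OF t] using t by (auto simp: eventually_at dist_real_def intro!: exI[of _ "t - a"])
  show "X t = qm_derivn M {a..1} 0 X t" by (simp add: qm_derivn_def)
  show "sq_integrable M (qm_derivn M {a..1} j X t)" if "j \<le> m" for j
  proof (cases j)
    case 0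
    then show ?thesis using C t by (simp add: qm_C_def qm_derivn_def)
  next
    case (Suc i)
    then have "has_qm_deriv M {a..1} (qm_derivn M {a..1} i X) (qm_derivn M {a..1} (Suc i) X t) t"
      using C that t by (simp add: qm_C_def)
    then show ?thesis using Suc by (simp add: has_qm_deriv_def)
  qed
  show "has_qm_deriv M {0..1} (qm_derivn M {a..1} j X) (qm_derivn M {a..1} (Suc j) X t) t" if "j < m" for j
    unfolding has_qm_deriv_cong_at[OF at_eq[OF t]] using C that t by (simp add: qm_C_def)
qed (use j t in auto)

lemma increment_local:
  assumes a: "0 < a" "a < 1" and st: "s \<in> {a<..1}" "t \<in> {a<..1}"
  shows "qm_norm M (\<lambda>\<omega>. D m s \<omega> - D m t \<omega>)
    = qm_norm M (\<lambda>\<omega>. qm_derivn M {a..1} m X s \<omega> - qm_derivn M {a..1} m X t \<omega>)"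
proof -
  have s: "sq_integrable M (D m u)" "AE \<omega> in M. D m u \<omega> = qm_derivn M {a..1} m X u \<omega>" if "u \<in> {a<..1}" for u
    using derivs_local[OF a order_refl, of u] that by auto
  have C: "X \<in> qm_C M m {a..1}" using X1 a by (simp add: class_CB_def class_C_def)
  have s': "sq_integrable M (qm_derivn M {a..1} m X u)" if "u \<in> {a<..1}" for u
  proof (cases m)
    case 0
    then show ?thesis using C that by (simp add: qm_C_def qm_derivn_def)
  next
    case (Suc i)
    then have "has_qm_deriv M {a..1} (qm_derivn M {a..1} i X) (qm_derivn M {a..1} (Suc i) X u) u"
      using C that by (simp add: qm_C_def)
    then show ?thesis using Suc by (simp add: has_qm_deriv_def)
  qed
  show ?thesis
  proof (rule qm_norm_cong_AE)
    show "AE \<omega> in M. D m s \<omega> - D m t \<omega> = qm_derivn M {a..1} m X s \<omega> - qm_derivn M {a..1} m X t \<omega>"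
      using s(2)[OF st(1)] s(2)[OF st(2)] by eventually_elim simp
  qed (use s(1)[OF st(1)] s(1)[OF st(2)] s'[OF st(1)] s'[OF st(2)] in \<open>auto simp: sq_integrable_def\<close>)
qed

lemma jet_high:
  assumes a: "0 < a" "a \<le> 1"
  shows "qm_jet M {a..1} m D"
proof -
  define a' where "a' = a / 2"
  have a': "0 < a'" "a' < 1" "a' < a" using a by (auto simp: a'_def)
  note L = derivs_local[OF a'(1,2)]
  have "qm_continuous_on M {a..1} (D m)"
    unfolding qm_continuous_on_def
  proof
    fix t assume t: "t \<in> {a..1}"
    let ?Y = "qm_derivn M {a'..1} m X"
    have "X \<in> qm_C M m {a'..1}" using X1 a' by (simp add: class_CB_def class_C_def)
    then have "((\<lambda>s. qm_norm M (\<lambda>\<omega>. ?Y s \<omega> - ?Y t \<omega>)) \<longlongrightarrow> 0) (at t within {a'..1})"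
      using t a' by (simp add: qm_C_def qm_continuous_on_def)
    then have "((\<lambda>s. qm_norm M (\<lambda>\<omega>. ?Y s \<omega> - ?Y t \<omega>)) \<longlongrightarrow> 0) (at t within {a..1})"
      by (rule tendsto_within_subset) (use a' in auto)
    then show "((\<lambda>s. qm_norm M (\<lambda>\<omega>. D m s \<omega> - D m t \<omega>)) \<longlongrightarrow> 0) (at t within {a..1})"
      by (rule Lim_transform_within[where d=1])
        (use t a' increment_local[OF a'(1,2)] in auto)
  qed
  moreover have "has_qm_deriv M {a..1} (D i) (D (Suc i) t) t" if "i < m" "t \<in> {a..1}" for i t
  proof (rule has_qm_deriv_subset)
    show "has_qm_deriv M {0..1} (D i) (D (Suc i) t) t" using L[of i t] that a' by auto
  qed (use a in auto)
  ultimately show ?thesis unfolding qm_jet_def using L a' by auto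
qed

lemma jet_high_sub:
  assumes "0 < a" "0 < w" "a + w \<le> 1"
  shows "qm_jet M {a..a + w} m D"
proof -
  have *: "qm_jet M {a..1} m D" using assms by (intro jet_high) auto
  show ?thesis by (rule qm_jet_subset[OF *]) (use assms in auto)
qed

text \<open>
  The definition of the class uses derivatives relative to an interval that does not reach \<open>0\<close>; half the
  distance of the points from \<open>0\<close> leaves room for one that contains both in its interior.
\<close>

lemma hoelder_high:
  assumes "t \<in> {0<..1}" "u \<in> {0<..1}"
  shows "\<exists>v\<in>closed_segment t u. qm_norm M (\<lambda>\<omega>. D m u \<omega> - D m t \<omega>) \<le> sqrt (V v) * \<bar>u - t\<bar> powr \<beta>"
proof -
  define a where "a = min t u / 2"
  have a: "0 < a" "a < 1" "a < t" "a < u" using assms by (auto simp: a_def min_def)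
  have "X \<in> class_C M m \<beta> a 1 V" using X1 a by (simp add: class_CB_def)
  then obtain v where "v \<in> closed_segment t u"
      "qm_norm M (\<lambda>\<omega>. qm_derivn M {a..1} m X u \<omega> - qm_derivn M {a..1} m X t \<omega>) \<le> sqrt (V v) * \<bar>u - t\<bar> powr \<beta>"
    using assms a unfolding class_C_def by fastforce
  then show ?thesis using increment_local[OF a(1,2), of u t] a assms by auto
qed

text \<open>
  The local condition in the form in which it is compared with fractional Brownian motion: for
  squared norms, and with \<open>c\<close> evaluated at an arbitrary nearby point \<open>v\<close>.
\<close>

lemma increments_uniform:
  assumes \<delta>: "0 < \<delta>" "\<delta> \<le> 1" and \<epsilon>: "0 < \<epsilon>"
  shows "\<exists>\<eta>>0. \<forall>t\<in>{\<delta>..1}. \<forall>u\<in>{\<delta>..1}. \<forall>v\<in>{\<delta>..1}. \<bar>u - t\<bar> < \<eta> \<longrightarrow> \<bar>v - t\<bar> < \<eta> \<longrightarrow>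
    \<bar>(qm_norm M (\<lambda>\<omega>. D m u \<omega> - D m t \<omega>))\<^sup>2 - c v * \<bar>u - t\<bar> powr (2 * \<beta>)\<bar> \<le> \<epsilon> * \<bar>u - t\<bar> powr (2 * \<beta>)"
proof -
  have cc: "continuous_on {\<delta>..1} c" using c_cont by (rule continuous_on_subset) (use \<delta> in auto)
  then obtain C where C: "\<And>t. t \<in> {\<delta>..1} \<Longrightarrow> \<bar>c t\<bar> \<le> C"
    using continuous_on_Icc_bounded by blast
  have C0: "0 \<le> C" using C[of 1] \<delta> abs_ge_zero[of "c 1"] by (auto intro: order_trans)
  define \<epsilon>1 where "\<epsilon>1 = min 1 (\<epsilon> / 2 / (2 * sqrt C + 1))"
  have \<epsilon>1: "0 < \<epsilon>1" "\<epsilon>1 \<le> 1" "\<epsilon>1 * (2 * sqrt C + 1) \<le> \<epsilon> / 2"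
  proof -
    have p: "0 < 2 * sqrt C + 1" using C0 by (simp add: add_nonneg_pos)
    show "0 < \<epsilon>1" "\<epsilon>1 \<le> 1" using p \<epsilon> by (auto simp: \<epsilon>1_def)
    have "\<epsilon>1 \<le> \<epsilon> / 2 / (2 * sqrt C + 1)" by (simp add: \<epsilon>1_def)
    then show "\<epsilon>1 * (2 * sqrt C + 1) \<le> \<epsilon> / 2" using p by (simp only: pos_le_divide_eq)
  qed
  have "uniformly_continuous_on {\<delta>..1} c" using cc by (intro compact_uniformly_continuous) auto
  then obtain \<eta>1 where \<eta>1: "0 < \<eta>1" "\<And>t v. t \<in> {\<delta>..1} \<Longrightarrow> v \<in> {\<delta>..1} \<Longrightarrow> \<bar>v - t\<bar> < \<eta>1 \<Longrightarrow> \<bar>c v - c t\<bar> < \<epsilon> / 2"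
    unfolding uniformly_continuous_on_def dist_real_def using \<epsilon> by (metis half_gt_zero)
  define a where "a = \<delta> / 2"
  have a: "0 < a" "a < 1" "a < \<delta>" using \<delta> by (auto simp: a_def)
  let ?Y = "qm_derivn M {a..1} m X"
  have "X \<in> class_B M m \<beta> a 1 c" using X1 a by (simp add: class_CB_def)
  then obtain \<eta>2 where \<eta>2: "0 < \<eta>2" "\<And>t s. t \<in> {a..1} \<Longrightarrow> s \<noteq> 0 \<Longrightarrow> \<bar>s\<bar> < \<eta>2 \<Longrightarrow> t + s \<in> {a..1} \<Longrightarrow>
      \<bar>qm_norm M (\<lambda>\<omega>. ?Y (t + s) \<omega> - ?Y t \<omega>) / \<bar>s\<bar> powr \<beta> - sqrt (c t)\<bar> < \<epsilon>1"
    unfolding class_B_def using \<epsilon>1(1) by blast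
  show ?thesis
  proof (intro exI[of _ "min \<eta>1 \<eta>2"] conjI ballI impI)
    fix t u v assume t: "t \<in> {\<delta>..1}" and u: "u \<in> {\<delta>..1}" and v: "v \<in> {\<delta>..1}"
      and ut: "\<bar>u - t\<bar> < min \<eta>1 \<eta>2" and vt: "\<bar>v - t\<bar> < min \<eta>1 \<eta>2"
    show "\<bar>(qm_norm M (\<lambda>\<omega>. D m u \<omega> - D m t \<omega>))\<^sup>2 - c v * \<bar>u - t\<bar> powr (2 * \<beta>)\<bar> \<le> \<epsilon> * \<bar>u - t\<bar> powr (2 * \<beta>)"
    proof (cases "u = t")
      case False
      define P where "P = \<bar>u - t\<bar> powr \<beta>"
      have P: "0 < P" using False by (simp add: P_def)
      have P2: "\<bar>u - t\<bar> powr (2 * \<beta>) = P\<^sup>2" by (simp add: P_def power2_eq_square powr_add[symmetric])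
      define A where "A = qm_norm M (\<lambda>\<omega>. D m u \<omega> - D m t \<omega>) / P"
      have A0: "0 \<le> A" using P by (simp add: A_def)
      have n: "qm_norm M (\<lambda>\<omega>. D m u \<omega> - D m t \<omega>) = A * P" using P by (simp add: A_def)
      have "\<bar>A - sqrt (c t)\<bar> < \<epsilon>1"
        using \<eta>2(2)[of t "u - t"] t u a ut False increment_local[OF a(1,2), of u t]
        by (simp add: A_def P_def)
      then have d: "\<bar>A - sqrt (c t)\<bar> \<le> \<epsilon>1" by simp
      have ct: "0 < c t" "c t \<le> C" using c_pos[of t] C[OF t] t \<delta> by auto
      have sC: "sqrt (c t) \<le> sqrt C" using ct by simp
      have "\<bar>A\<^sup>2 - c t\<bar> = \<bar>A - sqrt (c t)\<bar> * \<bar>A + sqrt (c t)\<bar>"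
        using ct by (simp add: abs_mult[symmetric] algebra_simps power2_eq_square)
      also have "\<dots> \<le> \<epsilon>1 * (2 * sqrt C + 1)"
      proof (rule mult_mono)
        have "A + sqrt (c t) \<le> 2 * sqrt C + 1" using d sC \<epsilon>1(2) by linarith
        then show "\<bar>A + sqrt (c t)\<bar> \<le> 2 * sqrt C + 1" using A0 ct by simp
      qed (use d \<epsilon>1(1) in auto)
      also have "\<dots> \<le> \<epsilon> / 2" by (rule \<epsilon>1(3))
      finally have "\<bar>A\<^sup>2 - c t\<bar> \<le> \<epsilon> / 2" .
      moreover have "\<bar>c v - c t\<bar> < \<epsilon> / 2" using \<eta>1(2)[OF t v] vt by simp
      ultimately have "\<bar>A\<^sup>2 - c v\<bar> \<le> \<epsilon>" by linarith
      then have "\<bar>A\<^sup>2 - c v\<bar> * P\<^sup>2 \<le> \<epsilon> * P\<^sup>2" by (intro mult_right_mono) auto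
      moreover have "(A * P)\<^sup>2 - c v * P\<^sup>2 = (A\<^sup>2 - c v) * P\<^sup>2" by (simp add: power_mult_distrib algebra_simps)
      ultimately show ?thesis unfolding n P2 by (simp add: abs_mult)
    qed simp
  qed (use \<eta>1 \<eta>2 in simp)
qed

end

section \<open>The error on a single knot interval\<close>

context composite_hermite_spline
begin

abbreviation g :: "real \<Rightarrow> real" where "g \<equiv> quantile_density h"

lemma width:
  assumes "1 \<le> j" "j \<le> n"
  shows "0 < width n j" "T n (j - 1) + width n j = T n j" "0 \<le> T n (j - 1)" "T n j \<le> 1"
    "j \<noteq> 1 \<Longrightarrow> 0 < T n (j - 1)"
    "\<exists>\<xi>\<in>{real (j - 1) / real n..real j / real n}. real n * width n j = g \<xi>"
proof -
  have n: "1 \<le> n" using assms by simp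
  note kn = qRS_knots[OF h T n]
  show "0 < width n j" using kn(3)[of "j - 1" j] assms by (simp add: width_def)
  show "T n (j - 1) + width n j = T n j" by (simp add: width_def)
  show "0 \<le> T n (j - 1)" "T n j \<le> 1" using kn(4)[of "j - 1"] kn(4)[of j] assms by auto
  show "0 < T n (j - 1)" if "j \<noteq> 1" using kn(3)[of 0 "j - 1"] kn(1) assms that by auto
  show "\<exists>\<xi>\<in>{real (j - 1) / real n..real j / real n}. real n * width n j = g \<xi>"
    using qRS_spacing[OF h T assms] unfolding width_def by force
qed

lemma g_nonneg: "s \<in> {0..1} \<Longrightarrow> 0 \<le> g s"
proof (cases "s = 0")
  case True
  have "(g \<longlongrightarrow> g 0) (at 0 within {0..1})"
    using quantile_density_continuous[OF h] by (simp add: continuous_on_def)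
  moreover have "\<forall>\<^sub>F s in at 0 within {0..1}. 0 \<le> g s"
    using quantile_density_pos[OF h] by (auto simp: eventually_at_filter intro!: always_eventually less_imp_le)
  ultimately have "0 \<le> g 0"
    by (rule tendsto_lowerbound) (rule at_within_unit_interval, simp)
  with True show "0 \<le> g s" by simp
next
  case False
  then show "s \<in> {0..1} \<Longrightarrow> 0 \<le> g s" using quantile_density_pos[OF h, of s] by auto
qed

lemma g_powr_continuous: "0 < p \<Longrightarrow> continuous_on {0..1} (\<lambda>s. g s powr p)"
  using quantile_density_continuous[OF h] g_nonneg by (intro continuous_on_powr') auto

text \<open>
  The widths are values of the bounded function \<open>g\<close> divided by \<open>n\<close>.
\<close>

lemma mesh_small:
  assumes "0 < \<eta>"
  shows "\<forall>\<^sub>F n in sequentially. \<forall>j\<in>{1..n}. width n j < \<eta>"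
proof -
  obtain G where G: "0 < G" "\<And>s. s \<in> {0..1} \<Longrightarrow> \<bar>g s\<bar> \<le> G"
    using continuous_on_Icc_bounded[OF quantile_density_continuous[OF h]] by blast
  have "\<forall>\<^sub>F n in sequentially. G / \<eta> < real n" by real_asymp
  then show ?thesis
  proof eventually_elim
    case (elim n)
    show ?case
    proof
      fix j assume "j \<in> {1..n}"
      then have j: "1 \<le> j" "j \<le> n" by auto
      obtain \<xi> where \<xi>: "\<xi> \<in> {real (j - 1) / real n..real j / real n}" "real n * width n j = g \<xi>"
        using width(6)[OF j] by blast
      moreover have "0 \<le> real (j - 1) / real n" "real j / real n \<le> 1" using j by (auto simp: divide_le_eq_1)
      ultimately have "\<xi> \<in> {0..1}" unfolding atLeastAtMost_iff by linarith
      then have "real n * width n j \<le> G" using G(2)[of \<xi>] \<xi>(2) by auto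
      also have "G < real n * \<eta>" using elim assms by (simp add: field_simps)
      finally show "width n j < \<eta>" using j by simp
    qed
  qed
qed

lemma residual_jet:
  assumes j: "1 \<le> j" "j \<le> n"
  shows "qm_jet M {0..1} (if j = 1 then l else m) (\<lambda>i s \<omega>. width n j ^ i * D i (T n (j - 1) + s * width n j) \<omega>)"
proof (cases "j = 1")
  case True
  have n: "1 \<le> n" using j by simp
  have "{T n 0..T n 0 + width n 1} \<subseteq> {0..1}"
    using width[OF order_refl n] qRS_knots(1)[OF h T n] by auto
  then have "qm_jet M {T n 0..T n 0 + width n 1} l D"
    by (rule qm_jet_subset[OF jet_low])
  from qm_jet_rescale[OF this width(1)[OF order_refl n]] show ?thesis using True by simp
next
  case False
  have "qm_jet M {T n (j - 1)..T n (j - 1) + width n j} m D"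
    using width[OF j] False by (intro jet_high_sub) auto
  from qm_jet_rescale[OF this width(1)[OF j]] show ?thesis using False by simp
qed

lemma residual_nonneg [simp]: "0 \<le> residual n j x"
  by (simp add: residual_def)

lemma residual_continuous:
  assumes j: "1 \<le> j" "j \<le> n"
  shows "continuous_on {0..1} (residual n j)"
  unfolding residual_def[abs_def]
  by (rule continuous_on_hermite_error_norm[OF residual_jet[OF j]]) (use k2 q2 in auto)

text \<open>
  On the first interval only the global smoothness \<open>l + \<alpha>\<close> is available.
\<close>

lemma residual_first:
  assumes n: "1 \<le> n" and x: "x \<in> {0..1}"
  shows "residual n 1 x \<le> sqrt (hermite_bound q) * (sqrt K * T n 1 powr (real l + \<alpha>))"
proof -
  have T0: "T n 0 = 0" by (rule qRS_knots(1)[OF h T n])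
  define w where "w = width n 1"
  have w: "0 < w" "w \<le> 1" "w = T n 1" using width[OF order_refl n] T0 by (auto simp: w_def)
  have J: "qm_jet M {0..0 + w} l D"
    by (rule qm_jet_subset[OF jet_low]) (use w in auto)
  have "residual n 1 x = qm_norm M (\<lambda>\<omega>. hermite_error q x (\<lambda>i s. w ^ i * D i (0 + s * w) \<omega>))"
    using T0 by (simp add: residual_def w_def)
  also have "\<dots> \<le> sqrt (hermite_bound q) * (w ^ l * (sqrt K * w powr \<alpha>))"
  proof (rule hermite_error_dominated[OF odd_q q2 q_le(2) J w(1) _ x])
    fix s assume s: "s \<in> {0..0 + w}"
    have "qm_norm M (\<lambda>\<omega>. D l s \<omega> - D l 0 \<omega>) \<le> sqrt K * \<bar>s - 0\<bar> powr \<alpha>"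
      using s w by (intro hoelder_low) auto
    also have "\<dots> \<le> sqrt K * w powr \<alpha>" using s \<alpha> K by (intro mult_left_mono powr_mono2) auto
    finally show "qm_norm M (\<lambda>\<omega>. D l s \<omega> - D l 0 \<omega>) \<le> sqrt K * w powr \<alpha>" .
  qed
  also have "w ^ l * (sqrt K * w powr \<alpha>) = sqrt K * w powr (real l + \<alpha>)"
    using w by (simp add: powr_add powr_realpow)
  finally show ?thesis by (simp add: w(3))
qed

text \<open>
  The point \<open>v\<close> maximises \<open>V\<close> on the knot interval, and \<open>\<xi>\<close> is the mean value point with
  \<open>n * width n j = g \<xi>\<close>.  The two are unrelated, which is why the majorants of \<open>V\<close> and \<open>g\<close> have to be
  moved between neighbouring arguments later.
\<close>

lemma residual_dominated:
  assumes j: "2 \<le> j" "j \<le> n" and x: "x \<in> {0..1}"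
  shows "\<exists>v\<in>{T n (j - 1)..T n j}. \<exists>\<xi>\<in>{real (j - 1) / real n..real j / real n}.
    real n powr \<gamma> * residual n j x \<le> sqrt (hermite_bound k) * (sqrt (V v) * g \<xi> powr \<gamma>)"
proof -
  have j': "1 \<le> j" "j \<noteq> 1" using j by auto
  define w a where "w = width n j" and "a = T n (j - 1)"
  have w: "0 < w" "0 < a" "a + w = T n j" "a + w \<le> 1"
    using width[OF j'(1) j(2)] j'(2) by (auto simp: w_def a_def)
  have "continuous_on {a..a + w} V" using V_cont by (rule continuous_on_subset) (use w in auto)
  then obtain v where v: "v \<in> {a..a + w}" "\<And>u. u \<in> {a..a + w} \<Longrightarrow> V u \<le> V v"
    using continuous_attains_sup[of "{a..a + w}" V] w by auto
  obtain \<xi> where \<xi>: "\<xi> \<in> {real (j - 1) / real n..real j / real n}" "real n * w = g \<xi>"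
    using width(6)[OF j'(1) j(2)] by (auto simp: w_def)
  have Vv: "0 \<le> V v" using V_pos[of v] v w by auto
  have "residual n j x = qm_norm M (\<lambda>\<omega>. hermite_error k x (\<lambda>i s. w ^ i * D i (a + s * w) \<omega>))"
    using j' by (simp add: residual_def w_def a_def)
  also have "\<dots> \<le> sqrt (hermite_bound k) * (w ^ m * (sqrt (V v) * w powr \<beta>))"
  proof (rule hermite_error_dominated[OF odd_k k2 k_le(2) jet_high_sub[OF w(2,1,4)] w(1) _ x])
    fix s assume s: "s \<in> {a..a + w}"
    obtain u where u: "u \<in> closed_segment a s" "qm_norm M (\<lambda>\<omega>. D m s \<omega> - D m a \<omega>) \<le> sqrt (V u) * \<bar>s - a\<bar> powr \<beta>"
      using hoelder_high[of a s] s w by auto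
    have "u \<in> {a..a + w}" using u(1) s by (auto simp: closed_segment_eq_real_ivl split: if_splits)
    then have "sqrt (V u) \<le> sqrt (V v)" using v by auto
    moreover have "\<bar>s - a\<bar> powr \<beta> \<le> w powr \<beta>" using s \<beta> by (intro powr_mono2) auto
    ultimately have "sqrt (V u) * \<bar>s - a\<bar> powr \<beta> \<le> sqrt (V v) * w powr \<beta>"
      using Vv by (intro mult_mono) auto
    with u(2) show "qm_norm M (\<lambda>\<omega>. D m s \<omega> - D m a \<omega>) \<le> sqrt (V v) * w powr \<beta>" by simp
  qed
  also have "w ^ m * (sqrt (V v) * w powr \<beta>) = sqrt (V v) * w powr \<gamma>"
    using w by (simp add: \<gamma>_def powr_add powr_realpow)
  finally have "real n powr \<gamma> * residual n j x \<le> real n powr \<gamma> * (sqrt (hermite_bound k) * (sqrt (V v) * w powr \<gamma>))"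
    by (intro mult_left_mono) auto
  also have "\<dots> = sqrt (hermite_bound k) * (sqrt (V v) * (real n * w) powr \<gamma>)"
    using w by (simp add: powr_mult)
  finally have le: "real n powr \<gamma> * residual n j x \<le> sqrt (hermite_bound k) * (sqrt (V v) * g \<xi> powr \<gamma>)"
    by (simp only: \<xi>(2))
  have "v \<in> {T n (j - 1)..T n j}" using v(1) unfolding w(3) unfolding a_def .
  with le \<xi>(1) show ?thesis by blast
qed

text \<open>
  The squares are compared first: \<open>\<epsilon>1\<close> controls the deviation of the increments from those of
  fractional Brownian motion, \<open>\<epsilon>2\<close> the deviation of \<open>n * width n j\<close> from \<open>g (H v) = 1 / h v\<close>.
\<close>

lemma residual_local:
  assumes \<delta>: "0 < \<delta>" "\<delta> \<le> 1" and \<epsilon>: "0 < \<epsilon>"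
  shows "\<forall>\<^sub>F n in sequentially. \<forall>j\<in>{2..n}. \<delta> \<le> T n (j - 1) \<longrightarrow>
    (\<forall>v\<in>{T n (j - 1)..T n j}. \<forall>x\<in>{0..1}. \<bar>real n powr \<gamma> * residual n j x - \<psi> v * b x\<bar> \<le> \<epsilon>)"
proof -
  \<comment> \<open>Squared quantities are compared, hence the doubled exponent.\<close>
  define \<Gamma> where "\<Gamma> = 2 * \<gamma>"
  have \<Gamma>: "0 < \<Gamma>" using \<gamma>_pos by (simp add: \<Gamma>_def)
  obtain G where G: "0 < G" "\<And>s. s \<in> {0..1} \<Longrightarrow> \<bar>g s powr \<Gamma>\<bar> \<le> G"
    using continuous_on_Icc_bounded[OF g_powr_continuous[OF \<Gamma>]] by blast
  have "continuous_on {\<delta>..1} c" using c_cont by (rule continuous_on_subset) (use \<delta> in auto)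
  then obtain C where C: "0 < C" "\<And>t. t \<in> {\<delta>..1} \<Longrightarrow> \<bar>c t\<bar> \<le> C"
    using continuous_on_Icc_bounded by blast
  obtain b0 where b0: "0 < b0" "\<And>x. x \<in> {0..1} \<Longrightarrow> \<bar>b x\<bar> \<le> b0"
    using continuous_on_Icc_bounded[OF fbm_residual_continuous[OF B \<beta>(1) k2]] by blast
  let ?h = "hermite_bound k"
  have hb: "0 < ?h" by (rule hermite_bound(1)[OF odd_k])
  define \<epsilon>1 where "\<epsilon>1 = \<epsilon>\<^sup>2 / 2 / (?h * (3 / 2) * G)"
  have \<epsilon>1: "0 < \<epsilon>1" "?h * (3 / 2 * \<epsilon>1 * G) = \<epsilon>\<^sup>2 / 2" using \<epsilon> hb G by (auto simp: \<epsilon>1_def)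
  define \<epsilon>2 where "\<epsilon>2 = \<epsilon>\<^sup>2 / 2 / (C * b0\<^sup>2)"
  have \<epsilon>2: "0 < \<epsilon>2" "\<epsilon>2 * (C * b0\<^sup>2) = \<epsilon>\<^sup>2 / 2" using \<epsilon> C(1) b0(1) by (auto simp: \<epsilon>2_def)
  obtain \<eta> where \<eta>: "0 < \<eta>" "\<And>t u v. t \<in> {\<delta>..1} \<Longrightarrow> u \<in> {\<delta>..1} \<Longrightarrow> v \<in> {\<delta>..1} \<Longrightarrow> \<bar>u - t\<bar> < \<eta> \<Longrightarrow> \<bar>v - t\<bar> < \<eta> \<Longrightarrow>
    \<bar>(qm_norm M (\<lambda>\<omega>. D m u \<omega> - D m t \<omega>))\<^sup>2 - c v * \<bar>u - t\<bar> powr (2 * \<beta>)\<bar> \<le> \<epsilon>1 * \<bar>u - t\<bar> powr (2 * \<beta>)"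
    using increments_uniform[OF \<delta> \<epsilon>1(1)] by blast
  have "uniformly_continuous_on {0..1} (\<lambda>s. g s powr \<Gamma>)"
    by (intro compact_uniformly_continuous g_powr_continuous \<Gamma>) auto
  then obtain \<zeta> where \<zeta>: "0 < \<zeta>" "\<And>s t. s \<in> {0..1} \<Longrightarrow> t \<in> {0..1} \<Longrightarrow> \<bar>t - s\<bar> < \<zeta> \<Longrightarrow> \<bar>g t powr \<Gamma> - g s powr \<Gamma>\<bar> < \<epsilon>2"
    unfolding uniformly_continuous_on_def dist_real_def using \<epsilon>2(1) by metis
  have "\<forall>\<^sub>F n in sequentially. 1 / \<zeta> < real n" by real_asymp
  with mesh_small[OF \<eta>(1)] show ?thesis
  proof eventually_elim
    case (elim n)
    show ?case
    proof (intro ballI impI)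
      fix j v x assume "j \<in> {2..n}" and \<delta>j: "\<delta> \<le> T n (j - 1)" and v: "v \<in> {T n (j - 1)..T n j}" and x: "x \<in> {0..1::real}"
      then have j: "1 \<le> j" "j \<le> n" "j \<noteq> 1" "2 \<le> j" by auto
      have n: "1 \<le> n" using j by simp
      define w a where "w = width n j" and "a = T n (j - 1)"
      have w: "0 < w" "0 < a" "a + w = T n j" "a + w \<le> 1" "w < \<eta>" "\<delta> \<le> a" "v \<in> {a..a + w}"
        using width[OF j(1,2)] j elim(1) v \<delta>j by (auto simp: w_def a_def)
      obtain \<xi> where \<xi>: "\<xi> \<in> {real (j - 1) / real n..real j / real n}" "real n * w = g \<xi>"
        using width(6)[OF j(1,2)] by (auto simp: w_def)
      have jn: "real j / real n \<le> 1" "0 \<le> real (j - 1) / real n" "real j / real n - real (j - 1) / real n = 1 / real n"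
        using j by (auto simp: divide_le_eq_1 of_nat_diff diff_divide_distrib[symmetric])
      have \<xi>1: "\<xi> \<in> {0..1}" using \<xi>(1) jn unfolding atLeastAtMost_iff by linarith
      have v1: "v \<in> {0<..1}" "v \<in> {\<delta>..1}" using w by auto
      have Hv: "cdf_of h v \<in> {real (j - 1) / real n..real j / real n}"
      proof -
        have "cdf_of h (T n (j - 1)) \<le> cdf_of h v" "cdf_of h v \<le> cdf_of h (T n j)"
          using v w by (auto simp: cdf_of_le_iff[OF h] a_def)
        then show ?thesis using qRS_knots(5)[OF h T n, of j] qRS_knots(5)[OF h T n, of "j - 1"] j by simp
      qed
      have Hv1: "cdf_of h v \<in> {0..1}" using Hv jn unfolding atLeastAtMost_iff by linarith
      have "\<bar>\<xi> - cdf_of h v\<bar> \<le> 1 / real n" using \<xi>(1) Hv jn(3) unfolding atLeastAtMost_iff by linarith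
      also have "\<dots> < \<zeta>" using elim(2) \<zeta>(1) n by (simp add: field_simps)
      finally have gg: "\<bar>g \<xi> powr \<Gamma> - g (cdf_of h v) powr \<Gamma>\<bar> < \<epsilon>2" by (intro \<zeta>(2) \<xi>1 Hv1)
      have gH: "g (cdf_of h v) = 1 / h v" by (rule quantile_density_cdf[OF h v1(1)])
      have hv: "0 < h v" by (rule design_density_pos[OF h v1(1)])
      have cv: "0 < c v" "c v \<le> C" using c_pos[OF v1(1)] C(2)[OF v1(2)] by auto
      define R where "R = real n powr \<gamma> * residual n j x"
      have R0: "0 \<le> R" by (simp add: R_def)
      have \<psi>2: "(\<psi> v)\<^sup>2 = c v * g (cdf_of h v) powr \<Gamma>"
      proof -
        have "(h v powr (- \<gamma>))\<^sup>2 = h v powr (- \<Gamma>)" by (simp add: power2_eq_square powr_add[symmetric] \<Gamma>_def)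
        also have "\<dots> = (1 / h v) powr \<Gamma>" using hv by (simp add: powr_minus_divide powr_divide)
        finally show ?thesis unfolding gH \<psi>_def using cv by (simp add: power_mult_distrib)
      qed
      have "\<bar>(residual n j x)\<^sup>2 - w powr (2 * (real m + \<beta>)) * c v * (b x)\<^sup>2\<bar> \<le> ?h * (3 / 2 * \<epsilon>1 * w powr (2 * (real m + \<beta>)))"
      proof -
        have r: "residual n j x = qm_norm M (\<lambda>\<omega>. hermite_error k x (\<lambda>i s. w ^ i * D i (a + s * w) \<omega>))"
          using j by (simp add: residual_def w_def a_def)
        show ?thesis unfolding r fbm_residual_def
        proof (rule hermite_error_asymptotic[OF odd_k k2 k_le(2) jet_high_sub[OF w(2,1,4)] w(1) fbm_jet(1)[OF B \<beta>(1)] fbm_jet(2)[OF B \<beta>(1)]])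
          fix s t assume "s \<in> {a..a + w}" "t \<in> {a..a + w}"
          then show "\<bar>(qm_norm M (\<lambda>\<omega>. D m s \<omega> - D m t \<omega>))\<^sup>2 - c v * \<bar>s - t\<bar> powr (2 * \<beta>)\<bar> \<le> \<epsilon>1 * \<bar>s - t\<bar> powr (2 * \<beta>)"
            using w by (intro \<eta>(2)) auto
        qed (use \<epsilon>1 \<beta> x in auto)
      qed
      then have scaled: "(real n powr \<Gamma>) * \<bar>(residual n j x)\<^sup>2 - w powr \<Gamma> * c v * (b x)\<^sup>2\<bar> \<le> (real n powr \<Gamma>) * (?h * (3 / 2 * \<epsilon>1 * w powr \<Gamma>))"
        unfolding \<Gamma>_def \<gamma>_def by (intro mult_left_mono) auto
      have nw: "real n powr \<Gamma> * w powr \<Gamma> = g \<xi> powr \<Gamma>"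
        using w \<xi>(2) by (simp add: powr_mult[symmetric])
      have "R\<^sup>2 = real n powr \<Gamma> * (residual n j x)\<^sup>2"
        by (simp add: R_def \<Gamma>_def power_mult_distrib power2_eq_square powr_add[symmetric])
      then have "R\<^sup>2 - g \<xi> powr \<Gamma> * c v * (b x)\<^sup>2 = real n powr \<Gamma> * ((residual n j x)\<^sup>2 - w powr \<Gamma> * c v * (b x)\<^sup>2)"
        unfolding nw[symmetric] by (simp add: algebra_simps)
      then have "\<bar>R\<^sup>2 - g \<xi> powr \<Gamma> * c v * (b x)\<^sup>2\<bar> = real n powr \<Gamma> * \<bar>(residual n j x)\<^sup>2 - w powr \<Gamma> * c v * (b x)\<^sup>2\<bar>"
        by (simp add: abs_mult)
      also note scaled
      also have "real n powr \<Gamma> * (?h * (3 / 2 * \<epsilon>1 * w powr \<Gamma>)) = ?h * (3 / 2 * \<epsilon>1 * g \<xi> powr \<Gamma>)"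
        unfolding nw[symmetric] by simp
      also have "\<dots> \<le> ?h * (3 / 2 * \<epsilon>1 * G)"
        using hb \<epsilon>1(1) G(2)[OF \<xi>1] by (intro mult_left_mono) auto
      finally have 1: "\<bar>R\<^sup>2 - g \<xi> powr \<Gamma> * c v * (b x)\<^sup>2\<bar> \<le> \<epsilon>\<^sup>2 / 2" unfolding \<epsilon>1(2) .
      have "\<bar>g \<xi> powr \<Gamma> * c v * (b x)\<^sup>2 - (\<psi> v * b x)\<^sup>2\<bar> = \<bar>g \<xi> powr \<Gamma> - g (cdf_of h v) powr \<Gamma>\<bar> * (c v * (b x)\<^sup>2)"
      proof -
        have "g \<xi> powr \<Gamma> * c v * (b x)\<^sup>2 - (\<psi> v * b x)\<^sup>2 = (g \<xi> powr \<Gamma> - g (cdf_of h v) powr \<Gamma>) * (c v * (b x)\<^sup>2)"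
          unfolding power_mult_distrib \<psi>2 by (simp add: algebra_simps)
        then show ?thesis using cv by (simp add: abs_mult)
      qed
      also have "\<dots> \<le> \<epsilon>2 * (C * b0\<^sup>2)"
        using gg cv b0(2)[OF x] \<epsilon>2(1) by (intro mult_mono power_mono) auto
      finally have 2: "\<bar>g \<xi> powr \<Gamma> * c v * (b x)\<^sup>2 - (\<psi> v * b x)\<^sup>2\<bar> \<le> \<epsilon>\<^sup>2 / 2" unfolding \<epsilon>2(2) .
      have le: "\<bar>R\<^sup>2 - (\<psi> v * b x)\<^sup>2\<bar> \<le> \<epsilon>\<^sup>2" using 1 2 by linarith
      have P0: "0 \<le> \<psi> v * b x" using cv by (auto simp: \<psi>_def intro!: mult_nonneg_nonneg)
      have "\<bar>R - \<psi> v * b x\<bar>\<^sup>2 \<le> \<bar>R - \<psi> v * b x\<bar> * (R + \<psi> v * b x)"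
        unfolding power2_eq_square using R0 P0 by (intro mult_left_mono) auto
      also have "\<dots> = \<bar>R\<^sup>2 - (\<psi> v * b x)\<^sup>2\<bar>"
        using R0 P0 by (simp add: power2_eq_square square_diff_square_factored abs_mult)
      finally have "\<bar>R - \<psi> v * b x\<bar>\<^sup>2 \<le> \<epsilon>\<^sup>2" using le by simp
      then have "\<bar>R - \<psi> v * b x\<bar> \<le> \<epsilon>" by (rule power2_le_imp_le) (use \<epsilon> in simp)
      then show "\<bar>real n powr \<gamma> * residual n j x - \<psi> v * b x\<bar> \<le> \<epsilon>" by (simp only: R_def)
    qed
  qed
qed

lemma spline_error_eq_residual:
  assumes j: "1 \<le> j" "j \<le> n" and t: "t \<le> T n j" "T n (j - 1) < t \<or> j = 1 \<and> t = 0"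
  shows "spline_error n t = residual n j ((t - T n (j - 1)) / width n j)"
proof -
  have n: "1 \<le> n" using j by simp
  note kn = qRS_knots[OF h T n]
  have least: "(LEAST i. 1 \<le> i \<and> t \<le> T n i) = j"
  proof (rule Least_equality)
    fix i assume i: "1 \<le> i \<and> t \<le> T n i"
    show "j \<le> i"
    proof (rule ccontr)
      assume "\<not> j \<le> i"
      then have "i \<le> j - 1" "j \<noteq> 1" using i by auto
      then have "i = j - 1 \<or> i < j - 1" "j - 1 \<le> n" using j by auto
      then have "T n i \<le> T n (j - 1)" using kn(3)[of i "j - 1"] by (elim disjE) (simp_all add: less_imp_le)
      with i t \<open>j \<noteq> 1\<close> show False by auto
    qed
  qed (use j t in auto)
  note w = width[OF j]
  define x where "x = (t - T n (j - 1)) / width n j"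
  have tx: "t = T n (j - 1) + x * width n j" using w(1) by (simp add: x_def)
  have "spline_error n t = qm_norm M (\<lambda>\<omega>. X t \<omega> - hermite M (if j = 1 then q else k) (T n (j - 1)) (T n j) X t \<omega>)"
    unfolding spline_error_def composite_hermite_def Let_def least ..
  also have "\<dots> = residual n j x"
    unfolding residual_def tx w(2)[symmetric]
    by (subst hermite_residual) (use odd_q odd_k w(1) in auto)
  finally show ?thesis by (simp add: x_def)
qed

end

section \<open>The knot intervals near zero\<close>

context composite_hermite_spline
begin

text \<open>
  The index of the knot interval \<open>(t\<^sub>j\<^sub>-\<^sub>1, t\<^sub>j]\<close> containing \<open>t\<close>.
\<close>

definition idx :: "nat \<Rightarrow> real \<Rightarrow> nat" where "idx n t = nat \<lceil>real n * cdf_of h t\<rceil>"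

lemma idx:
  assumes t: "t \<in> {0<..1}" and n: "1 \<le> n"
  shows "1 \<le> idx n t" "idx n t \<le> n" "T n (idx n t - 1) < t" "t \<le> T n (idx n t)"
proof -
  note kn = qRS_knots[OF h T n]
  have H: "0 < cdf_of h t" "cdf_of h t \<le> 1" using cdf_of_pos[OF h t] cdf_of_in[OF h, of t] t by auto
  have p: "0 < real n * cdf_of h t" using H n by simp
  then have c: "0 < \<lceil>real n * cdf_of h t\<rceil>" by simp
  have r: "real (idx n t) = of_int \<lceil>real n * cdf_of h t\<rceil>" using c by (simp add: idx_def)
  have "0 < idx n t" using c by (simp only: idx_def zero_less_nat_eq)
  then show i1: "1 \<le> idx n t" by simp
  have "real n * cdf_of h t \<le> real n" using H by (simp add: mult_left_le)
  then show i2: "idx n t \<le> n" by (simp add: idx_def ceiling_le_iff nat_le_iff)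
  have "real n * cdf_of h t \<le> real (idx n t)" unfolding r by (rule le_of_int_ceiling)
  then have "cdf_of h t \<le> real (idx n t) / real n" using n by (simp add: pos_le_divide_eq mult.commute)
  then have "cdf_of h t \<le> cdf_of h (T n (idx n t))" by (simp only: kn(5)[OF i2])
  then show "t \<le> T n (idx n t)" using t kn(4)[OF i2] by (subst (asm) cdf_of_le_iff[OF h]) auto
  have i3: "idx n t - 1 \<le> n" using i2 by simp
  have "real (idx n t) - 1 < real n * cdf_of h t" unfolding r by linarith
  then have "real (idx n t - 1) < real n * cdf_of h t" using i1 by (simp add: of_nat_diff)
  then have "real (idx n t - 1) / real n < cdf_of h t" using n by (simp add: pos_divide_less_eq mult.commute)
  then have "cdf_of h (T n (idx n t - 1)) < cdf_of h t" by (simp only: kn(5)[OF i3])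
  then show "T n (idx n t - 1) < t" using t kn(4)[OF i3] by (subst (asm) cdf_of_less_iff[OF h]) auto
qed

lemma idx_eqI:
  assumes "1 \<le> j" "j \<le> n" "T n (j - 1) < t" "t \<le> T n j"
  shows "idx n t = j"
proof -
  have n: "1 \<le> n" using assms by simp
  note kn = qRS_knots[OF h T n]
  have "j - 1 \<le> n" using assms by simp
  then have t: "t \<in> {0<..1}" using assms(3,4) kn(4)[of "j - 1"] kn(4)[OF assms(2)] by auto
  note i = idx[OF t n]
  have "\<not> idx n t < j"
  proof
    assume "idx n t < j"
    then have "idx n t = j - 1 \<or> idx n t < j - 1" "j - 1 \<le> n" using assms by auto
    then have "T n (idx n t) \<le> T n (j - 1)" using kn(3)[of "idx n t" "j - 1"] by (elim disjE) (simp_all add: less_imp_le)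
    with i assms show False by simp
  qed
  moreover have "\<not> j < idx n t"
  proof
    assume "j < idx n t"
    then have "j = idx n t - 1 \<or> j < idx n t - 1" "idx n t - 1 \<le> n" using i by auto
    then have "T n j \<le> T n (idx n t - 1)" using kn(3)[of j "idx n t - 1"] by (elim disjE) (simp_all add: less_imp_le)
    with i assms show False by simp
  qed
  ultimately show ?thesis by simp
qed

lemma idx_eventually:
  assumes t: "t \<in> {0<..1}"
  shows "\<forall>\<^sub>F n in sequentially. 1 \<le> n \<and> 2 \<le> idx n t \<and> t / 2 \<le> T n (idx n t - 1)"
proof -
  have "0 < t / 2" using t by simp
  from mesh_small[OF this] eventually_ge_at_top[of 1] show ?thesis
  proof eventually_elim
    case (elim n)
    note i = idx[OF t elim(2)]
    have w: "T n (idx n t) - T n (idx n t - 1) < t / 2"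
      using elim(1) i by (auto simp: width_def)
    then have l: "t / 2 \<le> T n (idx n t - 1)" using i by linarith
    have "idx n t \<noteq> 1" using l t qRS_knots(1)[OF h T elim(2)] by auto
    with i l elim(2) show ?case by auto
  qed
qed

lemma residual_pointwise:
  assumes t: "t \<in> {0<..1}" and \<epsilon>: "0 < \<epsilon>"
  shows "\<forall>\<^sub>F n in sequentially. \<forall>x\<in>{0..1}. \<bar>real n powr \<gamma> * residual n (idx n t) x - \<psi> t * b x\<bar> \<le> \<epsilon>"
proof -
  have "0 < t / 2" "t / 2 \<le> 1" using t by auto
  from residual_local[OF this \<epsilon>] idx_eventually[OF t] show ?thesis
  proof eventually_elim
    case (elim n)
    then have n: "1 \<le> n" by simp
    note i = idx[OF t n]
    have "idx n t \<in> {2..n}" "t / 2 \<le> T n (idx n t - 1)" "t \<in> {T n (idx n t - 1)..T n (idx n t)}"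
      using elim(2) i by auto
    with elim(1) show ?case by blast
  qed
qed

text \<open>
  With \<open>lam = l + \<alpha> + p\<close> and \<open>\<sigma> = \<gamma> / lam\<close> the growth condition on \<open>r\<close> makes \<open>t\<^sub>1\<close> of smaller order than
  \<open>(1 / n) powr \<sigma>\<close>, and \<open>\<sigma> * lam = \<gamma>\<close>.  The summand \<open>p\<close> stands for the reciprocal of the exponent of
  the norm and accounts for the length of the interval.
\<close>

lemma first_interval_negligible:
  assumes p: "0 \<le> p" and a: "0 < a" and g_le: "\<And>s. s \<in> {0<..a} \<Longrightarrow> g s \<le> r s"
    and r: "r \<in> o[at_right 0](\<lambda>s. s powr (\<gamma> / (real l + \<alpha> + p) - 1))"
  shows "(\<lambda>n. real n powr \<gamma> * T n 1 powr (real l + \<alpha> + p)) \<longlonglongrightarrow> 0"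
proof (rule LIMSEQ_I)
  fix \<epsilon> :: real assume \<epsilon>: "0 < \<epsilon>"
  define lam where "lam = real l + \<alpha> + p"
  define \<sigma> where "\<sigma> = \<gamma> / lam"
  have lam: "0 < lam" using \<alpha> p by (simp add: lam_def)
  have \<sigma>: "0 < \<sigma>" "\<sigma> * lam = \<gamma>" using lam \<gamma>_pos by (auto simp: \<sigma>_def)
  \<comment> \<open>With this constant the bound for \<open>n powr \<gamma> * t\<^sub>1 powr lam\<close> is exactly \<open>\<epsilon> / 2\<close>.\<close>
  define e where "e = \<sigma> * (\<epsilon> / 2) powr (1 / lam)"
  have e: "0 < e" "e / \<sigma> = (\<epsilon> / 2) powr (1 / lam)" using \<sigma> \<epsilon> by (auto simp: e_def)
  have "\<forall>\<^sub>F s in at_right 0. norm (r s) \<le> e * norm (s powr (\<sigma> - 1))"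
    using landau_o.smallD[OF r e(1)] by (simp add: \<sigma>_def lam_def)
  then obtain d where d: "0 < d" "\<And>s. 0 < s \<Longrightarrow> s < d \<Longrightarrow> norm (r s) \<le> e * norm (s powr (\<sigma> - 1))"
    by (auto simp: eventually_at_right_field)
  define d' where "d' = min (d / 2) a"
  have d': "0 < d'" "d' < d" "d' \<le> a" using d a by (auto simp: d'_def)
  have bnd: "g s \<le> e * s powr (\<sigma> - 1)" if "0 < s" "s \<le> d'" "s \<le> 1" for s
    using g_le[of s] d(2)[of s] that d' by auto
  obtain n0 :: nat where n0: "1 / d' < real n0" using reals_Archimedean2 by blast
  show "\<exists>no. \<forall>n\<ge>no. norm (real n powr \<gamma> * T n 1 powr (real l + \<alpha> + p) - 0) < \<epsilon>"
  proof (intro exI allI impI)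
    fix n assume n: "max 1 n0 \<le> n"
    then have n1: "1 \<le> n" by simp
    note kn = qRS_knots[OF h T n1]
    have "1 / d' < real n" using n n0 by simp
    then have "1 / real n < d'" using d' n1 by (simp add: field_simps)
    have H: "cdf_of h (T n 1) = 1 / real n" using kn(5)[OF n1] by simp
    have t: "0 < T n 1" "T n 1 \<le> 1" using kn(3)[of 0 1] kn(4)[OF n1] kn(1) n1 by auto
    have "T n 1 \<le> e / \<sigma> * cdf_of h (T n 1) powr \<sigma>"
      by (rule cdf_of_power_bound[OF h \<sigma>(1) e(1) bnd t]) (use H \<open>1 / real n < d'\<close> in auto)
    then have "T n 1 powr lam \<le> (e / \<sigma> * (1 / real n) powr \<sigma>) powr lam"
      unfolding H using t lam by (intro powr_mono2) auto
    also have "\<dots> = (e / \<sigma>) powr lam * (1 / real n) powr \<gamma>"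
      using e \<sigma> by (simp add: powr_mult powr_powr)
    also have "(e / \<sigma>) powr lam = \<epsilon> / 2" unfolding e(2) using lam \<epsilon> by (simp add: powr_powr)
    finally have "real n powr \<gamma> * T n 1 powr lam \<le> real n powr \<gamma> * (\<epsilon> / 2 * (1 / real n) powr \<gamma>)"
      by (intro mult_left_mono) auto
    also have "\<dots> = \<epsilon> / 2" using n1 by (simp add: powr_divide)
    finally show "norm (real n powr \<gamma> * T n 1 powr (real l + \<alpha> + p) - 0) < \<epsilon>"
      using \<epsilon> by (simp add: lam_def)
  qed
qed

text \<open>
  This fails for \<open>j = 1\<close>, the reason why the first interval is treated separately.
\<close>

lemma half_double:
  assumes j: "2 \<le> j" "j \<le> n" and s: "s \<in> {real (j - 1) / real n..real j / real n}"
    and u: "u \<in> {real (j - 1) / real n..real j / real n}"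
  shows "u \<in> {s / 2..2 * s}" "0 < s" "s \<le> 1"
proof -
  have "real j \<le> 2 * real (j - 1)" using j by (simp add: of_nat_diff)
  then have "real j / real n \<le> 2 * (real (j - 1) / real n)" using j by (simp add: field_simps)
  moreover have "0 < real (j - 1) / real n" using j by simp
  moreover have "real j / real n \<le> 1" using j by (simp add: divide_le_eq_1)
  ultimately show "u \<in> {s / 2..2 * s}" "0 < s" "s \<le> 1"
    using s u unfolding atLeastAtMost_iff by linarith+
qed

lemma cdf_between:
  assumes j: "1 \<le> j" "j \<le> n" and v: "v \<in> {T n (j - 1)..T n j}"
  shows "v \<in> {0..1}" "cdf_of h v \<in> {real (j - 1) / real n..real j / real n}"
proof -
  have n: "1 \<le> n" "j - 1 \<le> n" using j by auto
  note kn = qRS_knots[OF h T n(1)]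
  show v1: "v \<in> {0..1}" using v kn(4)[OF n(2)] kn(4)[OF j(2)] by auto
  have "cdf_of h (T n (j - 1)) \<le> cdf_of h v" "cdf_of h v \<le> cdf_of h (T n j)"
    using v v1 kn(4)[OF n(2)] kn(4)[OF j(2)] by (auto simp: cdf_of_le_iff[OF h])
  then show "cdf_of h v \<in> {real (j - 1) / real n..real j / real n}"
    using kn(5)[OF n(2)] kn(5)[OF j(2)] by simp
qed

text \<open>
  Only the argument of \<open>g\<close> is moved; \<open>V\<close> and \<open>r \<circ> H\<close> are evaluated at the same point \<open>v\<close>, where their
  product is small by hypothesis.
\<close>

lemma residual_tail_uniform:
  assumes a: "0 < a" "a \<le> 1" and r: "regularly_varying_0 r \<rho>" and g_le: "\<And>s. s \<in> {0<..a} \<Longrightarrow> g s \<le> r s"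
    and lim: "((\<lambda>t. sqrt (V t) * r (cdf_of h t) powr \<gamma>) \<longlongrightarrow> 0) (at_right 0)" and \<epsilon>: "0 < \<epsilon>"
  shows "\<exists>s0>0. \<forall>n. \<forall>j\<in>{2..n}. real j / real n < s0 \<longrightarrow> (\<forall>x\<in>{0..1}. real n powr \<gamma> * residual n j x \<le> \<epsilon>)"
proof -
  have "continuous_on {0<..a} g" using quantile_density_continuous[OF h] by (rule continuous_on_subset) (use a in auto)
  then obtain C s1 where C: "0 < C" "0 < s1" "\<And>s. 0 < s \<Longrightarrow> s < s1 \<Longrightarrow> 0 < r s"
      "\<And>s x. 0 < s \<Longrightarrow> s < s1 \<Longrightarrow> x \<in> {s / 2..2 * s} \<Longrightarrow> g x \<le> C * r s"
    using regularly_varying_0_majorant_bound[OF r a(1) _ g_le] by blast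
  let ?h = "sqrt (hermite_bound k)"
  have hb: "0 < ?h" using hermite_bound(1)[OF odd_k] by simp
  define e where "e = \<epsilon> / (?h * C powr \<gamma>)"
  have e: "0 < e" "?h * C powr \<gamma> * e = \<epsilon>" using hb C(1) \<epsilon> by (auto simp: e_def)
  have "\<forall>\<^sub>F t in at_right 0. sqrt (V t) * r (cdf_of h t) powr \<gamma> < e"
    using lim e(1) by (rule order_tendstoD)
  then obtain d where d: "0 < d" "\<And>t. 0 < t \<Longrightarrow> t < d \<Longrightarrow> sqrt (V t) * r (cdf_of h t) powr \<gamma> < e"
    by (auto simp: eventually_at_right_field)
  define d' where "d' = min d 1"
  have d': "d' \<in> {0<..1}" "d' \<le> d" using d by (auto simp: d'_def)
  define s0 where "s0 = min s1 (cdf_of h d')"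
  have s0: "0 < s0" using C(2) cdf_of_pos[OF h d'(1)] by (simp add: s0_def)
  have "real n powr \<gamma> * residual n j x \<le> \<epsilon>" if j: "2 \<le> j" "j \<le> n" and js: "real j / real n < s0" and x: "x \<in> {0..1}" for n j x
  proof -
    obtain v \<xi> where v: "v \<in> {T n (j - 1)..T n j}" and \<xi>: "\<xi> \<in> {real (j - 1) / real n..real j / real n}"
      and le: "real n powr \<gamma> * residual n j x \<le> ?h * (sqrt (V v) * g \<xi> powr \<gamma>)"
      using residual_dominated[OF j x] by blast
    have j1: "1 \<le> j" using j by simp
    note cv = cdf_between[OF j1 j(2) v]
    note hd = half_double[OF j cv(2) \<xi>]
    have sv: "cdf_of h v < s1" "cdf_of h v < cdf_of h d'" using cv(2) js by (auto simp: s0_def)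
    then have "v < d'" using cdf_of_less_iff[OF h cv(1), of d'] sv(2) d'(1) by auto
    have v0: "0 < v" using hd(2) cv(1) cdf_of_0[OF h] by (cases "v = 0") auto
    have "0 \<le> g \<xi>" using hd(1,3) \<xi> j by (intro g_nonneg) (auto intro: order_trans simp: divide_le_eq_1)
    then have "g \<xi> powr \<gamma> \<le> (C * r (cdf_of h v)) powr \<gamma>"
      using C(4)[OF hd(2) sv(1) hd(1)] \<gamma>_pos by (intro powr_mono2) auto
    also have "\<dots> = C powr \<gamma> * r (cdf_of h v) powr \<gamma>" using C(1) C(3)[OF hd(2) sv(1)] by (simp add: powr_mult)
    finally have "?h * (sqrt (V v) * g \<xi> powr \<gamma>) \<le> ?h * (sqrt (V v) * (C powr \<gamma> * r (cdf_of h v) powr \<gamma>))"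
      using hb V_pos[of v] v0 cv(1) by (intro mult_left_mono) auto
    also have "\<dots> = ?h * C powr \<gamma> * (sqrt (V v) * r (cdf_of h v) powr \<gamma>)" by simp
    also have "\<dots> \<le> ?h * C powr \<gamma> * e"
      using d(2)[of v] v0 \<open>v < d'\<close> d' hb by (intro mult_left_mono) auto
    finally show ?thesis using le e(2) by simp
  qed
  with s0 show ?thesis by auto
qed

end

section \<open>The uniform norm\<close>

lemma tendsto_ennreal_sandwich:
  assumes "0 \<le> \<Lambda>"
    and "\<And>\<epsilon>. 0 < \<epsilon> \<Longrightarrow> \<forall>\<^sub>F n in F. ennreal (\<Lambda> - \<epsilon>) \<le> f n \<and> f n \<le> ennreal (\<Lambda> + \<epsilon>)"
  shows "(f \<longlongrightarrow> ennreal \<Lambda>) F"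
proof -
  have fin: "\<forall>\<^sub>F n in F. ennreal (enn2real (f n)) = f n"
    using assms(2)[of 1, simplified]
  proof eventually_elim
    case (elim n)
    then have "f n < \<top>" by (blast intro: le_less_trans ennreal_less_top)
    then show ?case by (simp add: ennreal_enn2real)
  qed
  have "((\<lambda>n. enn2real (f n)) \<longlongrightarrow> \<Lambda>) F"
  proof (rule tendstoI)
    fix e :: real assume e: "0 < e"
    then have "\<forall>\<^sub>F n in F. ennreal (\<Lambda> - e / 2) \<le> f n \<and> f n \<le> ennreal (\<Lambda> + e / 2)"
      by (intro assms(2)) simp
    with fin show "\<forall>\<^sub>F n in F. dist (enn2real (f n)) \<Lambda> < e"
    proof eventually_elim
      case (elim n)
      have "ennreal (\<Lambda> - e / 2) \<le> ennreal (enn2real (f n))" "ennreal (enn2real (f n)) \<le> ennreal (\<Lambda> + e / 2)"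
        using elim by simp_all
      moreover have "0 \<le> enn2real (f n)" "0 \<le> \<Lambda> + e / 2" using assms(1) e by auto
      ultimately have "\<Lambda> - e / 2 \<le> enn2real (f n)" "enn2real (f n) \<le> \<Lambda> + e / 2"
        by (blast intro: iffD1[OF ennreal_le_iff])+
      then show ?case using e by (simp add: dist_real_def abs_less_iff)
    qed
  qed
  then have "((\<lambda>n. ennreal (enn2real (f n))) \<longlongrightarrow> ennreal \<Lambda>) F" by (rule tendsto_ennrealI)
  then show ?thesis by (rule Lim_transform_eventually[OF _ fin])
qed

context composite_hermite_spline
begin

lemma \<psi>_pos: "t \<in> {0<..1} \<Longrightarrow> 0 < \<psi> t"
  using c_pos[of t] design_density_pos[OF h, of t] by (simp add: \<psi>_def)

lemma \<psi>_cont: "continuous_on {0<..1} \<psi>"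
proof -
  have "h t \<noteq> 0" if "t \<in> {0<..1}" for t using design_density_pos[OF h that] by simp
  then show ?thesis unfolding \<psi>_def[abs_def]
    by (intro continuous_intros c_cont design_density_cont[OF h]) auto
qed

text \<open>
  The left node is interpolated.
\<close>

lemma hermite_error_0: "odd k' \<Longrightarrow> hermite_error k' 0 \<phi> = 0"
proof -
  assume k': "odd k'"
  have "poly ((pderiv ^^ 0) (hermite_poly k' 0 1 (\<lambda>i. \<phi> i 0) (\<lambda>i. \<phi> i 1))) 0 = \<phi> 0 0"
    using k' by (intro hermite_poly_props) auto
  then show ?thesis unfolding hermite_poly_unit[OF k'] by (simp add: hermite_error_def poly_sum)
qed

lemma b_0: "b 0 = 0"
  by (simp add: fbm_residual_def hermite_error_0[OF odd_k])

lemma spline_error_cases: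
  assumes n: "1 \<le> n" and t: "t \<in> {0..1}"
  shows "\<exists>j\<in>{1..n}. \<exists>x\<in>{0..1}. spline_error n t = residual n j x"
proof -
  define j where "j = (if t = 0 then 1 else idx n t)"
  have j: "1 \<le> j" "j \<le> n" and t': "t \<le> T n j" "T n (j - 1) < t \<or> j = 1 \<and> t = 0"
    using idx[of t n] n t qRS_knots(4)[OF h T n n] by (auto simp: j_def less_le)
  have "T n (j - 1) \<le> t" using t' qRS_knots(1)[OF h T n] by auto
  then have "(t - T n (j - 1)) / width n j \<in> {0..1}"
    using t'(1) width(1)[OF j] by (auto simp: divide_le_eq_1 width_def)
  moreover have "j \<in> {1..n}" using j by simp
  ultimately show ?thesis using spline_error_eq_residual[OF j t'] by blast
qed

text \<open>
  The limit \<open>\<Lambda>\<close> is the product of the maxima of \<open>b\<close> and \<open>\<psi>\<close>.  That \<open>\<psi>\<close> attains its supremum follows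
  from the tail bound, which passes from the residuals to their limit \<open>\<psi> t * b x\<close>.
\<close>

lemma uniform_limit_of_error:
  assumes first: "(\<lambda>n. real n powr \<gamma> * T n 1 powr (real l + \<alpha>)) \<longlonglongrightarrow> 0"
    and tail: "\<And>\<epsilon>. 0 < \<epsilon> \<Longrightarrow> \<exists>s0>0. \<forall>n. \<forall>j\<in>{2..n}. real j / real n < s0 \<longrightarrow>
        (\<forall>x\<in>{0..1}. real n powr \<gamma> * residual n j x \<le> \<epsilon>)"
  defines "L \<equiv> (SUP x\<in>{0..1}. ennreal \<bar>b x\<bar>) * (SUP t\<in>{0<..1}. ennreal \<bar>\<psi> t\<bar>)"
  shows "(\<lambda>n. ennreal (real n powr \<gamma>) * (SUP t\<in>{0..1}. ennreal \<bar>spline_error n t\<bar>)) \<longlonglongrightarrow> L"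
    "0 < L" "L < \<infinity>"
proof -
  obtain x0 where x0: "x0 \<in> {0..1}" "\<And>x. x \<in> {0..1} \<Longrightarrow> b x \<le> b x0"
    using continuous_attains_sup[of "{0..1}" b] fbm_residual_continuous[OF B \<beta>(1) k2] by auto
  have bx0: "0 < b x0"
    using fbm_residual_nontrivial[OF B \<beta> k2] x0(2) by (meson less_le_trans)
  have \<psi>_tail: "\<exists>s0>0. \<forall>t\<in>{0<..1}. cdf_of h t < s0 / 2 \<longrightarrow> \<psi> t * b x0 \<le> e" if e: "0 < e" for e
  proof -
    obtain s0 where s0: "0 < s0" and tl: "\<And>n j x. j \<in> {2..n} \<Longrightarrow> real j / real n < s0 \<Longrightarrow> x \<in> {0..1} \<Longrightarrow> real n powr \<gamma> * residual n j x \<le> e / 2"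
      using tail[of "e / 2"] e by auto
    have "\<psi> t * b x0 \<le> e" if t: "t \<in> {0<..1}" and Ht: "cdf_of h t < s0 / 2" for t
    proof -
      have "\<forall>\<^sub>F n in sequentially. 2 / s0 < real n" by real_asymp
      moreover have "\<forall>\<^sub>F n in sequentially. \<forall>x\<in>{0..1}. \<bar>real n powr \<gamma> * residual n (idx n t) x - \<psi> t * b x\<bar> \<le> e / 2"
        using e by (intro residual_pointwise t) simp
      ultimately have "\<forall>\<^sub>F n in sequentially. \<psi> t * b x0 \<le> e"
        using idx_eventually[OF t]
      proof eventually_elim
        case (elim n)
        then have n: "1 \<le> n" by simp
        note i = idx[OF t n]
        have "real (idx n t - 1) / real n \<le> cdf_of h t"
        proof -
          have "idx n t - 1 \<le> n" using i by simp
          from qRS_knots(4,5)[OF h T n this] have "T n (idx n t - 1) \<in> {0..1}"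
            "cdf_of h (T n (idx n t - 1)) = real (idx n t - 1) / real n" by auto
          moreover have "cdf_of h (T n (idx n t - 1)) \<le> cdf_of h t"
            using cdf_of_le_iff[OF h calculation(1), of t] i t by auto
          ultimately show ?thesis by simp
        qed
        moreover have "real (idx n t) / real n = real (idx n t - 1) / real n + 1 / real n"
          using i(1) by (simp add: of_nat_diff add_divide_distrib[symmetric])
        moreover have "1 / real n < s0 / 2" using elim(1) s0 n by (simp add: field_simps)
        ultimately have "real (idx n t) / real n < s0" using Ht by linarith
        then have "real n powr \<gamma> * residual n (idx n t) x0 \<le> e / 2"
          using elim(3) i x0(1) by (intro tl) auto
        with elim(2) x0(1) have "\<bar>real n powr \<gamma> * residual n (idx n t) x0 - \<psi> t * b x0\<bar> \<le> e / 2"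
            "real n powr \<gamma> * residual n (idx n t) x0 \<le> e / 2" by auto
        then show ?case by linarith
      qed
      then show ?thesis by simp
    qed
    with s0 show ?thesis by blast
  qed
  obtain t0 where t0: "t0 \<in> {0<..1}" "\<And>t. t \<in> {0<..1} \<Longrightarrow> \<psi> t \<le> \<psi> t0"
  proof -
    have "0 < \<psi> 1 * b x0" using \<psi>_pos[of 1] bx0 by simp
    from \<psi>_tail[OF this] obtain s0 where s0: "0 < s0" "\<And>t. t \<in> {0<..1} \<Longrightarrow> cdf_of h t < s0 / 2 \<Longrightarrow> \<psi> t * b x0 \<le> \<psi> 1 * b x0"
      by blast
    define d where "d = quantile_of h (min (s0 / 2) 1)"
    have d: "d \<in> {0<..1}" "cdf_of h d \<le> s0 / 2"
      using quantile_of_pos[OF h, of "min (s0 / 2) 1"] cdf_of_quantile[OF h, of "min (s0 / 2) 1"] s0 by (auto simp: d_def)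
    have "continuous_on {d..1} \<psi>" using \<psi>_cont by (rule continuous_on_subset) (use d in auto)
    then obtain t0 where t0: "t0 \<in> {d..1}" "\<And>t. t \<in> {d..1} \<Longrightarrow> \<psi> t \<le> \<psi> t0"
      using continuous_attains_sup[of "{d..1}" \<psi>] d by auto
    have "\<psi> t \<le> \<psi> t0" if t: "t \<in> {0<..1}" for t
    proof (cases "t < d")
      case True
      have "cdf_of h t < cdf_of h d" using True t d by (intro cdf_of_less[OF h]) auto
      then have "\<psi> t * b x0 \<le> \<psi> 1 * b x0" using d t by (intro s0) auto
      then have "\<psi> t \<le> \<psi> 1" using bx0 by simp
      also have "\<dots> \<le> \<psi> t0" using d by (intro t0) auto
      finally show ?thesis .
    qed (use t t0 in auto)
    then show ?thesis using t0(1) d by (intro that[of t0]) auto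
  qed
  define \<Lambda> where "\<Lambda> = b x0 * \<psi> t0"
  have \<Lambda>: "0 < \<Lambda>" using bx0 \<psi>_pos[OF t0(1)] by (simp add: \<Lambda>_def)
  have "(SUP x\<in>{0..1}. ennreal \<bar>b x\<bar>) = ennreal (b x0)"
    using x0 by (intro antisym SUP_least SUP_upper2[of x0]) (auto intro!: ennreal_leI)
  moreover have "(SUP t\<in>{0<..1}. ennreal \<bar>\<psi> t\<bar>) = ennreal (\<psi> t0)"
  proof (intro antisym SUP_least)
    show "ennreal \<bar>\<psi> t\<bar> \<le> ennreal (\<psi> t0)" if "t \<in> {0<..1}" for t
      using \<psi>_pos[OF that] t0(2)[OF that] by (intro ennreal_leI) auto
    show "ennreal (\<psi> t0) \<le> (SUP t\<in>{0<..1}. ennreal \<bar>\<psi> t\<bar>)"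
      using t0(1) \<psi>_pos[OF t0(1)] by (intro SUP_upper2[of t0]) auto
  qed
  ultimately have L: "L = ennreal \<Lambda>"
    unfolding L_def \<Lambda>_def using bx0 \<psi>_pos[OF t0(1)] by (simp add: ennreal_mult)
  show "0 < L" "L < \<infinity>" using \<Lambda> by (simp_all add: L)
  have lim: "(\<lambda>n. ennreal (real n powr \<gamma>) * (SUP t\<in>{0..1}. ennreal \<bar>spline_error n t\<bar>)) \<longlonglongrightarrow> ennreal \<Lambda>"
  proof (rule tendsto_ennreal_sandwich)
    fix \<epsilon> :: real assume \<epsilon>: "0 < \<epsilon>"
    obtain s0 where s0: "0 < s0" and tl: "\<And>n j x. j \<in> {2..n} \<Longrightarrow> real j / real n < s0 \<Longrightarrow> x \<in> {0..1} \<Longrightarrow> real n powr \<gamma> * residual n j x \<le> \<epsilon>"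
      using tail[OF \<epsilon>] by auto
    \<comment> \<open>An interval with \<open>j / n \<ge> s0\<close> has \<open>(j - 1) / n \<ge> s0 / 2\<close> and therefore lies in \<open>[d, 1]\<close>.\<close>
    define d where "d = quantile_of h (min (s0 / 2) 1)"
    have d: "d \<in> {0<..1}" "cdf_of h d \<le> s0 / 2"
      using quantile_of_pos[OF h, of "min (s0 / 2) 1"] cdf_of_quantile[OF h, of "min (s0 / 2) 1"] s0 by (auto simp: d_def)
    let ?c = "sqrt (hermite_bound q) * sqrt K"
    have "(\<lambda>n. ?c * (real n powr \<gamma> * T n 1 powr (real l + \<alpha>))) \<longlonglongrightarrow> ?c * 0"
      by (intro tendsto_mult tendsto_const first)
    then have "\<forall>\<^sub>F n in sequentially. ?c * (real n powr \<gamma> * T n 1 powr (real l + \<alpha>)) < \<epsilon>"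
      using \<epsilon> by (intro order_tendstoD) auto
    moreover have "\<forall>\<^sub>F n in sequentially. \<forall>j\<in>{2..n}. d \<le> T n (j - 1) \<longrightarrow>
      (\<forall>v\<in>{T n (j - 1)..T n j}. \<forall>x\<in>{0..1}. \<bar>real n powr \<gamma> * residual n j x - \<psi> v * b x\<bar> \<le> \<epsilon>)"
      using d \<epsilon> by (intro residual_local) auto
    ultimately show "\<forall>\<^sub>F n in sequentially. ennreal (\<Lambda> - \<epsilon>) \<le> ennreal (real n powr \<gamma>) * (SUP t\<in>{0..1}. ennreal \<bar>spline_error n t\<bar>)
      \<and> ennreal (real n powr \<gamma>) * (SUP t\<in>{0..1}. ennreal \<bar>spline_error n t\<bar>) \<le> ennreal (\<Lambda> + \<epsilon>)"
      using residual_pointwise[OF t0(1) \<epsilon>] eventually_ge_at_top[of 1]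
    proof eventually_elim
      case (elim n)
      note n = elim(4)
      have up: "real n powr \<gamma> * residual n j x \<le> \<Lambda> + \<epsilon>" if j: "j \<in> {1..n}" and x: "x \<in> {0..1}" for j x
      proof (cases "j = 1")
        case True
        have "real n powr \<gamma> * residual n j x \<le> real n powr \<gamma> * (sqrt (hermite_bound q) * (sqrt K * T n 1 powr (real l + \<alpha>)))"
          unfolding True by (intro mult_left_mono residual_first n x) auto
        also have "\<dots> \<le> \<epsilon>" using elim(1) by (simp add: mult_ac)
        finally show ?thesis using \<Lambda> by simp
      next
        case False
        then have j2: "j \<in> {2..n}" using j by auto
        show ?thesis
        proof (cases "real j / real n < s0")
          case True
          with tl[OF j2 True x] \<Lambda> show ?thesis by simp
        next
          case F: False
          have jn: "j - 1 \<le> n" "1 \<le> j" "j \<le> n" using j by auto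
          have "real j \<le> 2 * real (j - 1)" using j2 by (simp add: of_nat_diff)
          then have "real j / real n \<le> 2 * (real (j - 1) / real n)" using n by (simp add: field_simps)
          then have "cdf_of h d \<le> cdf_of h (T n (j - 1))"
            using F d(2) qRS_knots(5)[OF h T n jn(1)] by linarith
          then have dT: "d \<le> T n (j - 1)"
            using cdf_of_le_iff[OF h _ qRS_knots(4)[OF h T n jn(1)], of d] d(1) by auto
          note w = width[OF jn(2,3)]
          have v: "T n j \<in> {T n (j - 1)..T n j}" "T n j \<in> {0<..1}" using w dT d(1) by auto
          have "\<bar>real n powr \<gamma> * residual n j x - \<psi> (T n j) * b x\<bar> \<le> \<epsilon>"
            using elim(2) j2 dT v(1) x by blast
          moreover have "\<psi> (T n j) * b x \<le> \<psi> t0 * b x0"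
            using t0(2)[OF v(2)] x0(2)[OF x] \<psi>_pos[OF t0(1)] by (intro mult_mono) auto
          ultimately show ?thesis by (simp add: \<Lambda>_def mult.commute)
        qed
      qed
      have "ennreal (real n powr \<gamma>) * (SUP t\<in>{0..1}. ennreal \<bar>spline_error n t\<bar>)
        = (SUP t\<in>{0..1}. ennreal (real n powr \<gamma>) * ennreal \<bar>spline_error n t\<bar>)"
        by (simp add: SUP_mult_left_ennreal)
      also have "\<dots> = (SUP t\<in>{0..1}. ennreal (real n powr \<gamma> * spline_error n t))"
        by (intro SUP_cong refl) (simp add: ennreal_mult' spline_error_def)
      finally have S: "ennreal (real n powr \<gamma>) * (SUP t\<in>{0..1}. ennreal \<bar>spline_error n t\<bar>)
        = (SUP t\<in>{0..1}. ennreal (real n powr \<gamma> * spline_error n t))" .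
      have "(SUP t\<in>{0..1}. ennreal (real n powr \<gamma> * spline_error n t)) \<le> ennreal (\<Lambda> + \<epsilon>)"
      proof (rule SUP_least)
        fix t :: real assume "t \<in> {0..1}"
        with spline_error_cases[OF n] obtain j x where "j \<in> {1..n}" "x \<in> {0..1}" "spline_error n t = residual n j x" by blast
        then show "ennreal (real n powr \<gamma> * spline_error n t) \<le> ennreal (\<Lambda> + \<epsilon>)"
          using up by (auto intro!: ennreal_leI)
      qed
      moreover have "ennreal (\<Lambda> - \<epsilon>) \<le> (SUP t\<in>{0..1}. ennreal (real n powr \<gamma> * spline_error n t))"
      proof -
        note i = idx[OF t0(1) n]
        define j where "j = idx n t0"
        define t where "t = T n (j - 1) + x0 * width n j"
        note w = width[OF i(1,2), folded j_def]
        have "x0 \<noteq> 0" using bx0 b_0 by auto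
        then have "0 < x0 * width n j" "x0 * width n j \<le> width n j" using x0(1) w(1) by (auto simp: mult_left_le_one_le)
        then have t: "T n (j - 1) < t" "t \<le> T n j" unfolding t_def w(2)[symmetric] by auto
        have "spline_error n t = residual n j ((t - T n (j - 1)) / width n j)"
          using i(1,2) t by (intro spline_error_eq_residual) (auto simp: j_def)
        also have "(t - T n (j - 1)) / width n j = x0" using w(1) by (simp add: t_def)
        finally have "spline_error n t = residual n j x0" .
        moreover have "\<bar>real n powr \<gamma> * residual n j x0 - \<psi> t0 * b x0\<bar> \<le> \<epsilon>"
          using elim(3) x0(1) by (auto simp: j_def)
        ultimately have "\<Lambda> - \<epsilon> \<le> real n powr \<gamma> * spline_error n t"
          by (simp add: \<Lambda>_def mult.commute abs_le_iff)
        moreover have "t \<in> {0..1}" using t w by auto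
        ultimately show ?thesis by (intro SUP_upper2[of t] ennreal_leI)
      qed
      ultimately show ?case unfolding S by blast
    qed
  qed (use \<Lambda> in simp)
  then show "(\<lambda>n. ennreal (real n powr \<gamma>) * (SUP t\<in>{0..1}. ennreal \<bar>spline_error n t\<bar>)) \<longlonglongrightarrow> L" by (simp only: L)
qed

end

section \<open>Norms with finite exponent\<close>

text \<open>
  Half-open intervals are used so that the knot intervals partition \<open>(0, 1]\<close>.
\<close>

lemma nn_integral_rescaled_piece:
  fixes f :: "real \<Rightarrow> real"
  assumes f: "continuous_on {0..1} f" "\<And>x. x \<in> {0..1} \<Longrightarrow> 0 \<le> f x" and w: "0 < w"
  shows "(\<lambda>t. indicator {a<..a + w} t * f ((t - a) / w)) \<in> borel_measurable borel"
    and "(\<integral>\<^sup>+t. ennreal (indicator {a<..a + w} t * f ((t - a) / w)) \<partial>lborel) = ennreal (w * (LBINT x:{0..1}. f x))"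
proof -
  define G where "G x = indicator {0<..1} x * f x" for x :: real
  have "continuous_on {0<..1} f" using f(1) by (rule continuous_on_subset) auto
  then have G[measurable]: "G \<in> borel_measurable borel"
    using borel_measurable_continuous_on_indicator[of "{0<..1}" f] by (simp add: G_def[abs_def])
  have eq: "indicator {a<..a + w} t * f ((t - a) / w) = G ((t - a) / w)" for t
    using w by (auto simp: G_def indicator_def field_simps)
  show "(\<lambda>t. indicator {a<..a + w} t * f ((t - a) / w)) \<in> borel_measurable borel"
    unfolding eq by measurable
  have i: "set_integrable lborel {0..1} f" using f(1) by (rule borel_integrable_atLeastAtMost')
  have "(\<integral>\<^sup>+t. ennreal (G ((t - a) / w)) \<partial>lborel) = ennreal \<bar>w\<bar> * (\<integral>\<^sup>+x. ennreal (G ((a + w * x - a) / w)) \<partial>lborel)"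
    by (rule nn_integral_real_affine) (use w in auto)
  also have "(\<integral>\<^sup>+x. ennreal (G ((a + w * x - a) / w)) \<partial>lborel) = (\<integral>\<^sup>+x. ennreal (indicator {0..1} x * f x) \<partial>lborel)"
  proof (rule nn_integral_cong_AE)
    have "AE x in lborel. x \<noteq> (0::real)" by (rule AE_lborel_singleton)
    then show "AE x in lborel. ennreal (G ((a + w * x - a) / w)) = ennreal (indicator {0..1} x * f x)"
      by eventually_elim (use w in \<open>auto simp: G_def indicator_def\<close>)
  qed
  also have "\<dots> = ennreal (LBINT x:{0..1}. f x)"
    using i f(2) unfolding set_integrable_def set_lebesgue_integral_def
    by (subst nn_integral_eq_integral) (auto simp: indicator_def)
  finally show "(\<integral>\<^sup>+t. ennreal (indicator {a<..a + w} t * f ((t - a) / w)) \<partial>lborel) = ennreal (w * (LBINT x:{0..1}. f x))"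
    unfolding eq using w by (simp add: ennreal_mult')
qed

context composite_hermite_spline
begin

context
  fixes P :: real
  assumes P: "1 \<le> P"
begin

definition piece :: "nat \<Rightarrow> nat \<Rightarrow> real \<Rightarrow> real" where
  "piece n j x = (real n powr \<gamma> * residual n j x) powr P"

definition piece_integral :: "nat \<Rightarrow> nat \<Rightarrow> real" where
  "piece_integral n j = (LBINT x:{0..1}. piece n j x)"

text \<open>
  The integral of the \<open>P\<close>-th power of the scaled error over \<open>(t\<^sub>1, 1]\<close> equals the integral of this
  step function, whose value on a knot interval is the mean over that interval.  Averaging removes
  the oscillation of \<open>x\<close> with \<open>n\<close>, so the step functions converge pointwise.
\<close>

definition step :: "nat \<Rightarrow> real \<Rightarrow> real" where
  "step n t = indicator {0<..1} t * (if 2 \<le> idx n t then piece_integral n (idx n t) else 0)"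

definition limit_const :: real where "limit_const = (LBINT x:{0..1}. b x powr P)"

lemma piece_continuous: "1 \<le> j \<Longrightarrow> j \<le> n \<Longrightarrow> continuous_on {0..1} (piece n j)"
  unfolding piece_def[abs_def] using P
  by (intro continuous_on_powr' continuous_on_mult continuous_on_const residual_continuous) auto

lemma piece_nonneg [simp]: "0 \<le> piece n j x"
  by (simp add: piece_def)

lemma set_integral_unit_le:
  assumes f: "continuous_on {0..1} f" "\<And>x. x \<in> {0..1::real} \<Longrightarrow> f x \<le> (C::real)"
  shows "(LBINT x:{0..1}. f x) \<le> C"
proof -
  have "(LBINT x:{0..1}. f x) = integral {0..1} f" by (rule set_integral_continuous_real[OF f(1)])
  also have "\<dots> \<le> integral {0..1::real} (\<lambda>_. C)"
    by (rule Henstock_Kurzweil_Integration.integral_le)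
      (use f in \<open>auto intro: integrable_continuous_real\<close>)
  finally show ?thesis by simp
qed

lemma piece_integral_nonneg: "0 \<le> piece_integral n j"
  unfolding piece_integral_def set_lebesgue_integral_def by (intro integral_nonneg_AE) (auto simp: indicator_def)

lemma b_powr_continuous: "continuous_on {0..1} (\<lambda>x. b x powr P)"
  using fbm_residual_continuous[OF B \<beta>(1) k2] P by (intro continuous_on_powr') auto

lemma limit_const_pos: "0 < limit_const"
proof -
  have eq: "limit_const = integral {0..1} (\<lambda>x. b x powr P)"
    unfolding limit_const_def by (rule set_integral_continuous_real[OF b_powr_continuous])
  have "0 \<le> limit_const" unfolding eq
    by (intro Henstock_Kurzweil_Integration.integral_nonneg integrable_continuous_real b_powr_continuous) auto
  moreover have "limit_const \<noteq> 0"
  proof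
    assume "limit_const = 0"
    then have "\<forall>x\<in>{0..1}. b x powr P = 0"
      using integral_eq_0_iff[OF b_powr_continuous] by (simp add: eq)
    then show False using fbm_residual_nontrivial[OF B \<beta> k2] by force
  qed
  ultimately show ?thesis by simp
qed

lemma idx_iff:
  assumes n: "1 \<le> n" and t: "t \<in> {0<..1}" and j: "j \<in> {1..n}"
  shows "t \<in> {T n (j - 1)<..T n j} \<longleftrightarrow> j = idx n t"
proof
  assume "t \<in> {T n (j - 1)<..T n j}"
  then show "j = idx n t" using j by (intro idx_eqI[symmetric]) auto
next
  assume j: "j = idx n t"
  show "t \<in> {T n (j - 1)<..T n j}" unfolding j greaterThanAtMost_iff
    using idx(3,4)[OF t n] by blast
qed

lemma step_eq_sum:
  assumes n: "1 \<le> n"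
  shows "step n t = (\<Sum>j\<in>{2..n}. indicator {T n (j - 1)<..T n j} t * piece_integral n j)"
proof (cases "t \<in> {0<..1}")
  case True
  have "indicator {T n (j - 1)<..T n j} t = (if j = idx n t then 1 else 0 :: real)" if "j \<in> {2..n}" for j
    unfolding indicator_def using idx_iff[OF n True, of j] that by (simp only: atLeastAtMost_iff) auto
  then have "(\<Sum>j\<in>{2..n}. indicator {T n (j - 1)<..T n j} t * piece_integral n j)
    = (\<Sum>j\<in>{2..n}. if j = idx n t then piece_integral n j else 0)"
    by (intro sum.cong) auto
  also have "\<dots> = step n t" using True idx[OF True n] by (simp add: step_def)
  finally show ?thesis by simp
next
  case False
  have "t \<notin> {T n (j - 1)<..T n j}" if "j \<in> {2..n}" for j
    using False width(3,4)[of j n] that by auto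
  then show ?thesis using False by (simp add: step_def)
qed

lemma step_integral:
  assumes n: "1 \<le> n"
  shows "step n \<in> borel_measurable borel" "(\<integral>t. step n t \<partial>lborel) = (\<Sum>j\<in>{2..n}. width n j * piece_integral n j)"
proof -
  show "step n \<in> borel_measurable borel" unfolding step_eq_sum[OF n] by measurable
  have "(\<integral>t. step n t \<partial>lborel) = (\<Sum>j\<in>{2..n}. (\<integral>t. indicator {T n (j - 1)<..T n j} t * piece_integral n j \<partial>lborel))"
    unfolding step_eq_sum[OF n]
  proof (intro Bochner_Integration.integral_sum integrable_mult_left integrable_real_indicator)
    fix j assume "j \<in> {2..n}"
    then have "T n (j - 1) \<le> T n j" using width(1)[of j n] by (simp add: width_def)
    then show "emeasure lborel {T n (j - 1)<..T n j} < \<infinity>" by (simp only: emeasure_lborel_Ioc) simp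
  qed simp
  also have "\<dots> = (\<Sum>j\<in>{2..n}. width n j * piece_integral n j)"
  proof (rule sum.cong)
    fix j assume "j \<in> {2..n}"
    then have "T n (j - 1) \<le> T n j" using width(1)[of j n] by (simp add: width_def)
    then show "(\<integral>t. indicator {T n (j - 1)<..T n j} t * piece_integral n j \<partial>lborel) = width n j * piece_integral n j"
      by (simp add: width_def)
  qed simp
  finally show "(\<integral>t. step n t \<partial>lborel) = (\<Sum>j\<in>{2..n}. width n j * piece_integral n j)" .
qed

text \<open>
  Substitution on each knot interval; the point \<open>0\<close>, which lies in none of the half-open intervals, has
  measure \<open>0\<close>.
\<close>

lemma error_integral:
  assumes n: "1 \<le> n"
  shows "ennreal (real n powr (\<gamma> * P)) * (\<integral>\<^sup>+t\<in>{0..1}. ennreal (\<bar>spline_error n t\<bar> powr P) \<partial>lborel)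
    = ennreal (width n 1 * piece_integral n 1 + (\<integral>t. step n t \<partial>lborel))"
proof -
  define F where "F j t = indicator {T n (j - 1)<..T n j} t * piece n j ((t - T n (j - 1)) / width n j)" for j t
  have F: "F j \<in> borel_measurable borel" "(\<integral>\<^sup>+t. ennreal (F j t) \<partial>lborel) = ennreal (width n j * piece_integral n j)"
    if "j \<in> {1..n}" for j
  proof -
    have j: "1 \<le> j" "j \<le> n" using that by auto
    show "F j \<in> borel_measurable borel" "(\<integral>\<^sup>+t. ennreal (F j t) \<partial>lborel) = ennreal (width n j * piece_integral n j)"
      using nn_integral_rescaled_piece[OF piece_continuous[OF j] piece_nonneg width(1)[OF j], of "T n (j - 1)"]
      unfolding width(2)[OF j] F_def piece_integral_def by simp_all
  qed
  have eq: "ennreal (real n powr (\<gamma> * P)) * (ennreal (\<bar>spline_error n t\<bar> powr P) * indicator {0..1} t) = (\<Sum>j\<in>{1..n}. ennreal (F j t))"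
    if t0: "t \<noteq> 0" for t
  proof (cases "t \<in> {0<..1}")
    case True
    note i = idx[OF True n]
    have z: "ennreal (F j t) = (if j = idx n t then ennreal (F j t) else 0)" if "j \<in> {1..n}" for j
      unfolding F_def indicator_def using idx_iff[OF n True that] by (simp only: of_bool_def) simp
    have "(\<Sum>j\<in>{1..n}. ennreal (F j t)) = (\<Sum>j\<in>{1..n}. if j = idx n t then ennreal (F j t) else 0)"
      using z by (rule sum.cong[OF refl])
    also have "\<dots> = ennreal (F (idx n t) t)" using i by simp
    also have "F (idx n t) t = piece n (idx n t) ((t - T n (idx n t - 1)) / width n (idx n t))"
      using i by (simp add: F_def)
    also have "\<dots> = (real n powr \<gamma> * spline_error n t) powr P"
      using spline_error_eq_residual[OF i(1,2,4)] i(3) by (simp add: piece_def)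
    also have "\<dots> = real n powr (\<gamma> * P) * \<bar>spline_error n t\<bar> powr P"
      by (simp add: powr_mult powr_powr spline_error_def)
    finally show ?thesis using True by (simp add: ennreal_mult')
  next
    case False
    have "t \<notin> {T n (j - 1)<..T n j}" if "j \<in> {1..n}" for j
      using False width(3,4)[of j n] that by auto
    then have "(\<Sum>j\<in>{1..n}. ennreal (F j t)) = 0" by (intro sum.neutral ballI) (simp add: F_def)
    moreover have "t \<notin> {0..1}" using False t0 by auto
    then have "indicator {0..1} t = (0 :: ennreal)" by (auto simp: indicator_def)
    ultimately show ?thesis by (simp only: mult_zero_right)
  qed
  have "ennreal (real n powr (\<gamma> * P)) * (\<integral>\<^sup>+t\<in>{0..1}. ennreal (\<bar>spline_error n t\<bar> powr P) \<partial>lborel)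
    = (\<integral>\<^sup>+t. (\<Sum>j\<in>{1..n}. ennreal (F j t)) \<partial>lborel)"
  proof -
    have n0: "0 < real n powr (\<gamma> * P)" using n by simp
    have AE0: "AE t in lborel. t \<noteq> (0::real)" by (rule AE_lborel_singleton)
    have e2: "ennreal (\<bar>spline_error n t\<bar> powr P) * indicator {0..1} t = ennreal (1 / real n powr (\<gamma> * P)) * (\<Sum>j\<in>{1..n}. ennreal (F j t))"
      if "t \<noteq> 0" for t
      unfolding eq[OF that, symmetric] mult.assoc[symmetric] ennreal_mult'[symmetric]
      using n0 by (simp add: ennreal_mult'[symmetric])
    have "(\<integral>\<^sup>+t\<in>{0..1}. ennreal (\<bar>spline_error n t\<bar> powr P) \<partial>lborel)
      = (\<integral>\<^sup>+t. ennreal (1 / real n powr (\<gamma> * P)) * (\<Sum>j\<in>{1..n}. ennreal (F j t)) \<partial>lborel)"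
      by (rule nn_integral_cong_AE) (use AE0 e2 in \<open>auto elim: eventually_mono\<close>)
    also have "\<dots> = ennreal (1 / real n powr (\<gamma> * P)) * (\<integral>\<^sup>+t. (\<Sum>j\<in>{1..n}. ennreal (F j t)) \<partial>lborel)"
      using F(1) by (intro nn_integral_cmult borel_measurable_sum) auto
    finally show ?thesis using n0 by (simp add: mult.assoc[symmetric] ennreal_mult'[symmetric])
  qed
  also have "\<dots> = (\<Sum>j\<in>{1..n}. \<integral>\<^sup>+t. ennreal (F j t) \<partial>lborel)"
    using F(1) by (intro nn_integral_sum) auto
  also have "\<dots> = (\<Sum>j\<in>{1..n}. ennreal (width n j * piece_integral n j))"
    using F(2) by (intro sum.cong) auto
  also have "\<dots> = ennreal (\<Sum>j\<in>{1..n}. width n j * piece_integral n j)"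
  proof (rule sum_ennreal)
    fix j assume "j \<in> {1..n}"
    then show "0 \<le> width n j * piece_integral n j"
      using width(1)[of j n] piece_integral_nonneg[of n j] by (auto intro!: mult_nonneg_nonneg)
  qed
  also have "(\<Sum>j\<in>{1..n}. width n j * piece_integral n j) = width n 1 * piece_integral n 1 + (\<Sum>j\<in>{2..n}. width n j * piece_integral n j)"
    using n by (simp add: sum.atLeast_Suc_atMost numeral_2_eq_2)
  finally show ?thesis by (simp only: step_integral(2)[OF n])
qed

text \<open>
  For fixed \<open>t\<close> the residuals on the intervals containing \<open>t\<close> converge uniformly to \<open>\<psi> t * b\<close>.
\<close>

lemma piece_integral_limit:
  assumes t: "t \<in> {0<..1}"
  shows "(\<lambda>n. step n t) \<longlonglongrightarrow> \<psi> t powr P * limit_const"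
proof -
  obtain b0 where b0: "0 < b0" "\<And>x. x \<in> {0..1} \<Longrightarrow> \<bar>b x\<bar> \<le> b0"
    using continuous_on_Icc_bounded[OF fbm_residual_continuous[OF B \<beta>(1) k2]] by blast
  have "\<forall>\<^sub>F n in sequentially. (\<forall>x\<in>{0..1}. \<bar>real n powr \<gamma> * residual n (idx n t) x - \<psi> t * b x\<bar> \<le> 1)
      \<and> 1 \<le> n \<and> 2 \<le> idx n t"
    using residual_pointwise[OF t zero_less_one] idx_eventually[OF t] by eventually_elim blast
  then obtain n0 where n0: "\<And>n x. n0 \<le> n \<Longrightarrow> x \<in> {0..1} \<Longrightarrow> \<bar>real n powr \<gamma> * residual n (idx n t) x - \<psi> t * b x\<bar> \<le> 1"
      "\<And>n. n0 \<le> n \<Longrightarrow> 1 \<le> n \<and> 2 \<le> idx n t"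
    unfolding eventually_sequentially by blast
  define C where "C = (\<psi> t * b0 + 1) powr P"
  have "(\<lambda>i. \<integral>x. indicator {0..1} x *\<^sub>R piece (i + n0) (idx (i + n0) t) x \<partial>lborel)
      \<longlonglongrightarrow> (\<integral>x. indicator {0..1} x *\<^sub>R (\<psi> t * b x) powr P \<partial>lborel)"
  proof (rule integral_dominated_convergence[where w="\<lambda>x. indicator {0..1} x * C"])
    have "continuous_on {0..1} (\<lambda>x. (\<psi> t * b x) powr P)"
      using fbm_residual_continuous[OF B \<beta>(1) k2] P \<psi>_pos[OF t]
      by (intro continuous_on_powr' continuous_on_mult continuous_on_const) (auto intro: mult_nonneg_nonneg)
    from borel_measurable_continuous_on_indicator[OF _ this]
    show "(\<lambda>x. indicator {0..1} x *\<^sub>R (\<psi> t * b x) powr P) \<in> borel_measurable lborel" by simp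
    show "(\<lambda>x. indicator {0..1} x *\<^sub>R piece (i + n0) (idx (i + n0) t) x) \<in> borel_measurable lborel" for i
    proof -
      have "1 \<le> i + n0" using n0(2)[of "i + n0"] by simp
      from borel_measurable_continuous_on_indicator[OF _ piece_continuous[OF idx(1,2)[OF t this]]]
      show ?thesis by simp
    qed
    show "integrable lborel (\<lambda>x. indicator {0..1::real} x * C)" by (intro integrable_mult_left integrable_real_indicator) auto
    show "AE x in lborel. (\<lambda>i. indicator {0..1} x *\<^sub>R piece (i + n0) (idx (i + n0) t) x) \<longlonglongrightarrow> indicator {0..1} x *\<^sub>R (\<psi> t * b x) powr P"
    proof (rule AE_I2)
      fix x :: real
      show "(\<lambda>i. indicator {0..1} x *\<^sub>R piece (i + n0) (idx (i + n0) t) x) \<longlonglongrightarrow> indicator {0..1} x *\<^sub>R (\<psi> t * b x) powr P"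
      proof (cases "x \<in> {0..1}")
        case True
        have "(\<lambda>n. real n powr \<gamma> * residual n (idx n t) x) \<longlonglongrightarrow> \<psi> t * b x"
        proof (rule tendstoI)
          fix e :: real assume "0 < e"
          then have "0 < e / 2" by simp
          from residual_pointwise[OF t this]
          show "\<forall>\<^sub>F n in sequentially. dist (real n powr \<gamma> * residual n (idx n t) x) (\<psi> t * b x) < e"
            by eventually_elim (use True \<open>0 < e\<close> in \<open>fastforce simp: dist_real_def\<close>)
        qed
        then have "(\<lambda>n. piece n (idx n t) x) \<longlonglongrightarrow> (\<psi> t * b x) powr P"
          unfolding piece_def using P by (intro tendsto_powr2 tendsto_const) auto
        then have "(\<lambda>i. piece (i + n0) (idx (i + n0) t) x) \<longlonglongrightarrow> (\<psi> t * b x) powr P"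
          by (rule LIMSEQ_ignore_initial_segment)
        then show ?thesis using True by simp
      qed simp
    qed
    show "AE x in lborel. norm (indicator {0..1} x *\<^sub>R piece (i + n0) (idx (i + n0) t) x) \<le> indicator {0..1} x * C" for i
    proof (rule AE_I2)
      fix x :: real
      have "piece (i + n0) (idx (i + n0) t) x \<le> C" if x: "x \<in> {0..1}"
      proof -
        have "\<psi> t * b x \<le> \<psi> t * b0" using b0(2)[OF x] \<psi>_pos[OF t] by (intro mult_left_mono) auto
        moreover have "\<bar>real (i + n0) powr \<gamma> * residual (i + n0) (idx (i + n0) t) x - \<psi> t * b x\<bar> \<le> 1"
          using x by (intro n0(1)) auto
        ultimately have "real (i + n0) powr \<gamma> * residual (i + n0) (idx (i + n0) t) x \<le> \<psi> t * b0 + 1" by linarith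
        then show ?thesis unfolding piece_def C_def using P by (intro powr_mono2) auto
      qed
      then show "norm (indicator {0..1} x *\<^sub>R piece (i + n0) (idx (i + n0) t) x) \<le> indicator {0..1} x * C"
        by (auto simp: indicator_def)
    qed
  qed
  also have "(\<lambda>i. \<integral>x. indicator {0..1} x *\<^sub>R piece (i + n0) (idx (i + n0) t) x \<partial>lborel) = (\<lambda>i. step (i + n0) t)"
    using n0(2) t by (auto simp: step_def piece_integral_def set_lebesgue_integral_def)
  also have "(\<integral>x. indicator {0..1} x *\<^sub>R (\<psi> t * b x) powr P \<partial>lborel) = \<psi> t powr P * limit_const"
  proof -
    have "indicator {0..1} x *\<^sub>R (\<psi> t * b x) powr P = \<psi> t powr P * (indicator {0..1} x *\<^sub>R b x powr P)" for x
      using \<psi>_pos[OF t] by (simp add: powr_mult)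
    then show ?thesis
      unfolding limit_const_def set_lebesgue_integral_def by (simp only: integral_mult_right_zero)
  qed
  finally show ?thesis by (rule LIMSEQ_offset)
qed

text \<open>
  For \<open>t\<close> near \<open>0\<close> both \<open>V\<close> and \<open>g\<close> are moved to the common argument \<open>H t\<close> by regular variation, which
  yields the integrable function of the hypothesis; elsewhere the residuals are bounded by a
  constant.
\<close>

lemma majorant_exists:
  assumes a: "0 < a" "a \<le> 1" and r: "regularly_varying_0 r \<rho>" and g_le: "\<And>s. s \<in> {0<..a} \<Longrightarrow> g s \<le> r s"
    and a': "a' \<in> {0<..1}" and R: "regularly_varying_0 R \<rho>'"
    and V_le: "\<And>s. s \<in> {0<..a'} \<Longrightarrow> sqrt (V (quantile_of h s)) \<le> R s"
    and b': "b' \<in> {0<..1}" and Lp: "in_Lp P {0<..b'} (\<lambda>t. R (cdf_of h t) * r (cdf_of h t) powr \<gamma>)"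
  shows "\<exists>W. integrable lebesgue W \<and> (\<forall>t. 0 \<le> W t) \<and>
    (\<forall>n\<ge>1. \<forall>t\<in>{0<..1}. 2 \<le> idx n t \<longrightarrow> (\<forall>x\<in>{0..1}. piece n (idx n t) x \<le> W t))"
proof -
  let ?H = "cdf_of h"
  have "continuous_on {0<..a} g" using quantile_density_continuous[OF h] by (rule continuous_on_subset) (use a in auto)
  then obtain C1 s1 where C1: "0 < C1" "0 < s1" "\<And>s. 0 < s \<Longrightarrow> s < s1 \<Longrightarrow> 0 < r s"
      "\<And>s x. 0 < s \<Longrightarrow> s < s1 \<Longrightarrow> x \<in> {s / 2..2 * s} \<Longrightarrow> g x \<le> C1 * r s"
    using regularly_varying_0_majorant_bound[OF r a(1) _ g_le] by blast
  have cont: "continuous_on {0<..a'} (\<lambda>s. sqrt (V (quantile_of h s)))"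
  proof (rule continuous_on_real_sqrt, rule continuous_on_compose2[OF V_cont])
    show "continuous_on {0<..a'} (quantile_of h)"
      using quantile_of_continuous[OF h] by (rule continuous_on_subset) (use a' in auto)
    show "quantile_of h ` {0<..a'} \<subseteq> {0<..1}"
    proof (rule image_subsetI)
      fix s assume "s \<in> {0<..a'}"
      then show "quantile_of h s \<in> {0<..1}" using a' by (intro quantile_of_pos[OF h]) auto
    qed
  qed
  have "0 < a'" using a' by simp
  from regularly_varying_0_majorant_bound[OF R this cont V_le] obtain C2 s2 where C2: "0 < C2" "0 < s2" "\<And>s. 0 < s \<Longrightarrow> s < s2 \<Longrightarrow> 0 < R s"
      "\<And>s x. 0 < s \<Longrightarrow> s < s2 \<Longrightarrow> x \<in> {s / 2..2 * s} \<Longrightarrow> sqrt (V (quantile_of h x)) \<le> C2 * R s"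
    by blast
  \<comment> \<open>Below \<open>s0\<close> both regular variation bounds hold and \<open>t\<close> lies in the interval of integrability.\<close>
  define s0 where "s0 = min (min s1 s2) (?H b')"
  have s0: "0 < s0" "s0 \<le> s1" "s0 \<le> s2" "s0 \<le> ?H b'" "s0 \<le> 1"
    using C1(2) C2(2) cdf_of_pos[OF h b'] cdf_of_in[OF h, of b'] b' by (auto simp: s0_def)
  define v0 where "v0 = quantile_of h (s0 / 2)"
  have v0: "v0 \<in> {0<..1}" "?H v0 = s0 / 2"
    using quantile_of_pos[OF h, of "s0 / 2"] cdf_of_quantile[OF h, of "s0 / 2"] s0 by (auto simp: v0_def)
  have "continuous_on {v0..1} V" using V_cont by (rule continuous_on_subset) (use v0 in auto)
  then obtain CV where CV: "0 < CV" "\<And>v. v \<in> {v0..1} \<Longrightarrow> \<bar>V v\<bar> \<le> CV" using continuous_on_Icc_bounded by blast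
  obtain G where G: "0 < G" "\<And>s. s \<in> {0..1} \<Longrightarrow> \<bar>g s\<bar> \<le> G"
    using continuous_on_Icc_bounded[OF quantile_density_continuous[OF h]] by blast
  let ?h = "sqrt (hermite_bound k)"
  have hb: "0 < ?h" using hermite_bound(1)[OF odd_k] by simp
  define A1 where "A1 = (?h * (C2 * C1 powr \<gamma>)) powr P"
  define A2 where "A2 = (?h * (sqrt CV * G powr \<gamma>)) powr P"
  let ?w = "\<lambda>t. R (?H t) * r (?H t) powr \<gamma>"
  define W where "W t = indicator {0<..b'} t *\<^sub>R (\<bar>?w t\<bar> powr P) * A1 + indicator {0<..1} t * A2" for t :: real
  have "integrable lebesgue W"
  proof -
    have "integrable lebesgue (\<lambda>t. indicator {0<..b'} t *\<^sub>R (\<bar>?w t\<bar> powr P))"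
      using Lp by (simp add: in_Lp_def set_integrable_def)
    moreover have "integrable lebesgue (indicator {0<..1::real} :: real \<Rightarrow> real)"
      by (rule integrable_real_indicator) auto
    ultimately show ?thesis unfolding W_def by (intro Bochner_Integration.integrable_add integrable_mult_left)
  qed
  moreover have "0 \<le> W t" for t by (simp add: W_def A1_def A2_def)
  moreover have "piece n (idx n t) x \<le> W t"
    if n: "1 \<le> n" and t: "t \<in> {0<..1}" and j2: "2 \<le> idx n t" and x: "x \<in> {0..1}" for n t x
  proof -
    define j where "j = idx n t"
    note i = idx[OF t n, folded j_def]
    have j: "2 \<le> j" "j \<le> n" using j2 i by (auto simp: j_def)
    obtain v \<xi> where v: "v \<in> {T n (j - 1)..T n j}" and \<xi>: "\<xi> \<in> {real (j - 1) / real n..real j / real n}"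
      and le: "real n powr \<gamma> * residual n j x \<le> ?h * (sqrt (V v) * g \<xi> powr \<gamma>)"
      using residual_dominated[OF j x] by blast
    have "t \<in> {T n (j - 1)..T n j}" using i by auto
    note ct = cdf_between[OF i(1,2) this] and cv = cdf_between[OF i(1,2) v]
    note h\<xi> = half_double[OF j ct(2) \<xi>] and hv = half_double[OF j ct(2) cv(2)]
    have \<xi>1: "\<xi> \<in> {0..1}" using half_double(2,3)[OF j \<xi> \<xi>] by simp
    have g0: "0 \<le> g \<xi>" by (rule g_nonneg[OF \<xi>1])
    have v1: "v \<in> {0<..1}" using half_double(2)[OF j cv(2) cv(2)] cv(1) cdf_of_0[OF h] by (cases "v = 0") auto
    have Vv: "0 < V v" by (rule V_pos[OF v1])
    have p1: "piece n j x \<le> (?h * (sqrt (V v) * g \<xi> powr \<gamma>)) powr P"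
      unfolding piece_def using le P by (intro powr_mono2) auto
    show ?thesis
    proof (cases "?H t < s0")
      case True
      then have "?H t < ?H b'" using s0 by simp
      then have tb: "t \<in> {0<..b'}" using cdf_of_less_iff[OF h, of t b'] t b' by auto
      have s: "0 < ?H t" "?H t < s1" "?H t < s2" using h\<xi>(2) True s0 by auto
      have "g \<xi> powr \<gamma> \<le> (C1 * r (?H t)) powr \<gamma>"
        using C1(4)[OF s(1,2) h\<xi>(1)] g0 \<gamma>_pos by (intro powr_mono2) auto
      also have "\<dots> = C1 powr \<gamma> * r (?H t) powr \<gamma>" using C1(1) C1(3)[OF s(1,2)] by (simp add: powr_mult)
      finally have 1: "g \<xi> powr \<gamma> \<le> C1 powr \<gamma> * r (?H t) powr \<gamma>" .
      have 2: "sqrt (V v) \<le> C2 * R (?H t)"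
        using C2(4)[OF s(1,3) hv(1)] quantile_of_cdf[OF h cv(1)] by simp
      have R0: "0 < R (?H t)" by (rule C2(3)[OF s(1,3)])
      have "sqrt (V v) * g \<xi> powr \<gamma> \<le> (C2 * R (?H t)) * (C1 powr \<gamma> * r (?H t) powr \<gamma>)"
        using 1 2 Vv C2(1) R0 by (intro mult_mono) auto
      then have "?h * (sqrt (V v) * g \<xi> powr \<gamma>) \<le> ?h * ((C2 * R (?H t)) * (C1 powr \<gamma> * r (?H t) powr \<gamma>))"
        using hb by (intro mult_left_mono) auto
      also have "\<dots> = ?h * (C2 * C1 powr \<gamma>) * \<bar>?w t\<bar>" using R0 by (simp add: abs_mult)
      finally have "(?h * (sqrt (V v) * g \<xi> powr \<gamma>)) powr P \<le> (?h * (C2 * C1 powr \<gamma>) * \<bar>?w t\<bar>) powr P"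
        using hb Vv P by (intro powr_mono2) auto
      also have "\<dots> = A1 * \<bar>?w t\<bar> powr P" unfolding A1_def using hb C2(1) by (intro powr_mult)
      also have "\<dots> \<le> W t" using tb by (simp add: W_def A2_def)
      finally show ?thesis using p1 by (simp add: j_def)
    next
      case False
      have "?H v0 \<le> ?H v" using hv(1) False v0(2) by simp
      then have "v \<in> {v0..1}" using cdf_of_le_iff[OF h, of v0 v] v0(1) v1 by auto
      then have "sqrt (V v) \<le> sqrt CV" using CV(2)[of v] by auto
      moreover have "g \<xi> powr \<gamma> \<le> G powr \<gamma>" using G(2)[OF \<xi>1] g0 \<gamma>_pos by (intro powr_mono2) auto
      ultimately have "sqrt (V v) * g \<xi> powr \<gamma> \<le> sqrt CV * G powr \<gamma>" using Vv CV(1) by (intro mult_mono) auto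
      then have "?h * (sqrt (V v) * g \<xi> powr \<gamma>) \<le> ?h * (sqrt CV * G powr \<gamma>)" using hb by (intro mult_left_mono) auto
      then have "(?h * (sqrt (V v) * g \<xi> powr \<gamma>)) powr P \<le> A2"
        unfolding A2_def using hb Vv P by (intro powr_mono2) auto
      also have "A2 \<le> W t" using t by (simp add: W_def A1_def)
      finally show ?thesis using p1 by (simp add: j_def)
    qed
  qed
  ultimately show ?thesis by blast
qed

text \<open>
  Dominated convergence for the step functions.  The majorant is measurable for the completed
  measure, so the convergence theorem is applied there; the step functions and their limit are
  Borel functions, for which the two integrals agree.
\<close>

lemma Lp_limit_of_error:
  assumes first: "(\<lambda>n. real n powr \<gamma> * T n 1 powr (real l + \<alpha> + 1 / P)) \<longlonglongrightarrow> 0"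
    and W: "integrable lebesgue W" "\<And>t. 0 \<le> W t"
    and dom: "\<And>n t x. 1 \<le> n \<Longrightarrow> t \<in> {0<..1} \<Longrightarrow> 2 \<le> idx n t \<Longrightarrow> x \<in> {0..1} \<Longrightarrow> piece n (idx n t) x \<le> W t"
  defines "L \<equiv> Lp_norm (ereal P) {0..1} b * Lp_norm (ereal P) {0<..1} \<psi>"
  shows "(\<lambda>n. ennreal (real n powr \<gamma>) * Lp_norm (ereal P) {0..1} (spline_error n)) \<longlonglongrightarrow> L"
    "0 < L" "L < \<infinity>"
proof -
  define \<Psi> where "\<Psi> = (\<integral>t. indicator {0<..1} t * \<psi> t powr P \<partial>lborel)"
  have \<psi>m: "(\<lambda>t. indicator {0<..1} t * \<psi> t powr P) \<in> borel_measurable borel"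
  proof -
    have "continuous_on {0<..1} (\<lambda>t. \<psi> t powr P)"
      using \<psi>_cont \<psi>_pos P by (intro continuous_on_powr') (auto simp: less_imp_le)
    from borel_measurable_continuous_on_indicator[OF _ this] show ?thesis by simp
  qed
  have step_le: "\<bar>step n t\<bar> \<le> W t" if n: "1 \<le> n" for n t
  proof (cases "t \<in> {0<..1} \<and> 2 \<le> idx n t")
    case True
    then have "piece_integral n (idx n t) \<le> W t"
      unfolding piece_integral_def using idx[of t n] n
      by (intro set_integral_unit_le piece_continuous dom) auto
    then show ?thesis using True piece_integral_nonneg[of n "idx n t"] by (simp add: step_def)
  qed (use W(2) in \<open>auto simp: step_def\<close>)
  have sm: "step n \<in> borel_measurable lebesgue" if "1 \<le> n" for n
    using step_integral(1)[OF that] by (intro measurable_completion) simp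
  have DC: "integrable lebesgue (\<lambda>t. indicator {0<..1} t * \<psi> t powr P * limit_const)"
    "(\<lambda>i. \<integral>t. step (i + 1) t \<partial>lebesgue) \<longlonglongrightarrow> (\<integral>t. indicator {0<..1} t * \<psi> t powr P * limit_const \<partial>lebesgue)"
  proof -
    have 1: "(\<lambda>t. indicator {0<..1} t * \<psi> t powr P * limit_const) \<in> borel_measurable lebesgue"
    proof (rule measurable_completion)
      show "(\<lambda>t. indicator {0<..1} t * \<psi> t powr P * limit_const) \<in> borel_measurable lborel"
        using borel_measurable_times[OF \<psi>m borel_measurable_const] by simp
    qed
    have 2: "step (i + 1) \<in> borel_measurable lebesgue" for i by (rule sm) simp
    have 3: "AE t in lebesgue. (\<lambda>i. step (i + 1) t) \<longlonglongrightarrow> indicator {0<..1} t * \<psi> t powr P * limit_const"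
    proof (rule AE_I2)
      fix t :: real
      show "(\<lambda>i. step (i + 1) t) \<longlonglongrightarrow> indicator {0<..1} t * \<psi> t powr P * limit_const"
      proof (cases "t \<in> {0<..1}")
        case True
        from LIMSEQ_ignore_initial_segment[OF piece_integral_limit[OF True], of 1] True show ?thesis by simp
      qed (simp add: step_def)
    qed
    have 4: "AE t in lebesgue. norm (step (i + 1) t) \<le> W t" for i using step_le by simp
    show "integrable lebesgue (\<lambda>t. indicator {0<..1} t * \<psi> t powr P * limit_const)"
      by (rule integrable_dominated_convergence[OF 1 2 W(1) 3 4])
    show "(\<lambda>i. \<integral>t. step (i + 1) t \<partial>lebesgue) \<longlonglongrightarrow> (\<integral>t. indicator {0<..1} t * \<psi> t powr P * limit_const \<partial>lebesgue)"
      by (rule integral_dominated_convergence[OF 1 2 W(1) 3 4])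
  qed
  have "integrable lborel (\<lambda>t. indicator {0<..1} t * \<psi> t powr P * limit_const)"
    using DC(1) \<psi>m by (subst (asm) integrable_completion) auto
  then have \<psi>i: "integrable lborel (\<lambda>t. indicator {0<..1} t * \<psi> t powr P)"
    using limit_const_pos by simp
  have "(\<integral>t. indicator {0<..1} t * \<psi> t powr P * limit_const \<partial>lebesgue) = \<Psi> * limit_const"
    using \<psi>m by (subst integral_completion) (auto simp: \<Psi>_def)
  moreover have "(\<integral>t. step (i + 1) t \<partial>lebesgue) = (\<integral>t. step (i + 1) t \<partial>lborel)" for i
    using step_integral(1)[of "i + 1"] by (intro integral_completion) simp
  ultimately have "(\<lambda>i. \<integral>t. step (i + 1) t \<partial>lborel) \<longlonglongrightarrow> \<Psi> * limit_const" using DC(2) by (simp only:)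
  then have lim: "(\<lambda>n. \<integral>t. step n t \<partial>lborel) \<longlonglongrightarrow> \<Psi> * limit_const" by (rule LIMSEQ_offset)
  have \<Psi>: "0 < \<Psi>"
  proof -
    have "\<Psi> \<noteq> 0"
    proof
      assume "\<Psi> = 0"
      then have "AE t in lborel. indicator {0<..1} t * \<psi> t powr P = 0"
        unfolding \<Psi>_def using integral_nonneg_eq_0_iff_AE[OF \<psi>i] by simp
      then have "AE t in lborel. t \<notin> {0<..1::real}"
      proof eventually_elim
        case (elim t)
        then show ?case using \<psi>_pos[of t] by (auto simp: indicator_def)
      qed
      then have "{0<..1::real} \<in> null_sets lborel" by (subst AE_iff_null_sets) auto
      then show False by (simp add: null_sets_def)
    qed
    moreover have "0 \<le> \<Psi>" unfolding \<Psi>_def by (intro integral_nonneg_AE) auto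
    ultimately show ?thesis by simp
  qed
  have first': "(\<lambda>n. width n 1 * piece_integral n 1) \<longlonglongrightarrow> 0"
  proof -
    let ?c = "sqrt (hermite_bound q) * sqrt K"
    have c0: "0 \<le> ?c" using hermite_bound(1)[OF odd_q] K by simp
    have "(\<lambda>n. (?c powr P) * (real n powr \<gamma> * T n 1 powr (real l + \<alpha> + 1 / P)) powr P) \<longlonglongrightarrow> (?c powr P) * 0 powr P"
      using P by (intro tendsto_mult tendsto_const tendsto_powr2 first) auto
    then have z: "(\<lambda>n. (?c powr P) * (real n powr \<gamma> * T n 1 powr (real l + \<alpha> + 1 / P)) powr P) \<longlonglongrightarrow> 0" by simp
    have le: "norm (width n 1 * piece_integral n 1) \<le> (?c powr P) * (real n powr \<gamma> * T n 1 powr (real l + \<alpha> + 1 / P)) powr P"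
      if n: "1 \<le> n" for n
    proof -
      have w: "width n 1 = T n 1" "0 < T n 1"
        using width(1)[OF order_refl n] qRS_knots(1)[OF h T n] by (auto simp: width_def)
      have "piece_integral n 1 \<le> (real n powr \<gamma> * (?c * T n 1 powr (real l + \<alpha>))) powr P"
        unfolding piece_integral_def
      proof (rule set_integral_unit_le[OF piece_continuous[OF order_refl n]])
        fix x :: real assume "x \<in> {0..1}"
        then show "piece n 1 x \<le> (real n powr \<gamma> * (?c * T n 1 powr (real l + \<alpha>))) powr P"
          unfolding piece_def using residual_first[OF n, of x] P
          by (intro powr_mono2 mult_left_mono) (auto simp: mult.assoc)
      qed
      then have "T n 1 * piece_integral n 1 \<le> T n 1 * (real n powr \<gamma> * (?c * T n 1 powr (real l + \<alpha>))) powr P"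
        using w by (intro mult_left_mono) auto
      also have "T n 1 = (T n 1 powr (1 / P)) powr P" using w P by (simp add: powr_powr)
      also have "(T n 1 powr (1 / P)) powr P * (real n powr \<gamma> * (?c * ((T n 1 powr (1 / P)) powr P) powr (real l + \<alpha>))) powr P
        = (?c powr P) * (real n powr \<gamma> * T n 1 powr (real l + \<alpha> + 1 / P)) powr P"
      proof -
        have e: "(T n 1 powr (1 / P)) powr P = T n 1" using w P by (simp add: powr_powr)
        have "T n 1 powr (real l + \<alpha> + 1 / P) = T n 1 powr (real l + \<alpha>) * T n 1 powr (1 / P)" by (rule powr_add)
        then show ?thesis unfolding e using w c0 P
          by (simp add: powr_mult mult_ac e) (simp add: powr_powr)
      qed
      finally have "T n 1 * piece_integral n 1 \<le> (?c powr P) * (real n powr \<gamma> * T n 1 powr (real l + \<alpha> + 1 / P)) powr P"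
        using w P by (simp add: powr_powr)
      then show ?thesis using w piece_integral_nonneg[of n 1] by simp
    qed
    show ?thesis
      by (rule Lim_null_comparison[OF _ z]) (use le in \<open>auto simp: eventually_sequentially\<close>)
  qed
  define v where "v n = width n 1 * piece_integral n 1 + (\<integral>t. step n t \<partial>lborel)" for n
  have "v \<longlonglongrightarrow> 0 + \<Psi> * limit_const" unfolding v_def using first' lim by (rule tendsto_add)
  then have vlim: "v \<longlonglongrightarrow> \<Psi> * limit_const" by simp
  have v0: "0 \<le> v n" if n: "1 \<le> n" for n
    unfolding v_def step_integral(2)[OF n] using width(1)[of _ n] piece_integral_nonneg[of n] n
    by (intro add_nonneg_nonneg sum_nonneg mult_nonneg_nonneg) (auto intro: less_imp_le)
  have Pn: "P \<noteq> 0" using P by simp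
  have Lp: "Lp_norm (ereal P) I f = ennreal (J powr (1 / P))"
    if "(\<integral>\<^sup>+t\<in>I. ennreal (\<bar>f t\<bar> powr P) \<partial>lborel) = ennreal J" "0 \<le> J" for I f J
    using that by (simp add: Lp_norm_def Let_def)
  have main: "ennreal (real n powr \<gamma>) * Lp_norm (ereal P) {0..1} (spline_error n) = ennreal (v n powr (1 / P))"
    if n: "1 \<le> n" for n
  proof -
    let ?N = "real n powr (\<gamma> * P)"
    let ?J = "\<integral>\<^sup>+t\<in>{0..1}. ennreal (\<bar>spline_error n t\<bar> powr P) \<partial>lborel"
    have N0: "0 < ?N" using n by simp
    have e: "ennreal ?N * ?J = ennreal (v n)" unfolding v_def by (rule error_integral[OF n])
    have "?J = ennreal (1 / ?N) * (ennreal ?N * ?J)"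
      using N0 by (simp add: mult.assoc[symmetric] ennreal_mult'[symmetric])
    also have "\<dots> = ennreal (v n / ?N)" unfolding e using N0 v0[OF n] by (simp add: ennreal_mult'[symmetric])
    finally have "Lp_norm (ereal P) {0..1} (spline_error n) = ennreal ((v n / ?N) powr (1 / P))"
      using v0[OF n] by (intro Lp) auto
    moreover have "real n powr \<gamma> * (v n / ?N) powr (1 / P) = v n powr (1 / P)"
      using v0[OF n] n Pn by (simp add: powr_divide powr_powr)
    ultimately show ?thesis by (simp add: ennreal_mult'[symmetric])
  qed
  have "(\<lambda>n. v n powr (1 / P)) \<longlonglongrightarrow> (\<Psi> * limit_const) powr (1 / P)"
    using P by (intro tendsto_powr2 vlim tendsto_const) (auto simp: eventually_sequentially intro!: exI[of _ 1] v0)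
  then have "(\<lambda>n. ennreal (v n powr (1 / P))) \<longlonglongrightarrow> ennreal ((\<Psi> * limit_const) powr (1 / P))"
    by (rule tendsto_ennrealI)
  then have lim2: "(\<lambda>n. ennreal (real n powr \<gamma>) * Lp_norm (ereal P) {0..1} (spline_error n)) \<longlonglongrightarrow> ennreal ((\<Psi> * limit_const) powr (1 / P))"
    by (rule Lim_transform_eventually) (auto simp: eventually_sequentially main[symmetric] intro!: exI[of _ 1])
  have "Lp_norm (ereal P) {0..1} b = ennreal (limit_const powr (1 / P))"
  proof (rule Lp)
    have "set_integrable lborel {0..1} (\<lambda>x. b x powr P)" by (rule borel_integrable_atLeastAtMost'[OF b_powr_continuous])
    then have "(\<integral>\<^sup>+x. ennreal (indicator {0..1} x *\<^sub>R b x powr P) \<partial>lborel) = ennreal limit_const"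
      unfolding set_integrable_def limit_const_def set_lebesgue_integral_def
      by (intro nn_integral_eq_integral) auto
    moreover have "ennreal (indicator {0..1} x *\<^sub>R b x powr P) = ennreal (\<bar>b x\<bar> powr P) * indicator {0..1} x" for x
      by (simp add: indicator_def)
    ultimately show "(\<integral>\<^sup>+t\<in>{0..1}. ennreal (\<bar>b t\<bar> powr P) \<partial>lborel) = ennreal limit_const" by simp
  qed (use limit_const_pos in simp)
  moreover have "Lp_norm (ereal P) {0<..1} \<psi> = ennreal (\<Psi> powr (1 / P))"
  proof (rule Lp)
    have "(\<integral>\<^sup>+t. ennreal (indicator {0<..1} t * \<psi> t powr P) \<partial>lborel) = ennreal \<Psi>"
      unfolding \<Psi>_def using \<psi>i by (intro nn_integral_eq_integral) auto
    moreover have "ennreal (indicator {0<..1} t * \<psi> t powr P) = ennreal (\<bar>\<psi> t\<bar> powr P) * indicator {0<..1} t" for t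
      using \<psi>_pos[of t] by (auto simp: indicator_def)
    ultimately show "(\<integral>\<^sup>+t\<in>{0<..1}. ennreal (\<bar>\<psi> t\<bar> powr P) \<partial>lborel) = ennreal \<Psi>" by simp
  qed (use \<Psi> in simp)
  ultimately have L: "L = ennreal ((\<Psi> * limit_const) powr (1 / P))"
    unfolding L_def using \<Psi> limit_const_pos by (simp add: powr_mult ennreal_mult'[symmetric] mult.commute)
  show "(\<lambda>n. ennreal (real n powr \<gamma>) * Lp_norm (ereal P) {0..1} (spline_error n)) \<longlonglongrightarrow> L"
    using lim2 by (simp only: L)
  show "0 < L" "L < \<infinity>" using \<Psi> limit_const_pos by (auto simp: L)
qed

end

end

section \<open>The limit of the scaled error\<close>

theorem theorem1:
  fixes M :: "'a measure" and X :: "real \<Rightarrow> 'a \<Rightarrow> real"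
    and N :: "'b measure" and B :: "real \<Rightarrow> 'b \<Rightarrow> real"
    and p :: ereal and l m q k :: nat
    and \<alpha> \<beta> \<theta> K C a \<rho> :: real
    and c V h r :: "real \<Rightarrow> real" and T :: "nat \<Rightarrow> nat \<Rightarrow> real"
  assumes "prob_space M"
    and p: "1 \<le> p"
    and \<alpha>: "0 < \<alpha>" "\<alpha> \<le> 1" and \<beta>: "0 < \<beta>" "\<beta> \<le> 1"
    and smooth: "real l + \<alpha> \<le> real m + \<beta>"
    and K: "0 < K" and X0: "X \<in> class_C M l \<alpha> 0 1 (\<lambda>_. K)"
    and X1: "X \<in> class_CB M m \<beta> c V"
    and \<theta>: "\<beta> < \<theta>" "\<theta> \<le> 1" and C: "0 < C"
    and mean: "(\<lambda>t. \<integral>\<omega>. X t \<omega> \<partial>M) \<in> fun_class_C m \<theta> C"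
    and odd: "odd q" "odd k" and qk: "q \<le> k"
    and ex_deriv: "k \<le> 2 * m + 1" "q \<le> 2 * l + 1"
    and deg: "l \<le> q" "m \<le> k"
    and h: "design_density h" and T: "qRS h T"
    and r: "regularly_varying_0 r \<rho>"
    and a: "0 < a" "a \<le> 1" and g_le: "\<forall>s\<in>{0<..a}. quantile_density h s \<le> r s"
    and r_small: "r \<in> o[at_right 0](\<lambda>s. s powr
        ((real m + \<beta>) / (real l + \<alpha> + real_of_ereal (1 / p)) - 1))"
    and p_inf: "p = \<infinity> \<Longrightarrow>
        ((\<lambda>t. sqrt (V t) * r (cdf_of h t) powr (real m + \<beta>)) \<longlongrightarrow> 0) (at_right 0)"
    and p_fin: "p < \<infinity> \<Longrightarrow> \<exists>R \<rho>'. regularly_varying_0 R \<rho>' \<and>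
        (\<exists>a'\<in>{0<..1}. \<forall>s\<in>{0<..a'}. sqrt (V (quantile_of h s)) \<le> R s) \<and>
        (\<exists>b\<in>{0<..1}. in_Lp (real_of_ereal p) {0<..b}
           (\<lambda>t. R (cdf_of h t) * r (cdf_of h t) powr (real m + \<beta>)))"
    and B: "fractional_BM N \<beta> B"
  shows "let L = hermite_const N B m k p *
                 Lp_norm p {0<..1} (\<lambda>t. sqrt (c t) * h t powr (- (real m + \<beta>)))
         in (\<lambda>n. ennreal (real n powr (real m + \<beta>)) *
                 process_norm M p (\<lambda>t \<omega>. X t \<omega> - composite_hermite M q k (T n) X t \<omega>))
              \<longlonglongrightarrow> L \<and> 0 < L \<and> L < \<infinity>"
proof -
  have \<beta>1: "\<beta> < 1" using \<theta> by simp
  interpret S: composite_hermite_spline M X N B l m q k \<alpha> \<beta> K c V h T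
    by unfold_locales (use \<alpha> \<beta> \<beta>1 K X0 X1 odd ex_deriv deg h T B in auto)
  have \<gamma>: "real m + \<beta> = S.\<gamma>" by (simp add: S.\<gamma>_def)
  have const: "hermite_const N B m k p = Lp_norm p {0..1} S.b" by (rule hermite_const_eq[OF odd(2)])
  have weight: "(\<lambda>t. sqrt (c t) * h t powr (- S.\<gamma>)) = S.\<psi>" by (simp add: S.\<psi>_def[abs_def])
  have error: "process_norm M p (\<lambda>t \<omega>. X t \<omega> - composite_hermite M q k (T n) X t \<omega>)
      = Lp_norm p {0..1} (S.spline_error n)" for n
    by (simp add: process_norm_def S.spline_error_def[abs_def])
  have g_le': "S.g s \<le> r s" if "s \<in> {0<..a}" for s using g_le that by blast
  show ?thesis
  proof (cases "p = \<infinity>")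
    case True
    have "(\<lambda>n. real n powr S.\<gamma> * T n 1 powr (real l + \<alpha> + 0)) \<longlonglongrightarrow> 0"
      using r_small a(1) g_le' True by (intro S.first_interval_negligible[of 0 a r]) (auto simp: \<gamma>)
    then have first: "(\<lambda>n. real n powr S.\<gamma> * T n 1 powr (real l + \<alpha>)) \<longlonglongrightarrow> 0" by simp
    have tail: "\<exists>s0>0. \<forall>n. \<forall>j\<in>{2..n}. real j / real n < s0 \<longrightarrow>
        (\<forall>x\<in>{0..1}. real n powr S.\<gamma> * S.residual n j x \<le> \<epsilon>)" if "0 < \<epsilon>" for \<epsilon>
      by (rule S.residual_tail_uniform[OF a r g_le' p_inf[OF True, unfolded \<gamma>] that])
    show ?thesis
      using S.uniform_limit_of_error[OF first tail] True
      unfolding const error \<gamma> weight Let_def Lp_norm_def by simp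
  next
    case False
    then obtain P where pP: "p = ereal P" and P: "1 \<le> P" using p by (cases p) auto
    have "1 / p = ereal (1 / P)" using P unfolding pP by (simp add: one_ereal_def)
    then have "real_of_ereal (1 / p) = 1 / P" by simp
    then have first: "(\<lambda>n. real n powr S.\<gamma> * T n 1 powr (real l + \<alpha> + 1 / P)) \<longlonglongrightarrow> 0"
      using r_small a(1) g_le' P by (intro S.first_interval_negligible[of "1 / P" a r]) (auto simp: \<gamma>)
    have "p < \<infinity>" by (simp add: pP)
    from p_fin[OF this] obtain R \<rho>' a' b' where R: "regularly_varying_0 R \<rho>'"
      and a': "a' \<in> {0<..1}" and V_le: "\<forall>s\<in>{0<..a'}. sqrt (V (quantile_of h s)) \<le> R s"
      and b': "b' \<in> {0<..1}"
      and Lp: "in_Lp P {0<..b'} (\<lambda>t. R (cdf_of h t) * r (cdf_of h t) powr S.\<gamma>)"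
      unfolding pP \<gamma> by auto
    obtain W where W: "integrable lebesgue W" "\<And>t. 0 \<le> W t"
      and dom: "\<And>n t x. 1 \<le> n \<Longrightarrow> t \<in> {0<..1} \<Longrightarrow> 2 \<le> S.idx n t \<Longrightarrow> x \<in> {0..1} \<Longrightarrow> S.piece P n (S.idx n t) x \<le> W t"
      using S.majorant_exists[OF P a r g_le' a' R _ b' Lp] V_le by blast
    show ?thesis
      using S.Lp_limit_of_error[OF P first W dom]
      unfolding const error \<gamma> weight Let_def unfolding pP by simp
  qed
qed

end
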